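(* Let $\xi$ be a random variable with values in $\mathbb{Z}^2$, let $A\subset\mathbb{Z}^2$ be a finite set, let $\eta^{(x)}$, $x\in A$, be random variables with values in $\mathbb{Z}^2$, and let $X=(X(n))_{n\in\mathbb{N}_0}$ be the standard random walk perturbed on the set $A$, that is, the Markov chain on $\mathbb{Z}^2$ with transition probabilities $\mathbb{P}\{X(n+1)=y\mid X(n)=x\}=\mathbb{P}\{\xi=y-x\}$ if $x\notin A$ and $\mathbb{P}\{X(n+1)=y\mid X(n)=x\}=\mathbb{P}\{\eta^{(x)}=y-x\}$ if $x\in A$. Assume that $\mathbb{E}[\xi]=(0,0)$, $\mathbb{E}[|\xi|^2]<\infty$, that Condition $\mathcal{B}$ (defined in the context) holds, and that $$\max_{x\in A}\mathbb{P}\big\{\big|\eta^{(x)}\big|>t\big\}=o\Big(\frac{1}{\log t}\Big),\quad t\to\infty.$$ Then $$\Big(\frac{X(\lfloor nt\rfloor)}{\sqrt{n}}\Big)_{t\geq 0}\ \Rightarrow\ \big(W_\Gamma(t)\big)_{t\geq 0},\quad n\to\infty$$ (weak convergence) in the $J_1$-topology on $D([0,\infty),\mathbb{R}^2)$. Here $W_\Gamma=(W_\Gamma(t))_{t\ge 0}$ is a two-dimensional Wiener process with characteristic function $$\mathbb{E}\, e^{\mathrm{i}\langle z, W_\Gamma(t)\rangle}=e^{-\frac{\langle \Gamma z,z\rangle t}{2}},\quad z\in\mathbb{R}^2,$$ and $\Gamma$ is the (nondegenerate) covariance matrix of $\xi$.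
   Context: $\mathbb{N}_0=\{0,1,2,\dots\}$. $\langle\cdot,\cdot\rangle$ is the scalar product in $\mathbb{R}^2$. $D([0,\infty),\mathbb{R}^2)$ is the Skorokhod space of càdlàg functions from $[0,\infty)$ to $\mathbb{R}^2$. Let $\xi_1,\xi_2,\ldots$ be independent copies of $\xi$; the standard random walk is $S_\xi(0)=0$, $S_\xi(n)=\xi_1+\ldots+\xi_n$. The walk $S_\xi$ is called aperiodic if no proper subgroup of $\mathbb{Z}^2$ contains all $x\in\mathbb{Z}^2$ with $\mathbb{P}\{\xi=x\}>0$. Condition $\mathcal{B}$: the random walk $S_\xi$ is aperiodic and, for the Markov chain $X$, every state of $\mathbb{Z}^2\setminus A$ is accessible from every state of $A$. (Nondegeneracy of $\Gamma$ is a consequence of aperiodicity.) The initial state $X(0)$ is an arbitrary $\mathbb{Z}^2$-valued random variable. *)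

theory Defs
  imports
    "HOL-Probability.Probability"
    "HOL-Library.Landau_Symbols"
    "HOL-Algebra.Group"
begin

type_synonym Z2 = "int ^ 2"
type_synonym R2 = "real ^ 2"

definition rvec :: "Z2 \<Rightarrow> R2" where
  "rvec x = (\<chi> i. real_of_int (x $ i))"

definition Z2_group :: "Z2 monoid" where
  "Z2_group = \<lparr>carrier = UNIV, monoid.mult = (+), one = 0\<rparr>"


section \<open>Perturbed random walks\<close>

definition perturbed_kernel ::
    "'a measure \<Rightarrow> ('a \<Rightarrow> Z2) \<Rightarrow> (Z2 \<Rightarrow> 'b measure) \<Rightarrow> (Z2 \<Rightarrow> 'b \<Rightarrow> Z2) \<Rightarrow> Z2 set
      \<Rightarrow> Z2 \<Rightarrow> Z2 \<Rightarrow> real" where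
  "perturbed_kernel N \<xi> N' \<eta> A x y =
     (if x \<in> A then \<P>(\<omega> in N' x. \<eta> x \<omega> = y - x) else \<P>(\<omega> in N. \<xi> \<omega> = y - x))"

text \<open>The condition contains both the Markov property and the prescription of the
  transition probabilities; the law of the initial state \<open>X 0\<close> is left arbitrary.\<close>

definition markov_chain :: "'c measure \<Rightarrow> (nat \<Rightarrow> 'c \<Rightarrow> 's) \<Rightarrow> ('s \<Rightarrow> 's \<Rightarrow> real) \<Rightarrow> bool" where
  "markov_chain M X p \<longleftrightarrow>
     (\<forall>n. X n \<in> measurable M (count_space UNIV)) \<and>
     (\<forall>n h y. \<P>(\<omega> in M. \<forall>k\<le>n. X k \<omega> = h k) > 0 \<longrightarrow>
        \<P>(\<omega> in M. X (Suc n) \<omega> = y \<bar> \<forall>k\<le>n. X k \<omega> = h k) = p (h n) y)"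

primrec n_step :: "('s \<Rightarrow> 's \<Rightarrow> real) \<Rightarrow> nat \<Rightarrow> 's \<Rightarrow> 's \<Rightarrow> real" where
  "n_step p 0 x y = (if x = y then 1 else 0)"
| "n_step p (Suc n) x y = (\<Sum>\<^sub>\<infinity>z\<in>UNIV. p x z * n_step p n z y)"

definition accessible :: "('s \<Rightarrow> 's \<Rightarrow> real) \<Rightarrow> 's \<Rightarrow> 's \<Rightarrow> bool" where
  "accessible p x y \<longleftrightarrow> (\<exists>n. n_step p n x y > 0)"

definition aperiodic_walk :: "'a measure \<Rightarrow> ('a \<Rightarrow> Z2) \<Rightarrow> bool" where
  "aperiodic_walk N \<xi> \<longleftrightarrow>
     \<not> (\<exists>H. subgroup H Z2_group \<and> H \<noteq> UNIV \<and> {x. \<P>(\<omega> in N. \<xi> \<omega> = x) > 0} \<subseteq> H)"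

definition condition_B ::
    "'a measure \<Rightarrow> ('a \<Rightarrow> Z2) \<Rightarrow> (Z2 \<Rightarrow> 'b measure) \<Rightarrow> (Z2 \<Rightarrow> 'b \<Rightarrow> Z2) \<Rightarrow> Z2 set \<Rightarrow> bool" where
  "condition_B N \<xi> N' \<eta> A \<longleftrightarrow>
     aperiodic_walk N \<xi> \<and>
     (\<forall>x\<in>A. \<forall>y\<in>- A. accessible (perturbed_kernel N \<xi> N' \<eta> A) x y)"

definition covariance_matrix :: "'a measure \<Rightarrow> ('a \<Rightarrow> real ^ 'n) \<Rightarrow> real ^ 'n ^ 'n" where
  "covariance_matrix N Y =
     (\<chi> i j. \<integral>\<omega>. (Y \<omega> $ i - (\<integral>\<omega>'. Y \<omega>' $ i \<partial>N)) * (Y \<omega> $ j - (\<integral>\<omega>'. Y \<omega>' $ j \<partial>N)) \<partial>N)"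


section \<open>The space \<open>D([0,\<infinity>))\<close> with the \<open>J\<^sub>1\<close>-topology\<close>

text \<open>Functions on \<open>[0,\<infinity>)\<close> are represented by functions on the real line that are
  \<^const>\<open>extensional\<close> on \<open>{0..}\<close>, i.e. have a fixed dummy value at negative arguments.\<close>

definition cadlag_space :: "(real \<Rightarrow> 'a::metric_space) set" where
  "cadlag_space = {x \<in> extensional {0..}.
     (\<forall>t\<ge>0. (x \<longlongrightarrow> x t) (at_right t)) \<and> (\<forall>t>0. \<exists>l. (x \<longlongrightarrow> l) (at_left t))}"

text \<open>The metric is the one of Ethier and Kurtz (\<^emph>\<open>Markov Processes\<close>, Section 3.5):
  \[ d(x,y) = \inf_{\lambda} \max\Big(\gamma(\lambda),
      \int_0^\infty e^{-u} \sup_{t\ge 0} \min(1, |x(t\wedge u) - y(\lambda(t)\wedge u)|)\,du\Big),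
     \quad \gamma(\lambda) = \sup_{s>t\ge 0} \Big|\log\frac{\lambda(s)-\lambda(t)}{s-t}\Big|, \]
  the infimum being over the increasing bijections \<open>\<lambda>\<close> of \<open>[0,\<infinity>)\<close> with \<open>\<gamma>(\<lambda>) < \<infinity>\<close>.
  All suprema and infima below are over non-empty sets that are bounded on the relevant side.\<close>

definition log_slopes :: "(real \<Rightarrow> real) \<Rightarrow> real set" where
  "log_slopes l = {\<bar>ln ((l s - l t) / (s - t))\<bar> | s t. 0 \<le> t \<and> t < s}"

definition time_changes :: "(real \<Rightarrow> real) set" where
  "time_changes = {l. strict_mono_on {0..} l \<and> l ` {0..} = {0..} \<and> bdd_above (log_slopes l)}"

definition stopped_dist ::
    "(real \<Rightarrow> 'a::metric_space) \<Rightarrow> (real \<Rightarrow> 'a) \<Rightarrow> (real \<Rightarrow> real) \<Rightarrow> real \<Rightarrow> real" where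
  "stopped_dist x y l u = (SUP t\<in>{0..}. min 1 (dist (x (min t u)) (y (min (l t) u))))"

definition skorokhod_dist :: "(real \<Rightarrow> 'a::metric_space) \<Rightarrow> (real \<Rightarrow> 'a) \<Rightarrow> real" where
  "skorokhod_dist x y =
     (INF l\<in>time_changes. max (Sup (log_slopes l))
        (LINT u:{0..}|lborel. exp (- u) * stopped_dist x y l u))"

definition j1_open :: "(real \<Rightarrow> 'a::metric_space) set \<Rightarrow> bool" where
  "j1_open U \<longleftrightarrow> U \<subseteq> cadlag_space \<and>
     (\<forall>x\<in>U. \<exists>e>0. \<forall>y\<in>cadlag_space. skorokhod_dist x y < e \<longrightarrow> y \<in> U)"

definition j1_topology :: "(real \<Rightarrow> 'a::metric_space) topology" where
  "j1_topology = topology j1_open"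

lemma istopology_j1_open: "istopology j1_open"
  unfolding istopology_def
proof (intro conjI allI impI)
  fix S T :: "(real \<Rightarrow> 'a) set"
  assume S: "j1_open S" and T: "j1_open T"
  show "j1_open (S \<inter> T)"
    unfolding j1_open_def
  proof (intro conjI ballI)
    show "S \<inter> T \<subseteq> cadlag_space"
      using S by (auto simp: j1_open_def)
  next
    fix x assume "x \<in> S \<inter> T"
    then obtain d e where "d > 0" "e > 0"
      and "\<forall>y\<in>cadlag_space. skorokhod_dist x y < d \<longrightarrow> y \<in> S"
      and "\<forall>y\<in>cadlag_space. skorokhod_dist x y < e \<longrightarrow> y \<in> T"
      using S T unfolding j1_open_def by blast
    then show "\<exists>r>0. \<forall>y\<in>cadlag_space. skorokhod_dist x y < r \<longrightarrow> y \<in> S \<inter> T"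
      by (intro exI[of _ "min d e"]) auto
  qed
next
  fix K :: "(real \<Rightarrow> 'a) set set"
  assume K: "\<forall>S\<in>K. j1_open S"
  show "j1_open (\<Union>K)"
    unfolding j1_open_def
  proof (intro conjI ballI)
    show "\<Union>K \<subseteq> cadlag_space"
      using K by (auto simp: j1_open_def)
  next
    fix x assume "x \<in> \<Union>K"
    then obtain S where "S \<in> K" "x \<in> S" by blast
    with K show "\<exists>r>0. \<forall>y\<in>cadlag_space. skorokhod_dist x y < r \<longrightarrow> y \<in> \<Union>K"
      unfolding j1_open_def by (meson UnionI)
  qed
qed

lemma openin_j1_topology: "openin j1_topology U \<longleftrightarrow> j1_open U"
  unfolding j1_topology_def using istopology_j1_open topology_inverse' by metis

lemma topspace_j1_topology: "topspace j1_topology = cadlag_space"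
proof -
  have "j1_open (cadlag_space :: (real \<Rightarrow> 'a) set)"
    by (auto simp: j1_open_def intro: exI[of _ 1])
  then show ?thesis
    unfolding topspace_def openin_j1_topology by (auto simp: j1_open_def)
qed


section \<open>Weak convergence of random elements of a topological space\<close>

definition borel_of :: "'a topology \<Rightarrow> 'a measure" where
  "borel_of T = sigma (topspace T) {U. openin T U}"

definition converges_weakly ::
    "'s topology \<Rightarrow> 'c measure \<Rightarrow> (nat \<Rightarrow> 'c \<Rightarrow> 's) \<Rightarrow> 'd measure \<Rightarrow> ('d \<Rightarrow> 's) \<Rightarrow> bool" where
  "converges_weakly T M Y M' Z \<longleftrightarrow>
     (\<forall>n. Y n \<in> measurable M (borel_of T)) \<and>
     Z \<in> measurable M' (borel_of T) \<and>
     (\<forall>f. continuous_map T euclideanreal f \<and> bounded (f ` topspace T) \<longrightarrow>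
        (\<lambda>n. \<integral>\<omega>. f (Y n \<omega>) \<partial>M) \<longlonglongrightarrow> (\<integral>\<omega>. f (Z \<omega>) \<partial>M'))"

definition rescaled_path :: "(nat \<Rightarrow> 'c \<Rightarrow> Z2) \<Rightarrow> nat \<Rightarrow> 'c \<Rightarrow> real \<Rightarrow> R2" where
  "rescaled_path X n \<omega> =
     (\<lambda>t\<in>{0..}. (1 / sqrt (real n)) *\<^sub>R rvec (X (nat \<lfloor>real n * t\<rfloor>) \<omega>))"

definition sample_path :: "(real \<Rightarrow> 'd \<Rightarrow> 'a) \<Rightarrow> 'd \<Rightarrow> real \<Rightarrow> 'a" where
  "sample_path W \<omega> = (\<lambda>t\<in>{0..}. W t \<omega>)"


section \<open>Wiener processes\<close>

definition wiener_process :: "'d measure \<Rightarrow> (real \<Rightarrow> 'd \<Rightarrow> real ^ 'n) \<Rightarrow> real ^ 'n ^ 'n \<Rightarrow> bool" where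
  "wiener_process M W \<Gamma> \<longleftrightarrow>
     prob_space M \<and>
     (\<forall>t\<ge>0. W t \<in> borel_measurable M) \<and>
     (AE \<omega> in M. W 0 \<omega> = 0) \<and>
     (\<forall>\<omega>\<in>space M. continuous_on {0..} (\<lambda>t. W t \<omega>)) \<and>
     (\<forall>s :: nat \<Rightarrow> real. \<forall>n. mono s \<and> 0 \<le> s 0 \<longrightarrow>
        prob_space.indep_vars M (\<lambda>_. borel) (\<lambda>i \<omega>. W (s (Suc i)) \<omega> - W (s i) \<omega>) {..<n}) \<and>
     (\<forall>s t. 0 \<le> s \<and> s \<le> t \<longrightarrow>
        distr M borel (\<lambda>\<omega>. W t \<omega> - W s \<omega>) = distr M borel (W (t - s))) \<and>
     (\<forall>t\<ge>0. \<forall>z. (CLINT \<omega>|M. iexp (z \<bullet> W t \<omega>)) =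
        of_real (exp (- (((\<Gamma> *v z) \<bullet> z) * t / 2))))"

end

theory Submission
  imports Defs "HOL-Real_Asymp.Real_Asymp"
begin

text \<open>Off \<open>A\<close> the chain is a centred planar random walk, and such a walk avoids a finite set for \<open>n\<close> steps
  with probability at least of order \<open>1 / log n\<close>. Since every state outside \<open>A\<close> is accessible from \<open>A\<close>, the
  expected number of visits to \<open>A\<close> before time \<open>n\<close> is \<open>O(log n)\<close>, uniformly in the starting point. A visit
  changes the characteristic function at scale \<open>\<theta> / sqrt n\<close> by \<open>o(1 / log n)\<close>, by the tail condition on the
  \<open>\<eta>\<close>; hence all the visits together are negligible, and the characteristic functions of the increments of
  the chain converge to those of the Wiener process uniformly in the starting point. This gives both the
  finite-dimensional distributions and, through Ottaviani's inequality, tightness. Because the limit is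
  continuous, locally uniform distances suffice, and these control the Skorokhod distance by taking the
  identity as time change.\<close>

section \<open>Kernels on countable state spaces\<close>

text \<open>The jumps from A may have no moments at all, so neither martingales nor second moments
  of the chain are at hand; everything is expressed by bounded quantities, namely probabilities and
  characteristic functions. Nor are the increments independent. Uniformity in the starting point
  takes the place of independence, since it permits conditioning on the whole past.

  What the chain does inside A is uncontrolled. The visits are therefore bounded by an inequality
  that the worst expected number g satisfies by itself: g \<le> J + g (1 - p \<epsilon>), where p
  bounds from below the chance to reach within J steps a suitable point outside A, and \<epsilon>
  the chance to stay away from A from there on.

  The bound on \<epsilon> reverses an upper bound. The mass of the walk at a point after k steps is
  O(1 / k), with sum O(log n), and the last-exit identity says that these masses, multiplied by
  escape probabilities, add up to 1; so some escape probability is at least of order 1 / log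
  n.\<close>

lemma integrable_measure_pmf_bounded:
  fixes f :: "'a \<Rightarrow> 'b::{banach, second_countable_topology}"
  assumes "\<And>x. norm (f x) \<le> C"
  shows "integrable (measure_pmf p) f"
  using assms by (intro measure_pmf.integrable_const_bound[where B = C]) auto

lemma norm_integral_pmf_le:
  fixes f :: "'a \<Rightarrow> 'b::{banach, second_countable_topology}"
  assumes "\<And>x. norm (f x) \<le> C"
  shows "norm (\<integral>x. f x \<partial>measure_pmf p) \<le> C"
proof -
  have "norm (\<integral>x. f x \<partial>measure_pmf p) \<le> (\<integral>x. norm (f x) \<partial>measure_pmf p)"
    by (rule integral_norm_bound)
  also have "\<dots> \<le> C"
    using integrable_measure_pmf_bounded[of f C p] assms
    by (intro measure_pmf.integral_le_const integrable_norm) auto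
  finally show ?thesis .
qed

lemma integral_bind_pmf_real:
  fixes f :: "'b \<Rightarrow> real"
  assumes "\<And>x. \<bar>f x\<bar> \<le> C"
  shows "(\<integral>y. f y \<partial>measure_pmf (bind_pmf p K)) = (\<integral>x. (\<integral>y. f y \<partial>measure_pmf (K x)) \<partial>measure_pmf p)"
  unfolding measure_pmf_bind
  by (rule integral_bind[where K = "count_space UNIV" and B = C and B' = 1])
     (use assms in \<open>auto simp: measure_pmf.emeasure_space_1[simplified] measure_pmf_in_subprob_algebra\<close>)

lemma integral_bind_pmf_complex:
  fixes f :: "'b \<Rightarrow> complex"
  assumes f: "\<And>x. norm (f x) \<le> C"
  shows "(\<integral>y. f y \<partial>measure_pmf (bind_pmf p K)) = (\<integral>x. (\<integral>y. f y \<partial>measure_pmf (K x)) \<partial>measure_pmf p)"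
proof -
  have int: "integrable (measure_pmf r) f" for r :: "'b pmf"
    by (rule integrable_measure_pmf_bounded[OF f])
  have n: "norm (\<integral>y. f y \<partial>measure_pmf r) \<le> C" for r :: "'b pmf"
    by (rule norm_integral_pmf_le[OF f])
  have int2: "integrable (measure_pmf p) (\<lambda>x. \<integral>y. f y \<partial>measure_pmf (K x))"
    by (rule integrable_measure_pmf_bounded[OF n])
  have re: "\<bar>Re (f x)\<bar> \<le> C" and im: "\<bar>Im (f x)\<bar> \<le> C" for x
    using f[of x] abs_Re_le_cmod[of "f x"] abs_Im_le_cmod[of "f x"] by linarith+
  show ?thesis
  proof (rule complex_eqI)
    show "Re (\<integral>y. f y \<partial>measure_pmf (bind_pmf p K)) = Re (\<integral>x. (\<integral>y. f y \<partial>measure_pmf (K x)) \<partial>measure_pmf p)"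
      by (simp only: integral_Re[OF int, symmetric] integral_Re[OF int2, symmetric] integral_bind_pmf_real[OF re])
    show "Im (\<integral>y. f y \<partial>measure_pmf (bind_pmf p K)) = Im (\<integral>x. (\<integral>y. f y \<partial>measure_pmf (K x)) \<partial>measure_pmf p)"
      by (simp only: integral_Im[OF int, symmetric] integral_Im[OF int2, symmetric] integral_bind_pmf_real[OF im])
  qed
qed

lemma measure_bind_pmf:
  "measure (measure_pmf (bind_pmf p K)) S = (\<integral>x. measure (measure_pmf (K x)) S \<partial>measure_pmf p)"
  using integral_bind_pmf_real[of "indicator S" 1 p K] by simp

section \<open>Iterated kernels and random walks as kernels\<close>

primrec kpow :: "('s \<Rightarrow> 's pmf) \<Rightarrow> nat \<Rightarrow> 's \<Rightarrow> 's pmf" where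
  "kpow K 0 x = return_pmf x"
| "kpow K (Suc n) x = bind_pmf (K x) (kpow K n)"

lemma kpow_add: "kpow K (m + n) x = bind_pmf (kpow K m x) (kpow K n)"
proof (induction m arbitrary: x)
  case (Suc m)
  have "kpow K (m + n) = (\<lambda>y. bind_pmf (kpow K m y) (kpow K n))"
    by (rule ext) (rule Suc.IH)
  then show ?case by (simp add: bind_assoc_pmf)
qed (simp add: bind_return_pmf)

text \<open>The recursion of \<open>kpow\<close> splits off the first step. Arguments that follow
  the current position, such as the comparison of characteristic functions along time, need the last
  step split off.\<close>

lemma kpow_Suc_right: "kpow K (Suc n) x = bind_pmf (kpow K n x) K"
proof -
  have "kpow K 0 = return_pmf"
    by (rule ext) simp
  then have "kpow K 1 = K"
    by (intro ext) (simp add: bind_return_pmf')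
  then show ?thesis
    using kpow_add[of K n 1 x] by simp
qed

definition walk :: "'g::ab_group_add pmf \<Rightarrow> 'g \<Rightarrow> 'g pmf" where
  "walk \<mu> x = map_pmf ((+) x) \<mu>"

lemma integral_walk:
  fixes f :: "'g::ab_group_add \<Rightarrow> 'b::{banach, second_countable_topology}"
  shows "(\<integral>y. f y \<partial>measure_pmf (walk \<mu> x)) = (\<integral>y. f (x + y) \<partial>measure_pmf \<mu>)"
  by (simp add: walk_def integral_map_pmf)

lemma bind_walk: "bind_pmf (walk \<mu> x) f = bind_pmf \<mu> (\<lambda>y. f (x + y))"
  by (simp add: walk_def bind_map_pmf)

lemma kpow_walk_translate:
  "kpow (walk \<mu>) n (x + v) = map_pmf (\<lambda>y. y + v) (kpow (walk \<mu>) n x)"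
proof (induction n arbitrary: x)
  case (Suc n)
  have "kpow (walk \<mu>) n (x + v + y) = map_pmf (\<lambda>y. y + v) (kpow (walk \<mu>) n (x + y))" for y
    using Suc.IH[of "x + y"] by (simp add: add_ac)
  then show ?case
    by (simp add: bind_walk map_bind_pmf)
qed simp


section \<open>Concentration of planar walks\<close>

text \<open>If \<open>x0\<close>, \<open>x0 + v1\<close>, \<open>x0 + v2\<close> are noncollinear atoms of the step law, a step is with probability \<open>q\<close> a fair
  choice between \<open>x0\<close> and \<open>x0 + v1\<close>, and with probability \<open>q\<close> a fair choice between \<open>x0\<close> and \<open>x0 + v2\<close>. The
  position after \<open>i\<close> steps of the first kind and \<open>j\<close> of the second has two independent binomial coordinates,
  so that no point has mass above \<open>1 / sqrt ((i + 1) (j + 1))\<close>; averaging over \<open>i\<close> and \<open>j\<close> gives a bound of order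
  \<open>1 / k\<close> after \<open>k\<close> steps.\<close>

definition bw :: "nat \<Rightarrow> nat \<Rightarrow> real" where
  "bw n k = real (n choose k) / 2 ^ n"

lemma bw_nonneg: "0 \<le> bw n k"
  by (simp add: bw_def)

text \<open>Consecutive central weights have ratio (2n + 1) / (2n + 2), and (2n + 1)(2n + 3) \<le>
  (2n + 2)^2, so the left-hand side does not increase with n. This is Wallis' bound by
  induction.\<close>

lemma bw_central_even: "(bw (2 * n) n)\<^sup>2 * (2 * real n + 1) \<le> 1"
proof (induction n)
  case (Suc n)
  have "Suc n * ((2 * Suc n) choose Suc n) = 2 * (2 * n + 1) * ((2 * n) choose n)"
  proof -
    have 1: "Suc n * ((2 * Suc n) choose Suc n) = (2 * Suc n) * ((2 * n + 1) choose n)"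
      using Suc_times_binomial_eq[of "2 * n + 1" n] by (simp add: mult.commute)
    have 2: "Suc n * ((2 * n + 1) choose n) = (2 * n + 1) * ((2 * n) choose n)"
    proof -
      have "((2 * n + 1) choose n) = ((2 * n + 1) choose Suc n)"
        using binomial_symmetric[of n "2 * n + 1"] by simp
      then show ?thesis
        using Suc_times_binomial_eq[of "2 * n" n] by (simp add: mult.commute)
    qed
    have "Suc n * (Suc n * ((2 * Suc n) choose Suc n)) = Suc n * (2 * (2 * n + 1) * ((2 * n) choose n))"
      unfolding 1 using 2 by (metis mult.assoc mult.left_commute)
    then show ?thesis by (metis mult_cancel1 nat.simps(3))
  qed
  then have "real (Suc n * ((2 * Suc n) choose Suc n)) = real (2 * (2 * n + 1) * ((2 * n) choose n))"
    by metis
  then have r: "(real n + 1) * real ((2 * Suc n) choose Suc n) = 2 * (2 * real n + 1) * real ((2 * n) choose n)"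
    by (simp only: of_nat_mult of_nat_add of_nat_Suc of_nat_numeral of_nat_1) (simp add: algebra_simps)
  have e: "bw (2 * Suc n) (Suc n) = (2 * real n + 1) / (2 * real n + 2) * bw (2 * n) n"
  proof -
    have "real ((2 * Suc n) choose Suc n) = 2 * (2 * real n + 1) * real ((2 * n) choose n) / (real n + 1)"
      using r by (simp add: field_simps)
    then have "bw (2 * Suc n) (Suc n) = 2 * (2 * real n + 1) * real ((2 * n) choose n) / (real n + 1) / 2 ^ (2 * Suc n)"
      by (simp only: bw_def)
    also have "\<dots> = (2 * real n + 1) / (2 * real n + 2) * bw (2 * n) n"
      by (simp add: bw_def divide_simps) (simp add: algebra_simps)
    finally show ?thesis .
  qed
  have "(bw (2 * Suc n) (Suc n))\<^sup>2 * (2 * real (Suc n) + 1) =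
      ((bw (2 * n) n)\<^sup>2 * (2 * real n + 1)) * ((2 * real n + 1) * (2 * real n + 3) / (2 * real n + 2)\<^sup>2)"
    unfolding e power_mult_distrib power_divide by (simp add: power2_eq_square field_simps)
  also have "\<dots> \<le> 1 * 1"
  proof (rule mult_mono)
    have "(2 * real n + 1) * (2 * real n + 3) \<le> (2 * real n + 2)\<^sup>2"
      by (simp add: power2_eq_square algebra_simps)
    then show "(2 * real n + 1) * (2 * real n + 3) / (2 * real n + 2)\<^sup>2 \<le> 1"
      by (simp add: divide_le_eq_1)
  qed (use Suc.IH in auto)
  finally show ?case by simp
qed (simp add: bw_def)

text \<open>The middle weight dominates its row. The two middle coefficients of row 2m + 1 are equal
  and add up to the central one of row 2m + 2, so an odd row inherits the bound of the next even
  row.\<close>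

lemma bw_le: "bw n k \<le> 1 / sqrt (real n + 1)"
proof -
  have "(bw n k)\<^sup>2 * (real n + 1) \<le> 1"
  proof -
    have 1: "bw n k \<le> bw n (n div 2)"
      unfolding bw_def by (intro divide_right_mono) (auto simp: binomial_maximum)
    have 2: "(bw n (n div 2))\<^sup>2 * (real n + 1) \<le> 1"
    proof (cases "even n")
      case True
      then obtain m where "n = 2 * m" by (elim evenE)
      then show ?thesis using bw_central_even[of m] by simp
    next
      case False
      then obtain m where n: "n = 2 * m + 1" by (elim oddE)
      have "(2 * Suc m) choose Suc m = 2 * ((2 * m + 1) choose m)"
        using binomial_symmetric[of m "2 * m + 1"] by simp
      then have "real ((2 * Suc m) choose Suc m) = 2 * real ((2 * m + 1) choose m)"
        by simp
      then have "bw (2 * Suc m) (Suc m) = bw n (n div 2)"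
        by (simp only: bw_def n) simp
      then show ?thesis
        using bw_central_even[of "Suc m"] mult_left_mono[of "real n + 1" "2 * real (Suc m) + 1" "(bw n (n div 2))\<^sup>2"]
        by (simp add: n)
    qed
    have "(bw n k)\<^sup>2 \<le> (bw n (n div 2))\<^sup>2"
      using 1 by (intro power_mono) (auto simp: bw_nonneg)
    then show ?thesis
      using 2 mult_right_mono[of "(bw n k)\<^sup>2" "(bw n (n div 2))\<^sup>2" "real n + 1"] by linarith
  qed
  then have "(bw n k)\<^sup>2 \<le> (1 / sqrt (real n + 1))\<^sup>2"
    by (simp add: power_divide field_simps)
  then show ?thesis
    by (rule power2_le_imp_le) simp
qed

text \<open>Pascal's rule for averages: one of the \<open>Suc i\<close> fair coins is tossed
  separately and shifts the argument by 0 or 1.\<close>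

lemma sum_bw_Suc:
  fixes F :: "nat \<Rightarrow> real"
  shows "(\<Sum>m\<le>Suc i. bw (Suc i) m * F m) = (\<Sum>m\<le>i. bw i m * ((F m + F (Suc m)) / 2))"
proof -
  have "(\<Sum>m\<le>Suc i. bw (Suc i) m * F m) = bw (Suc i) 0 * F 0 + (\<Sum>m\<le>i. bw (Suc i) (Suc m) * F (Suc m))"
    by (rule sum.atMost_Suc_shift)
  also have "(\<Sum>m\<le>i. bw (Suc i) (Suc m) * F (Suc m)) =
      (\<Sum>m\<le>i. bw i m * F (Suc m) / 2) + (\<Sum>m\<le>i. bw i (Suc m) * F (Suc m) / 2)"
    unfolding sum.distrib[symmetric] by (rule sum.cong) (auto simp: bw_def field_simps)
  also have "(\<Sum>m\<le>i. bw i (Suc m) * F (Suc m) / 2) = (\<Sum>m\<le>Suc i. bw i m * F m / 2) - bw i 0 * F 0 / 2"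
    using sum.atMost_Suc_shift[of "\<lambda>m. bw i m * F m / 2" i] by linarith
  also have "(\<Sum>m\<le>Suc i. bw i m * F m / 2) = (\<Sum>m\<le>i. bw i m * F m / 2)"
    by (simp add: bw_def)
  also have "bw (Suc i) 0 * F 0 + ((\<Sum>m\<le>i. bw i m * F (Suc m) / 2) + ((\<Sum>m\<le>i. bw i m * F m / 2) - bw i 0 * F 0 / 2))
     = (\<Sum>m\<le>i. bw i m * F (Suc m) / 2) + (\<Sum>m\<le>i. bw i m * F m / 2)"
    by (simp add: bw_def)
  also have "\<dots> = (\<Sum>m\<le>i. bw i m * ((F m + F (Suc m)) / 2))"
    unfolding sum.distrib[symmetric] by (rule sum.cong) (auto simp: field_simps)
  finally show ?thesis .
qed

text \<open>The probability that x, moved by i fair choices between x0 and x0 + v1 and by j fair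
  choices between x0 and x0 + v2, ends at z. Each choice contributes x0 in any case, whence the
  multiple i + j. It is kept as a function of x so that it can be integrated along the walk.\<close>

definition grid :: "Z2 \<Rightarrow> Z2 \<Rightarrow> Z2 \<Rightarrow> Z2 \<Rightarrow> nat \<Rightarrow> nat \<Rightarrow> Z2 \<Rightarrow> real" where
  "grid x0 v1 v2 z i j x = (\<Sum>m\<le>i. bw i m * (\<Sum>l\<le>j. bw j l *
     of_bool (x + int (i + j) *s x0 + int m *s v1 + int l *s v2 = z)))"

lemma grid_nonneg: "0 \<le> grid x0 v1 v2 z i j x"
  unfolding grid_def by (intro sum_nonneg mult_nonneg_nonneg) (auto simp: bw_nonneg)

lemma grid_Suc1:
  "grid x0 v1 v2 z (Suc i) j x = (grid x0 v1 v2 z i j (x + x0) + grid x0 v1 v2 z i j (x + (x0 + v1))) / 2"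
proof -
  define T :: "Z2 \<Rightarrow> nat \<Rightarrow> nat \<Rightarrow> real" where
    "T y m l = of_bool (y + int (i + j) *s x0 + int m *s v1 + int l *s v2 = z)" for y m l
  have a: "of_bool (x + int (Suc i + j) *s x0 + int m *s v1 + int l *s v2 = z) = T (x + x0) m l" for m l
    unfolding T_def by (rule arg_cong[where f = of_bool]) (simp add: vec_eq_iff algebra_simps)
  have b: "T (x + x0) (Suc m) l = T (x + (x0 + v1)) m l" for m l
    unfolding T_def by (rule arg_cong[where f = of_bool]) (simp add: vec_eq_iff algebra_simps)
  have "grid x0 v1 v2 z (Suc i) j x = (\<Sum>m\<le>Suc i. bw (Suc i) m * (\<Sum>l\<le>j. bw j l * T (x + x0) m l))"
    by (simp only: grid_def a)
  also have "\<dots> = (\<Sum>m\<le>i. bw i m * (((\<Sum>l\<le>j. bw j l * T (x + x0) m l)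
      + (\<Sum>l\<le>j. bw j l * T (x + (x0 + v1)) m l)) / 2))"
    by (simp only: sum_bw_Suc b)
  also have "\<dots> = (grid x0 v1 v2 z i j (x + x0) + grid x0 v1 v2 z i j (x + (x0 + v1))) / 2"
    by (simp only: grid_def T_def[symmetric] add_divide_distrib sum.distrib distrib_left
        sum_divide_distrib sum_distrib_left times_divide_eq_right)
  finally show ?thesis .
qed

lemma grid_Suc2:
  "grid x0 v1 v2 z i (Suc j) x = (grid x0 v1 v2 z i j (x + x0) + grid x0 v1 v2 z i j (x + (x0 + v2))) / 2"
proof -
  define T :: "Z2 \<Rightarrow> nat \<Rightarrow> nat \<Rightarrow> real" where
    "T y m l = of_bool (y + int (i + j) *s x0 + int m *s v1 + int l *s v2 = z)" for y m l
  have a: "of_bool (x + int (i + Suc j) *s x0 + int m *s v1 + int l *s v2 = z) = T (x + x0) m l" for m l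
    unfolding T_def by (rule arg_cong[where f = of_bool]) (simp add: vec_eq_iff algebra_simps)
  have b: "T (x + x0) m (Suc l) = T (x + (x0 + v2)) m l" for m l
    unfolding T_def by (rule arg_cong[where f = of_bool]) (simp add: vec_eq_iff algebra_simps)
  have "grid x0 v1 v2 z i (Suc j) x = (\<Sum>m\<le>i. bw i m * (\<Sum>l\<le>Suc j. bw (Suc j) l * T (x + x0) m l))"
    by (simp only: grid_def a)
  also have "\<dots> = (\<Sum>m\<le>i. bw i m * (\<Sum>l\<le>j. bw j l * ((T (x + x0) m l + T (x + (x0 + v2)) m l) / 2)))"
    by (simp only: sum_bw_Suc b)
  also have "\<dots> = (grid x0 v1 v2 z i j (x + x0) + grid x0 v1 v2 z i j (x + (x0 + v2))) / 2"
    by (simp only: grid_def T_def[symmetric] add_divide_distrib sum.distrib distrib_left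
        sum_divide_distrib sum_distrib_left times_divide_eq_right)
  finally show ?thesis .
qed

text \<open>By Cramer's rule the pair (m, l) is determined by m v1 + l v2, so at most one term of
  the double sum survives. The arithmetic-geometric mean inequality then separates i from j, which
  lets the induction along the walk treat the two coordinates independently.\<close>

lemma grid_le:
  assumes det: "v1 $ 1 * v2 $ 2 - v1 $ 2 * v2 $ 1 \<noteq> (0::int)"
  shows "grid x0 v1 v2 z i j x \<le> (1 / (real i + 1) + 1 / (real j + 1)) / 2"
proof -
  define P where "P m l \<longleftrightarrow> x + int (i + j) *s x0 + int m *s v1 + int l *s v2 = z" for m l
  have uniq: "m = m' \<and> l = l'" if "P m l" "P m' l'" for m l m' l'
  proof -
    have "int m *s v1 + int l *s v2 = int m' *s v1 + int l' *s v2"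
      using that unfolding P_def by (metis (no_types, lifting) add.assoc add_left_cancel)
    then have 1: "(int m - int m') * v1 $ 1 = (int l' - int l) * v2 $ 1"
      and 2: "(int m - int m') * v1 $ 2 = (int l' - int l) * v2 $ 2"
      by (auto simp: vec_eq_iff forall_2 algebra_simps)
    have "(int m - int m') * (v1 $ 1 * v2 $ 2 - v1 $ 2 * v2 $ 1) =
       ((int m - int m') * v1 $ 1) * v2 $ 2 - ((int m - int m') * v1 $ 2) * v2 $ 1"
      by (simp add: algebra_simps)
    also have "\<dots> = 0" unfolding 1 2 by simp
    finally have m: "m = m'" using det by simp
    have "(int l' - int l) * (v1 $ 1 * v2 $ 2 - v1 $ 2 * v2 $ 1) =
       ((int l' - int l) * v2 $ 2) * v1 $ 1 - ((int l' - int l) * v2 $ 1) * v1 $ 2"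
      by (simp add: algebra_simps)
    also have "\<dots> = 0" unfolding 1[symmetric] 2[symmetric] by simp
    finally have "l = l'" using det by simp
    with m show ?thesis by simp
  qed
  have grid: "grid x0 v1 v2 z i j x = (\<Sum>(m,l)\<in>{..i} \<times> {..j}. bw i m * bw j l * of_bool (P m l))"
    unfolding grid_def P_def by (simp only: sum.cartesian_product[symmetric] sum_distrib_left mult.assoc)
  show ?thesis
  proof (cases "\<exists>m l. m \<le> i \<and> l \<le> j \<and> P m l")
    case True
    then obtain m l where ml: "m \<le> i" "l \<le> j" "P m l" by blast
    have "grid x0 v1 v2 z i j x = (\<Sum>(m,l)\<in>{(m, l)}. bw i m * bw j l * of_bool (P m l))"
      unfolding grid by (rule sum.mono_neutral_right) (use ml uniq in auto)
    also have "\<dots> = bw i m * bw j l" using ml by simp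
    also have "\<dots> \<le> (1 / sqrt (real i + 1)) * (1 / sqrt (real j + 1))"
      by (intro mult_mono bw_le) (auto simp: bw_nonneg)
    also have "\<dots> \<le> ((1 / sqrt (real i + 1))\<^sup>2 + (1 / sqrt (real j + 1))\<^sup>2) / 2"
      using sum_squares_bound[of "1 / sqrt (real i + 1)" "1 / sqrt (real j + 1)"] by simp
    also have "\<dots> = (1 / (real i + 1) + 1 / (real j + 1)) / 2"
      by (simp add: power_divide)
    finally show ?thesis .
  next
    case False
    then have "grid x0 v1 v2 z i j x = 0"
      unfolding grid by (intro sum.neutral) auto
    then show ?thesis by simp
  qed
qed

text \<open>Two fair coins of mass q each, on {a0, a1} and on {a0, a2}, are split off from p, and h
  is at most c on the rest. The coins take mass q from a0 and q / 2 from each of a1 and a2, which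
  the atoms can provide.\<close>

lemma pmf_integral_le_three_atoms:
  fixes h :: "'a \<Rightarrow> real"
  assumes le: "\<And>y. h y \<le> c" and bd: "\<And>y. \<bar>h y\<bar> \<le> C"
    and q: "q \<le> pmf p a0" "q \<le> pmf p a1" "q \<le> pmf p a2" "0 \<le> q"
    and d: "a0 \<noteq> a1" "a0 \<noteq> a2" "a1 \<noteq> a2"
  shows "(\<integral>y. h y \<partial>measure_pmf p) \<le> (1 - 2 * q) * c + q * ((h a0 + h a1) / 2) + q * ((h a0 + h a2) / 2)"
proof -
  let ?S = "{a0, a1, a2}"
  have int: "integrable (measure_pmf p) h"
    by (rule integrable_measure_pmf_bounded[where C = C]) (use bd in auto)
  have "q * (c - h a0) + q * (c - h a1) / 2 + q * (c - h a2) / 2 \<le>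
      pmf p a0 * (c - h a0) + pmf p a1 * (c - h a1) + pmf p a2 * (c - h a2)"
  proof -
    have "q * (c - h a0) \<le> pmf p a0 * (c - h a0)" "q * (c - h a1) \<le> pmf p a1 * (c - h a1)"
      "q * (c - h a2) \<le> pmf p a2 * (c - h a2)"
      by (intro mult_right_mono q; use le in simp)+
    moreover have "0 \<le> q * (c - h a1)" "0 \<le> q * (c - h a2)" using q(4) le by simp_all
    ultimately show ?thesis by linarith
  qed
  also have "\<dots> = (\<Sum>a\<in>?S. (c - h a) * indicator ?S a * pmf p a)"
    using d by simp
  also have "\<dots> = (\<integral>y. (c - h y) * indicator ?S y \<partial>measure_pmf p)"
    by (rule integral_measure_pmf_real[symmetric]) (auto simp: indicator_def split: if_splits)
  also have "\<dots> \<le> (\<integral>y. (c - h y) \<partial>measure_pmf p)"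
  proof (rule integral_mono)
    show "integrable (measure_pmf p) (\<lambda>y. (c - h y) * indicator ?S y)"
      by (rule integrable_real_mult_indicator) (auto intro!: Bochner_Integration.integrable_diff int)
  qed (use le int in \<open>auto simp: indicator_def\<close>)
  also have "\<dots> = c - (\<integral>y. h y \<partial>measure_pmf p)"
    using int by (subst Bochner_Integration.integral_diff) auto
  finally show ?thesis by (simp add: field_simps)
qed

text \<open>A step is with probability q a coin of the first kind, which raises i by one, with
  probability q one of the second kind, which raises j, and otherwise the unchanged bound is used.
  Hence i and j are arbitrary in the induction. Each of them gains q per step on average; the rate q
  / 2 in the bound leaves room for the convexity of 1 / t.\<close>

lemma grid_walk_le:
  fixes x0 v1 v2 :: Z2
  assumes det: "v1 $ 1 * v2 $ 2 - v1 $ 2 * v2 $ 1 \<noteq> (0::int)"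
    and q: "q \<le> pmf \<mu> x0" "q \<le> pmf \<mu> (x0 + v1)" "q \<le> pmf \<mu> (x0 + v2)" "0 < q"
  shows "(\<integral>y. grid x0 v1 v2 z i j y \<partial>measure_pmf (kpow (walk \<mu>) k x))
    \<le> (1 / (real i + 1 + q / 2 * real k) + 1 / (real j + 1 + q / 2 * real k)) / 2"
proof (induction k arbitrary: i j x)
  case 0
  then show ?case using grid_le[OF det] by simp
next
  case (Suc k)
  define s where "s k i = 1 / (real i + 1 + q / 2 * real k)" for k i
  define h where "h x = (\<integral>y. grid x0 v1 v2 z i j y \<partial>measure_pmf (kpow (walk \<mu>) k x))" for x
  have gb: "\<bar>grid x0 v1 v2 z i j y\<bar> \<le> 1" for i j y
  proof -
    have "grid x0 v1 v2 z i j y \<le> (1 / (real i + 1) + 1 / (real j + 1)) / 2" by (rule grid_le[OF det])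
    also have "\<dots> \<le> (1 + 1) / 2" by (intro divide_right_mono add_mono) auto
    finally show ?thesis using grid_nonneg[of x0 v1 v2 z i j y] by simp
  qed
  have gi: "integrable (measure_pmf r) (\<lambda>y. grid x0 v1 v2 z i j (y + v))" for i j v and r :: "Z2 pmf"
    by (rule integrable_measure_pmf_bounded[where C = 1]) (use gb in auto)
  have h_shift: "h (x + v) = (\<integral>y. grid x0 v1 v2 z i j (y + v) \<partial>measure_pmf (kpow (walk \<mu>) k x))" for v
    unfolding h_def kpow_walk_translate by simp
  have h1: "(h (x + x0) + h (x + (x0 + v1))) / 2 \<le> (s k (Suc i) + s k j) / 2"
  proof -
    have "(h (x + x0) + h (x + (x0 + v1))) / 2
       = (\<integral>y. grid x0 v1 v2 z (Suc i) j y \<partial>measure_pmf (kpow (walk \<mu>) k x))"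
      by (simp only: grid_Suc1 h_shift integral_divide_zero Bochner_Integration.integral_add[OF gi gi])
    with Suc.IH[where i = "Suc i" and j = j and x = x] show ?thesis by (simp add: s_def)
  qed
  have h2: "(h (x + x0) + h (x + (x0 + v2))) / 2 \<le> (s k i + s k (Suc j)) / 2"
  proof -
    have "(h (x + x0) + h (x + (x0 + v2))) / 2
       = (\<integral>y. grid x0 v1 v2 z i (Suc j) y \<partial>measure_pmf (kpow (walk \<mu>) k x))"
      by (simp only: grid_Suc2 h_shift integral_divide_zero Bochner_Integration.integral_add[OF gi gi])
    with Suc.IH[where i = i and j = "Suc j" and x = x] show ?thesis by (simp add: s_def)
  qed
  have hle: "h y \<le> (s k i + s k j) / 2" for y
    using Suc.IH[where i = i and j = j and x = y] by (simp add: h_def s_def)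
  have hb: "\<bar>h y\<bar> \<le> 1" for y
    using norm_integral_pmf_le[of "grid x0 v1 v2 z i j" 1] gb by (simp add: h_def)
  have v: "v1 \<noteq> 0" "v2 \<noteq> 0" "v1 \<noteq> v2"
    using det by auto
  \<comment> \<open>Two distinct atoms have total mass at most 1. This keeps the weight
    \<open>1 - 2 * q\<close> of the remaining steps nonnegative.\<close>
  have q2: "q \<le> 1 / 2"
  proof -
    have "2 * q \<le> sum (pmf \<mu>) {x0, x0 + v1}" using q v by simp
    also have "\<dots> \<le> 1" by (metis measure_measure_pmf_finite finite.emptyI finite.insertI measure_pmf.prob_le_1)
    finally show ?thesis by simp
  qed
  have step: "(1 - q) * s k i + q * s k (Suc i) \<le> s (Suc k) i" for i
  proof -
    define t where "t = real i + 1 + q / 2 * real k"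
    have t: "t \<ge> 1" using q by (simp add: t_def)
    \<comment> \<open>With q in place of q / 2, Jensen's inequality would point the other way; at
      half the rate the claim reduces to 1 - q \<le> t.\<close>
    have "(1 - q) / t + q / (t + 1) \<le> 1 / (t + q / 2)"
    proof -
      have "(1 - q) / t + q / (t + 1) = (t + 1 - q) / (t * (t + 1))"
        using t by (simp add: field_simps)
      also have "\<dots> \<le> 1 / (t + q / 2)"
      proof -
        have "(t + 1 - q) * (t + q / 2) \<le> t * (t + 1)"
        proof -
          have "q * (t + 1 - q) \<le> q * (2 * t)" using q t by (intro mult_left_mono) auto
          then show ?thesis by (simp add: algebra_simps)
        qed
        then show ?thesis using t q by (simp add: divide_simps mult.commute)
      qed
      finally show ?thesis .
    qed
    moreover have "real (Suc i) + 1 + q / 2 * real k = t + 1" "real i + 1 + q / 2 * real (Suc k) = t + q / 2"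
      by (simp_all add: t_def algebra_simps)
    ultimately show ?thesis by (simp only: s_def t_def[symmetric]) simp
  qed
  have "(\<integral>y. grid x0 v1 v2 z i j y \<partial>measure_pmf (kpow (walk \<mu>) (Suc k) x)) = (\<integral>y. h (x + y) \<partial>measure_pmf \<mu>)"
    by (simp add: integral_bind_pmf_real[OF gb] integral_walk h_def)
  also have "\<dots> \<le> (1 - 2 * q) * ((s k i + s k j) / 2) + q * ((h (x + x0) + h (x + (x0 + v1))) / 2)
      + q * ((h (x + x0) + h (x + (x0 + v2))) / 2)"
    by (rule pmf_integral_le_three_atoms[where C = 1]) (use q v hle hb in auto)
  also have "\<dots> \<le> (1 - 2 * q) * ((s k i + s k j) / 2) + q * ((s k (Suc i) + s k j) / 2)
      + q * ((s k i + s k (Suc j)) / 2)"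
    using h1 h2 q q2 by (intro add_mono mult_left_mono order_refl) simp_all
  also have "\<dots> = (((1 - q) * s k i + q * s k (Suc i)) + ((1 - q) * s k j + q * s k (Suc j))) / 2"
    by (simp add: field_simps)
  also have "\<dots> \<le> (s (Suc k) i + s (Suc k) j) / 2"
    using step[of i] step[of j] by simp
  finally show ?case by (simp add: s_def)
qed

text \<open>For i = j = 0 \<open>grid\<close> is the indicator of z. The decay 1 / k has the order
  of the planar local limit theorem; its sum over k is the logarithm in all later estimates.\<close>

lemma walk_concentration:
  fixes x0 v1 v2 :: Z2
  assumes det: "v1 $ 1 * v2 $ 2 - v1 $ 2 * v2 $ 1 \<noteq> (0::int)"
    and q: "q \<le> pmf \<mu> x0" "q \<le> pmf \<mu> (x0 + v1)" "q \<le> pmf \<mu> (x0 + v2)" "0 < q"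
  shows "pmf (kpow (walk \<mu>) k x) z \<le> 1 / (1 + q / 2 * real k)"
proof -
  have "grid x0 v1 v2 z 0 0 = indicator {z}"
    by (rule ext) (auto simp: grid_def bw_def indicator_def)
  then have "(\<integral>y. grid x0 v1 v2 z 0 0 y \<partial>measure_pmf (kpow (walk \<mu>) k x)) = pmf (kpow (walk \<mu>) k x) z"
    by (simp add: measure_pmf_single)
  with grid_walk_le[OF det q, where z = z and i = 0 and j = 0 and k = k and x = x] show ?thesis
    by (simp only: of_nat_0 add_0_left field_sum_of_halves add_divide_distrib)
qed

section \<open>Escaping from a finite set\<close>

text \<open>The positions at times 0, ..., n - 1 are inspected, the one at time n is not.\<close>

primrec avoid :: "('s \<Rightarrow> 's pmf) \<Rightarrow> 's set \<Rightarrow> nat \<Rightarrow> 's \<Rightarrow> real" where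
  "avoid K B 0 x = 1"
| "avoid K B (Suc n) x = (if x \<in> B then 0 else \<integral>y. avoid K B n y \<partial>measure_pmf (K x))"

lemma avoid_nonneg: "0 \<le> avoid K B n x"
  by (induction n arbitrary: x) (auto intro!: integral_nonneg)

lemma avoid_le_1: "avoid K B n x \<le> 1"
proof (induction n arbitrary: x)
  case (Suc n)
  have "norm (\<integral>y. avoid K B n y \<partial>measure_pmf (K x)) \<le> 1"
    by (rule norm_integral_pmf_le) (use Suc.IH avoid_nonneg[of K B n] in auto)
  then have "(\<integral>y. avoid K B n y \<partial>measure_pmf (K x)) \<le> 1" by (simp add: abs_le_iff)
  then show ?case by simp
qed simp

lemma integrable_avoid: "integrable (measure_pmf p) (avoid K B n)"
  by (rule integrable_measure_pmf_bounded[where C = 1]) (simp add: avoid_nonneg avoid_le_1)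

lemma avoid_Suc_le: "avoid K B (Suc n) x \<le> avoid K B n x"
proof (induction n arbitrary: x)
  case 0
  show ?case using avoid_le_1[of K B "Suc 0" x] by simp
next
  case (Suc n)
  have "(\<integral>y. avoid K B (Suc n) y \<partial>measure_pmf (K x)) \<le> (\<integral>y. avoid K B n y \<partial>measure_pmf (K x))"
    by (intro integral_mono integrable_avoid Suc.IH)
  note int_le = this
  show ?case
  proof (cases "x \<in> B")
    case False
    note e = avoid.simps(2)[of K B _ x, unfolded if_not_P[OF False]]
    from int_le show ?thesis unfolding e[of "Suc n"] e[of n] .
  qed simp
qed

lemma avoid_antimono: "m \<le> n \<Longrightarrow> avoid K B n x \<le> avoid K B m x"
  using decseq_SucI[of "\<lambda>n. avoid K B n x"] avoid_Suc_le[of K B _ x] by (auto simp: decseq_def)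

lemma avoid_subset: "B \<subseteq> B' \<Longrightarrow> avoid K B' n x \<le> avoid K B n x"
proof (induction n arbitrary: x)
  case (Suc n)
  have "(\<integral>y. avoid K B' n y \<partial>measure_pmf (K x)) \<le> (\<integral>y. avoid K B n y \<partial>measure_pmf (K x))"
    by (intro integral_mono integrable_avoid Suc)
  then show ?case using Suc.prems avoid_nonneg[of K B "Suc n" x] by auto
qed simp

text \<open>Until it enters B the chain only uses the kernel outside B. In this way escape estimates
  for the unperturbed walk carry over to the perturbed chain.\<close>

lemma avoid_cong: "(\<And>x. x \<notin> B \<Longrightarrow> K x = K' x) \<Longrightarrow> avoid K B n x = avoid K' B n x"
proof (induction n arbitrary: x)
  case (Suc n)
  then have "avoid K B n = avoid K' B n" by auto
  with Suc.prems show ?case by simp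
qed simp

lemma avoid_translate: "avoid (walk \<mu>) ((\<lambda>y. y + v) ` B) n (x + v) = avoid (walk \<mu>) B n x"
proof (induction n arbitrary: x)
  case (Suc n)
  have "(\<integral>y. avoid (walk \<mu>) ((\<lambda>y. y + v) ` B) n y \<partial>measure_pmf (walk \<mu> (x + v))) =
      (\<integral>y. avoid (walk \<mu>) ((\<lambda>y. y + v) ` B) n ((x + y) + v) \<partial>measure_pmf \<mu>)"
    by (simp add: integral_walk add_ac)
  also have "\<dots> = (\<integral>y. avoid (walk \<mu>) B n y \<partial>measure_pmf (walk \<mu> x))"
    by (simp only: Suc.IH integral_walk)
  finally show ?case by auto
qed simp

text \<open>The positions at times 1, ..., n are inspected, and the start may lie in B. For a start
  outside B this is \<open>avoid\<close> with \<open>Suc n\<close>.\<close>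

definition escape :: "('s \<Rightarrow> 's pmf) \<Rightarrow> 's set \<Rightarrow> nat \<Rightarrow> 's \<Rightarrow> real" where
  "escape K B n x = (\<integral>y. avoid K B n y \<partial>measure_pmf (K x))"

lemma escape_nonneg: "0 \<le> escape K B n x"
  by (simp add: escape_def avoid_nonneg)

lemma escape_le_1: "escape K B n x \<le> 1"
  using norm_integral_pmf_le[of "avoid K B n" 1 "K x"] by (simp add: escape_def avoid_nonneg avoid_le_1)

lemma escape_antimono: "m \<le> n \<Longrightarrow> escape K B n x \<le> escape K B m x"
  unfolding escape_def by (intro integral_mono integrable_avoid avoid_antimono)

lemma escape_subset: "B \<subseteq> B' \<Longrightarrow> escape K B' n x \<le> escape K B n x"
  unfolding escape_def by (intro integral_mono integrable_avoid avoid_subset)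

lemma escape_translate: "escape (walk \<mu>) ((\<lambda>y. y + v) ` B) n (x + v) = escape (walk \<mu>) B n x"
proof -
  have "escape (walk \<mu>) ((\<lambda>y. y + v) ` B) n (x + v) =
      (\<integral>y. avoid (walk \<mu>) ((\<lambda>y. y + v) ` B) n ((x + y) + v) \<partial>measure_pmf \<mu>)"
    by (simp add: escape_def integral_walk add_ac)
  then show ?thesis by (simp only: avoid_translate escape_def integral_walk)
qed

text \<open>Either B is avoided at all times 0, ..., N, or there is a last visit, at some b and some
  time k, followed by an escape during the remaining N - k steps. Decomposing at the last visit and
  not at the first one puts the escape probabilities next to occupation probabilities, so that upper
  bounds on the latter become lower bounds on the former.\<close>

lemma last_exit_decomposition:
  assumes "finite B"
  shows "avoid K B (Suc N) x + (\<Sum>k\<le>N. \<Sum>b\<in>B. pmf (kpow K k x) b * escape K B (N - k) b) = 1"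
proof (induction N arbitrary: x)
  case 0
  have "(\<Sum>b\<in>B. pmf (return_pmf x) b * escape K B 0 b) = (if x \<in> B then 1 else 0)"
    using assms by (simp add: escape_def indicator_def if_distrib[of "\<lambda>c. c * _"] cong: if_cong)
  moreover have "avoid K B 0 = (\<lambda>_. 1)" by auto
  ultimately show ?case by simp
next
  case (Suc N)
  have z: "(\<Sum>b\<in>B. pmf (return_pmf x) b * escape K B (Suc N) b) = (if x \<in> B then escape K B (Suc N) x else 0)"
    using assms by (simp add: indicator_def if_distrib[of "\<lambda>c. c * _"] cong: if_cong)
  have int: "integrable (measure_pmf (K x)) (\<lambda>y. pmf (kpow K k y) b * escape K B (N - k) b)" for k b
    by (rule integrable_measure_pmf_bounded[where C = 1])
       (auto simp: abs_mult escape_nonneg escape_le_1 pmf_le_1 intro!: mult_le_one)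
  define g where "g k y = (\<Sum>b\<in>B. pmf (kpow K k y) b * escape K B (N - k) b)" for k y
  have g: "integrable (measure_pmf (K x)) (g k)" for k
    unfolding g_def by (rule Bochner_Integration.integrable_sum) (rule int)
  have "(\<Sum>b\<in>B. pmf (kpow K (Suc k) x) b * escape K B (N - k) b) = (\<integral>y. g k y \<partial>measure_pmf (K x))" for k
    unfolding g_def by (subst Bochner_Integration.integral_sum) (rule int, simp add: pmf_bind)
  then have "(\<Sum>k\<le>N. \<Sum>b\<in>B. pmf (kpow K (Suc k) x) b * escape K B (N - k) b) =
      (\<Sum>k\<le>N. \<integral>y. g k y \<partial>measure_pmf (K x))"
    by (simp only:)
  also have "\<dots> = (\<integral>y. (\<Sum>k\<le>N. g k y) \<partial>measure_pmf (K x))"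
    using Bochner_Integration.integral_sum[of "{..N}" "measure_pmf (K x)" g] g by (simp only:)
  also have "\<dots> = (\<integral>y. 1 - avoid K B (Suc N) y \<partial>measure_pmf (K x))"
  proof (rule Bochner_Integration.integral_cong)
    show "(\<Sum>k\<le>N. g k y) = 1 - avoid K B (Suc N) y" for y
      using Suc.IH[of y] unfolding g_def by linarith
  qed simp
  also have "\<dots> = 1 - escape K B (Suc N) x"
    unfolding escape_def by (subst Bochner_Integration.integral_diff) (auto intro: integrable_avoid)
  finally have s: "(\<Sum>k\<le>N. \<Sum>b\<in>B. pmf (kpow K (Suc k) x) b * escape K B (N - k) b) = 1 - escape K B (Suc N) x" .
  have "avoid K B (Suc (Suc N)) x = (if x \<in> B then 0 else escape K B (Suc N) x)"
    by (simp only: avoid.simps(2)[of K B "Suc N"] escape_def)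
  then show ?case
    by (subst sum.atMost_Suc_shift) (simp only: kpow.simps(1) diff_zero diff_Suc_Suc z s, simp)
qed

lemma sum_inverse_linear_le:
  assumes "(0::real) < c" "1 \<le> N"
  shows "(\<Sum>k\<le>N. 1 / (1 + c * real k)) \<le> 1 + (1 + ln (real N)) / c"
proof -
  have "(\<Sum>k\<le>N. 1 / (1 + c * real k)) = 1 + (\<Sum>k=1..N. 1 / (1 + c * real k))"
    by (simp add: sum.atLeast1_atMost_eq sum.atMost_shift lessThan_atLeast0 atLeastLessThanSuc_atLeastAtMost)
  also have "(\<Sum>k=1..N. 1 / (1 + c * real k)) \<le> (\<Sum>k=1..N. 1 / c * inverse (real k))"
    using assms by (intro sum_mono) (auto simp: inverse_eq_divide intro!: frac_le)
  also have "\<dots> = 1 / c * harm N"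
    by (simp add: harm_def sum_distrib_left)
  also have "\<dots> \<le> 1 / c * (1 + ln (real N))"
  proof (rule mult_left_mono)
    have "harm N - ln (real N) \<le> harm 1 - ln (real 1)"
      using euler_mascheroni_sequence_decreasing[of 1 N] assms by simp
    then show "harm N \<le> 1 + ln (real N)" by (simp add: harm_def)
  qed (use assms in auto)
  finally show ?thesis by simp
qed

text \<open>Started in B, the last-exit sum equals 1. Summands with at least n steps left contain an
  escape probability of at most the maximum r over B, and the occupation probabilities sum to O(log
  n); this gives r times log n at least a positive constant once the other summands are known to
  contribute at most 1 / 2.\<close>

lemma escape_lower_bound:
  fixes \<mu> :: "'g::ab_group_add pmf"
  assumes conc: "\<And>k x z. pmf (kpow (walk \<mu>) k x) z \<le> 1 / (1 + c * real k)" and c: "0 < c"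
    and B: "finite B" "B \<noteq> {}"
  shows "\<exists>C>0. \<forall>n\<ge>2. \<exists>b\<in>B. C / ln (real n) \<le> escape (walk \<mu>) B n b"
proof -
  define K where "K = walk \<mu>"
  obtain b0 where b0: "b0 \<in> B" using B by blast
  define \<beta> where "\<beta> = real (card B)"
  have \<beta>: "\<beta> > 0" using B by (simp add: \<beta>_def card_gt_0_iff)
  \<comment> \<open>The horizon is stretched to N = L n. The last n times, which leave fewer than n
    steps for the escape, then contribute at most \<open>\<beta>\<close> / (c (L - 1)) \<le> 1 / 2
    by the concentration bound alone.\<close>
  obtain L :: nat where L: "2 * \<beta> / c + 1 < real L" using reals_Archimedean2 by blast
  have L1: "real L > 1" using L \<beta> c by (smt (verit) divide_nonneg_pos)
  \<comment> \<open>Chosen so that \<open>\<gamma>\<close> ln n bounds the harmonic sum up to L n;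
    the terms free of n are absorbed through ln n \<ge> ln 2.\<close>
  define \<gamma> where "\<gamma> = (1 + 1 / c + ln (real L) / c) / ln 2 + 1 / c"
  have \<gamma>: "\<gamma> > 0" unfolding \<gamma>_def using c L1 by (intro add_pos_pos divide_pos_pos add_pos_nonneg) auto
  have main: "\<exists>b\<in>B. 1 / (2 * \<beta> * \<gamma>) / ln (real n) \<le> escape K B n b" if n: "n \<ge> 2" for n
  proof -
    define r where "r = Max (escape K B n ` B)"
    have r: "escape K B n b \<le> r" if "b \<in> B" for b
      unfolding r_def using B that by (intro Max_ge) auto
    have r0: "0 \<le> r" using r[OF b0] escape_nonneg[of K B n b0] by linarith
    obtain b where b: "b \<in> B" "escape K B n b = r"
      using Max_in[of "escape K B n ` B"] B unfolding r_def by fastforce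
    define N where "N = L * n"
    have N: "N \<ge> 1" "n \<le> N" using n L1 by (auto simp: N_def Suc_le_eq)
    define \<delta> where "\<delta> = 1 / (c * (real L - 1) * real n)"
    have \<delta>: "\<delta> \<ge> 0" using c L1 by (simp add: \<delta>_def)
    have term_le: "pmf (kpow K k b0) b * escape K B (N - k) b \<le> r * (1 / (1 + c * real k)) + \<delta> * of_bool (k > N - n)"
      if "k \<le> N" "b \<in> B" for k b
    proof (cases "k > N - n")
      case False
      then have "escape K B (N - k) b \<le> r"
        using escape_antimono[of n "N - k" K B b] r[OF that(2)] that(1) N by force
      then have "pmf (kpow K k b0) b * escape K B (N - k) b \<le> 1 / (1 + c * real k) * r"
        using conc[of k b0 b] c by (intro mult_mono) (auto simp: K_def escape_nonneg)
      then show ?thesis using False by (simp add: mult.commute)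
    next
      case True
      have "real N - real n \<le> real k" using True N by linarith
      then have "c * ((real L - 1) * real n) \<le> c * real k"
        using c by (intro mult_left_mono) (auto simp: N_def algebra_simps)
      then have "c * ((real L - 1) * real n) \<le> 1 + c * real k" by linarith
      then have "1 / (1 + c * real k) \<le> \<delta>"
        unfolding \<delta>_def using c L1 n by (intro frac_le) (auto simp: mult.assoc)
      then have "pmf (kpow K k b0) b * escape K B (N - k) b \<le> \<delta> * 1"
        using conc[of k b0 b] \<delta> by (intro mult_mono) (auto simp: K_def escape_nonneg escape_le_1)
      moreover have "0 \<le> r * (1 / (1 + c * real k))" using r0 c by simp
      ultimately show ?thesis using True by simp
    qed
    have "1 = (\<Sum>k\<le>N. \<Sum>b\<in>B. pmf (kpow K k b0) b * escape K B (N - k) b)"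
      using last_exit_decomposition[OF B(1), of K N b0] b0 by simp
    also have "\<dots> \<le> (\<Sum>k\<le>N. \<Sum>b\<in>B. r * (1 / (1 + c * real k)) + \<delta> * of_bool (k > N - n))"
      by (intro sum_mono term_le) auto
    also have "\<dots> = \<beta> * (r * (\<Sum>k\<le>N. 1 / (1 + c * real k))) + \<beta> * (\<delta> * (\<Sum>k\<le>N. of_bool (k > N - n)))"
      by (simp only: sum_constant sum.distrib sum_distrib_left \<beta>_def distrib_left)
    also have "(\<Sum>k\<le>N. of_bool (k > N - n)) = real n"
    proof -
      have "{..N} \<inter> {k. k > N - n} = {N - n<..N}" by auto
      then show ?thesis using N by simp
    qed
    also have "\<beta> * (r * (\<Sum>k\<le>N. 1 / (1 + c * real k))) \<le> \<beta> * (r * (\<gamma> * ln (real n)))"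
    proof (intro mult_left_mono)
      have "(\<Sum>k\<le>N. 1 / (1 + c * real k)) \<le> 1 + (1 + ln (real N)) / c"
        by (rule sum_inverse_linear_le) (use c N in auto)
      also have "ln (real N) = ln (real L) + ln (real n)"
        unfolding N_def using L1 n by (simp add: ln_mult)
      also have "1 + (1 + (ln (real L) + ln (real n))) / c = (1 + 1 / c + ln (real L) / c) / ln 2 * ln 2 + 1 / c * ln (real n)"
        by (simp add: add_divide_distrib[of _ _ c])
      also have "\<dots> \<le> (1 + 1 / c + ln (real L) / c) / ln 2 * ln (real n) + 1 / c * ln (real n)"
        using c L1 n by (intro add_right_mono mult_left_mono) auto
      also have "\<dots> = \<gamma> * ln (real n)" by (simp add: \<gamma>_def algebra_simps)
      finally show "(\<Sum>k\<le>N. 1 / (1 + c * real k)) \<le> \<gamma> * ln (real n)" .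
    qed (use r0 \<beta> in auto)
    also have "\<beta> * (\<delta> * real n) \<le> 1 / 2"
    proof -
      have "\<beta> * (\<delta> * real n) = \<beta> / (c * (real L - 1))" using n by (simp add: \<delta>_def)
      also have "\<dots> \<le> 1 / 2"
      proof -
        have "2 * \<beta> \<le> c * (real L - 1)" using L c by (simp add: field_simps)
        then show ?thesis using c L1 by (simp add: field_simps)
      qed
      finally show ?thesis .
    qed
    finally have "1 / 2 \<le> \<beta> * (r * (\<gamma> * ln (real n)))" by simp
    then have "1 / (2 * \<beta> * \<gamma>) / ln (real n) \<le> r"
      using \<beta> \<gamma> n by (simp add: field_simps)
    with b show ?thesis by blast
  qed
  show ?thesis
    by (rule exI[of _ "1 / (2 * \<beta> * \<gamma>)"]) (use main \<beta> \<gamma> in \<open>auto simp: K_def\<close>)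
qed

section \<open>Expected number of visits\<close>

text \<open>By linearity the expected number of visits to A at times 0, ..., n - 1, that is, the
  Green function of A truncated at n.\<close>

definition visits :: "('s \<Rightarrow> 's pmf) \<Rightarrow> 's set \<Rightarrow> nat \<Rightarrow> 's \<Rightarrow> real" where
  "visits K A n x = (\<Sum>k<n. measure (measure_pmf (kpow K k x)) A)"

lemma visits_nonneg: "0 \<le> visits K A n x"
  by (simp add: visits_def sum_nonneg)

lemma visits_le_real: "visits K A n x \<le> real n"
  unfolding visits_def by (rule order_trans[OF sum_mono[of _ _ "\<lambda>_. 1"]]) auto

lemma visits_mono: "m \<le> n \<Longrightarrow> visits K A m x \<le> visits K A n x"
  unfolding visits_def by (intro sum_mono2) auto

lemma integrable_visits: "integrable (measure_pmf p) (visits K A n)"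
  by (rule integrable_measure_pmf_bounded[where C = "real n"]) (simp add: visits_nonneg visits_le_real)

lemma visits_add: "visits K A (j + n) x = visits K A j x + (\<integral>y. visits K A n y \<partial>measure_pmf (kpow K j x))"
proof -
  have "visits K A (j + n) x = visits K A j x + (\<Sum>k<n. measure (measure_pmf (kpow K (j + k) x)) A)"
    unfolding visits_def by (induction n) simp_all
  also have "(\<Sum>k<n. measure (measure_pmf (kpow K (j + k) x)) A) = (\<integral>y. visits K A n y \<partial>measure_pmf (kpow K j x))"
    unfolding visits_def kpow_add measure_bind_pmf
    by (rule Bochner_Integration.integral_sum[symmetric])
       (auto intro!: integrable_measure_pmf_bounded[where C = 1])
  finally show ?thesis .
qed

text \<open>Nothing is counted before A is entered, and from the entrance point at most g visits are
  expected. The bound g refers to a fixed horizon N \<ge> n, because the remaining time shrinks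
  along the induction.\<close>

lemma visits_le_avoid:
  assumes "\<And>a. a \<in> A \<Longrightarrow> visits K A N a \<le> g" and "0 \<le> g" and "n \<le> N"
  shows "visits K A n x \<le> g * (1 - avoid K A n x)"
  using \<open>n \<le> N\<close>
proof (induction n arbitrary: x)
  case 0
  then show ?case by (simp add: visits_def)
next
  case (Suc n)
  show ?case
  proof (cases "x \<in> A")
    case True
    then show ?thesis using assms(1)[OF True] visits_mono[OF Suc.prems, of K A x] by simp
  next
    case False
    have "visits K A (Suc n) x = (\<integral>y. visits K A n y \<partial>measure_pmf (K x))"
    proof -
      have "kpow K (Suc 0) x = K x" using kpow_Suc_right[of K 0 x] by (simp add: bind_return_pmf)
      then show ?thesis
        using visits_add[of K A 1 n x] False by (simp add: visits_def)
    qed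
    also have "\<dots> \<le> (\<integral>y. g * (1 - avoid K A n y) \<partial>measure_pmf (K x))"
      using Suc by (intro integral_mono integrable_visits)
        (auto intro!: Bochner_Integration.integrable_diff integrable_mult_right integrable_avoid)
    also have "\<dots> = g * (1 - avoid K A (Suc n) x)"
      using False by (simp add: integrable_avoid)
    finally show ?thesis .
  qed
qed

text \<open>Let g be the largest value of \<open>visits\<close> on A. From the state where it is
  attained, the chain is after some j \<le> J steps at y with probability at least p, and from y it
  avoids A with probability at least \<epsilon>; otherwise at most g further visits are expected.
  Hence g \<le> J + g (1 - p \<epsilon>), which can be solved for g.\<close>

lemma visits_le:
  assumes "finite A"
    and reach: "\<And>a. a \<in> A \<Longrightarrow> \<exists>j\<le>J. p \<le> pmf (kpow K j a) y" and p: "0 < p"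
    and \<epsilon>: "\<epsilon> \<le> avoid K A n y" "0 < \<epsilon>"
  shows "visits K A n x \<le> real J / (p * \<epsilon>)"
proof (cases "A = {}")
  case True
  then show ?thesis using p \<epsilon> by (simp add: visits_def)
next
  case False
  define g where "g = Max (visits K A n ` A)"
  have g: "visits K A n a \<le> g" if "a \<in> A" for a
    unfolding g_def using that assms(1) by (intro Max_ge) auto
  have g0: "0 \<le> g" using False g visits_nonneg[of K A n] by (meson all_not_in_conv order_trans)
  obtain a where a: "a \<in> A" "visits K A n a = g"
    using Max_in[of "visits K A n ` A"] assms(1) False unfolding g_def by fastforce
  obtain j where j: "j \<le> J" "p \<le> pmf (kpow K j a) y" using reach[OF a(1)] by blast
  have ub: "visits K A n z \<le> g * (1 - avoid K A n z)" for z
    by (rule visits_le_avoid[where N = n]) (use g g0 in auto)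
  have "p * \<epsilon> \<le> pmf (kpow K j a) y * avoid K A n y"
    using j \<epsilon> p by (intro mult_mono) auto
  also have "\<dots> = (\<integral>z. avoid K A n z * indicator {y} z \<partial>measure_pmf (kpow K j a))"
    by (subst integral_measure_pmf_real[where A = "{y}"]) (auto simp: indicator_def split: if_splits)
  also have "\<dots> \<le> (\<integral>z. avoid K A n z \<partial>measure_pmf (kpow K j a))"
    by (intro integral_mono integrable_avoid integrable_real_mult_indicator)
       (auto simp: indicator_def avoid_nonneg)
  finally have pe: "p * \<epsilon> \<le> (\<integral>z. avoid K A n z \<partial>measure_pmf (kpow K j a))" .
  \<comment> \<open>Lengthening the horizon by j makes room for the steps leading to y and leaves
    the full horizon n afterwards.\<close>
  have "g \<le> visits K A (j + n) a" using a visits_mono[of n "j + n" K A a] by simp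
  also have "\<dots> = visits K A j a + (\<integral>z. visits K A n z \<partial>measure_pmf (kpow K j a))"
    by (rule visits_add)
  also have "\<dots> \<le> real J + (\<integral>z. g * (1 - avoid K A n z) \<partial>measure_pmf (kpow K j a))"
  proof (rule add_mono)
    show "visits K A j a \<le> real J" using visits_le_real[of K A j a] j by simp
    show "(\<integral>z. visits K A n z \<partial>measure_pmf (kpow K j a)) \<le> (\<integral>z. g * (1 - avoid K A n z) \<partial>measure_pmf (kpow K j a))"
      using ub by (intro integral_mono integrable_visits)
        (auto intro!: Bochner_Integration.integrable_diff integrable_mult_right integrable_avoid)
  qed
  also have "(\<integral>z. g * (1 - avoid K A n z) \<partial>measure_pmf (kpow K j a)) = g * (1 - (\<integral>z. avoid K A n z \<partial>measure_pmf (kpow K j a)))"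
    by (simp add: integrable_avoid)
  also have "\<dots> \<le> g * (1 - p * \<epsilon>)" using pe g0 by (intro mult_left_mono) auto
  finally have "g * (p * \<epsilon>) \<le> real J" by (simp add: algebra_simps)
  then have "g \<le> real J / (p * \<epsilon>)" using p \<epsilon> by (simp add: pos_le_divide_eq)
  moreover have "visits K A n x \<le> g * 1"
    using ub[of x] g0 avoid_nonneg[of K A n x] mult_left_mono[of "1 - avoid K A n x" 1 g] by linarith
  ultimately show ?thesis by linarith
qed

text \<open>The lower bound on escape probabilities is applied to \<open>A\<close> together with a disjoint translate of it: if the
  good point \<open>b\<close> lies in \<open>A\<close>, then its translate \<open>b - v\<close> is outside \<open>A\<close> and escapes from \<open>A\<close> at least as
  easily.\<close>

theorem visits_log_bound:
  fixes K :: "Z2 \<Rightarrow> Z2 pmf"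
  assumes conc: "\<And>k x z. pmf (kpow (walk \<mu>) k x) z \<le> 1 / (1 + c * real k)" and c: "0 < c"
    and A: "finite A" and K: "\<And>x. x \<notin> A \<Longrightarrow> K x = walk \<mu> x"
    and acc: "\<And>a y. a \<in> A \<Longrightarrow> y \<notin> A \<Longrightarrow> \<exists>j. y \<in> set_pmf (kpow K j a)"
  shows "\<exists>C\<ge>0. \<forall>n\<ge>2. \<forall>x. visits K A n x \<le> C * ln (real n)"
proof (cases "A = {}")
  case True
  then show ?thesis by (auto simp: visits_def intro!: exI[of _ 1])
next
  case False
  have "infinite (UNIV :: Z2 set)" by (rule infinite_UNIV_char_0)
  moreover have "finite ((\<lambda>(a, b). b - a) ` (A \<times> A))" using A by auto
  \<comment> \<open>A shift outside the difference set of A moves every point of A out of A, in both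
    directions.\<close>
  ultimately obtain v where v: "v \<notin> (\<lambda>(a, b). b - a) ` (A \<times> A)"
    using ex_new_if_finite by blast
  have v': "a + v \<notin> A" "a - v \<notin> A" if "a \<in> A" for a
    using v that by (force simp: image_iff)+
  define B where "B = A \<union> (\<lambda>y. y + v) ` A"
  \<comment> \<open>The point that escapes well may change with n, but it stays in this finite set
    disjoint from A. So one step bound J and one probability p serve for all n.\<close>
  define F where "F = (\<lambda>y. y + v) ` A \<union> (\<lambda>y. y - v) ` A"
  have F: "finite F" "F \<inter> A = {}" "F \<noteq> {}" using A False v' by (auto simp: F_def)
  obtain C where C: "C > 0" "\<And>n. n \<ge> 2 \<Longrightarrow> \<exists>b\<in>B. C / ln (real n) \<le> escape (walk \<mu>) B n b"
    using escape_lower_bound[OF conc c, of B] A False by (auto simp: B_def)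
  have esc: "\<exists>y\<in>F. C / ln (real n) \<le> avoid K A n y" if n: "n \<ge> 2" for n
  proof -
    obtain b where b: "b \<in> B" "C / ln (real n) \<le> escape (walk \<mu>) B n b" using C(2)[OF n] by blast
    obtain y where y: "y \<in> F" "escape (walk \<mu>) B n b \<le> escape (walk \<mu>) A n y"
    proof (cases "b \<in> A")
      case True
      have "escape (walk \<mu>) B n b \<le> escape (walk \<mu>) ((\<lambda>y. y + v) ` A) n ((b - v) + v)"
        using escape_subset[of "(\<lambda>y. y + v) ` A" B "walk \<mu>" n b] by (simp add: B_def)
      also have "\<dots> = escape (walk \<mu>) A n (b - v)" by (rule escape_translate)
      finally show ?thesis using True that[of "b - v"] by (auto simp: F_def)
    next
      case False
      then show ?thesis using b(1) that[of b] escape_subset[of A B "walk \<mu>" n b] by (auto simp: B_def F_def)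
    qed
    have "escape (walk \<mu>) A n y = avoid (walk \<mu>) A (Suc n) y"
      using y(1) F by (auto simp: escape_def)
    also have "\<dots> \<le> avoid (walk \<mu>) A n y" by (rule avoid_Suc_le)
    also have "\<dots> = avoid K A n y" using K by (intro avoid_cong) auto
    finally show ?thesis using y b by (meson order_trans)
  qed
  have "\<forall>a\<in>A. \<forall>y\<in>F. \<exists>j. y \<in> set_pmf (kpow K j a)" using acc F by blast
  then obtain j where j: "\<And>a y. a \<in> A \<Longrightarrow> y \<in> F \<Longrightarrow> y \<in> set_pmf (kpow K (j a y) a)" by metis
  define p where "p = Min ((\<lambda>(a, y). pmf (kpow K (j a y) a) y) ` (A \<times> F))"
  define J where "J = Max ((\<lambda>(a, y). j a y) ` (A \<times> F))"
  have fin: "finite (A \<times> F)" "A \<times> F \<noteq> {}" using A False F by auto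
  have p0: "p > 0" unfolding p_def using fin j by (subst Min_gr_iff) (auto simp: pmf_positive)
  have reach: "\<exists>i\<le>J. p \<le> pmf (kpow K i a) y" if "a \<in> A" "y \<in> F" for a y
  proof (intro exI[of _ "j a y"] conjI)
    show "j a y \<le> J" unfolding J_def using fin that by (intro Max_ge) auto
    show "p \<le> pmf (kpow K (j a y) a) y" unfolding p_def using fin that by (intro Min_le) auto
  qed
  show ?thesis
  proof (intro exI[of _ "real J / (p * C)"] conjI allI impI)
    fix n :: nat and x assume n: "2 \<le> n"
    obtain y where y: "y \<in> F" "C / ln (real n) \<le> avoid K A n y" using esc[OF n] by blast
    have "visits K A n x \<le> real J / (p * (C / ln (real n)))"
      by (rule visits_le[OF A reach[OF _ y(1)] p0 y(2)]) (use C n in auto)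
    then show "visits K A n x \<le> real J / (p * C) * ln (real n)" by simp
  qed (use p0 C in auto)
qed

section \<open>Characteristic functions of the perturbed walk\<close>

lemma integrable_indicator_pmf: "integrable (measure_pmf p) (indicat_real S)"
  by (rule integrable_measure_pmf_bounded[where C = 1]) (simp add: indicator_def)

lemma rvec_add: "rvec (x + y) = rvec x + rvec y"
  by (simp add: rvec_def vec_eq_iff)

lemma rvec_diff: "rvec (x - y) = rvec x - rvec y"
  by (simp add: rvec_def vec_eq_iff)

lemma rvec_0: "rvec 0 = 0"
  by (simp add: rvec_def vec_eq_iff)

lemma norm_iexp_diff_le: "norm (iexp a - iexp b) \<le> \<bar>a - b\<bar>"
proof -
  have "iexp a - iexp b = iexp b * (iexp (a - b) - 1)"
    by (simp add: algebra_simps flip: exp_add)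
  moreover have "norm (iexp (a - b) - 1) \<le> \<bar>a - b\<bar>"
    using iexp_approx1[of "a - b" 0] by simp
  ultimately show ?thesis by (simp add: norm_mult)
qed

lemma norm_iexp_diff_le_2: "norm (iexp a - iexp b) \<le> 2"
  using norm_triangle_ineq4[of "iexp a" "iexp b"] by simp

definition pmf_char :: "Z2 pmf \<Rightarrow> Z2 \<Rightarrow> R2 \<Rightarrow> complex" where
  "pmf_char p x \<theta> = (\<integral>y. iexp (\<theta> \<bullet> rvec (y - x)) \<partial>measure_pmf p)"

lemma integrable_pmf_iexp: "integrable (measure_pmf p) (\<lambda>y. iexp (f y))"
  by (rule integrable_measure_pmf_bounded[where C = 1]) simp

lemma norm_pmf_char_le_1: "norm (pmf_char p x \<theta>) \<le> 1"
  unfolding pmf_char_def by (rule norm_integral_pmf_le) simp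

lemma pmf_char_shift: "(\<integral>y. iexp (\<theta> \<bullet> rvec y) \<partial>measure_pmf p) = iexp (\<theta> \<bullet> rvec x) * pmf_char p x \<theta>"
proof -
  have "(\<lambda>y. iexp (\<theta> \<bullet> rvec y)) = (\<lambda>y. iexp (\<theta> \<bullet> rvec x) * iexp (\<theta> \<bullet> rvec (y - x)))"
    by (rule ext) (simp add: rvec_diff inner_diff_right algebra_simps flip: exp_add)
  then show ?thesis by (simp add: pmf_char_def)
qed

lemma pmf_char_walk: "pmf_char (walk \<mu> x) x \<theta> = pmf_char \<mu> 0 \<theta>"
  by (simp add: pmf_char_def integral_walk)

text \<open>Displacements beyond the truncation level L are given the trivial bound 2, the others
  the Lipschitz bound of the exponential. Only a tail probability enters, as the jumps from A may
  lack moments.\<close>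

lemma pmf_char_near_1:
  assumes "0 \<le> L"
  shows "norm (pmf_char p x \<theta> - 1) \<le> 2 * measure (measure_pmf p) {y. norm (rvec (y - x)) > L} + norm \<theta> * L"
proof -
  let ?S = "{y. norm (rvec (y - x)) > L}"
  have "pmf_char p x \<theta> - 1 = (\<integral>y. iexp (\<theta> \<bullet> rvec (y - x)) - 1 \<partial>measure_pmf p)"
    unfolding pmf_char_def by (subst Bochner_Integration.integral_diff) (auto intro: integrable_pmf_iexp)
  also have "norm \<dots> \<le> (\<integral>y. norm (iexp (\<theta> \<bullet> rvec (y - x)) - 1) \<partial>measure_pmf p)"
    by (rule integral_norm_bound)
  also have "\<dots> \<le> (\<integral>y. 2 * indicator ?S y + norm \<theta> * L \<partial>measure_pmf p)"
  proof (rule integral_mono)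
    show "integrable (measure_pmf p) (\<lambda>y. norm (iexp (\<theta> \<bullet> rvec (y - x)) - 1))"
      by (intro integrable_norm Bochner_Integration.integrable_diff integrable_pmf_iexp) auto
    show "integrable (measure_pmf p) (\<lambda>y. 2 * indicator ?S y + norm \<theta> * L)"
      by (intro Bochner_Integration.integrable_add integrable_mult_right integrable_indicator_pmf) auto
    show "norm (iexp (\<theta> \<bullet> rvec (y - x)) - 1) \<le> 2 * indicator ?S y + norm \<theta> * L" for y
    proof (cases "y \<in> ?S")
      case True
      then show ?thesis using norm_iexp_diff_le_2[of "\<theta> \<bullet> rvec (y - x)" 0] assms
        by (simp add: add_increasing2)
    next
      case False
      have "norm (iexp (\<theta> \<bullet> rvec (y - x)) - 1) \<le> \<bar>\<theta> \<bullet> rvec (y - x)\<bar>"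
        using norm_iexp_diff_le[of "\<theta> \<bullet> rvec (y - x)" 0] by simp
      also have "\<dots> \<le> norm \<theta> * norm (rvec (y - x))" by (rule Cauchy_Schwarz_ineq2)
      also have "\<dots> \<le> norm \<theta> * L" using False by (intro mult_left_mono) auto
      finally show ?thesis using False by simp
    qed
  qed
  also have "\<dots> = 2 * measure (measure_pmf p) ?S + norm \<theta> * L" by (simp add: integrable_indicator_pmf)
  finally show ?thesis .
qed

text \<open>Telescoping along time. Splitting off the last step multiplies by the characteristic
  function of the jump from the current position, which is exactly that of \<open>\<mu>\<close> off
  A and differs from it by at most D on A. Since characteristic functions have modulus at most 1,
  earlier errors do not grow, and the total is D for each expected visit.\<close>

lemma kpow_char_perturbation:
  assumes K: "\<And>x. x \<notin> A \<Longrightarrow> K x = walk \<mu> x"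
    and D: "\<And>a. a \<in> A \<Longrightarrow> norm (pmf_char (K a) a \<theta> - pmf_char \<mu> 0 \<theta>) \<le> D"
  shows "norm (pmf_char (kpow K n x) x \<theta> - pmf_char \<mu> 0 \<theta> ^ n) \<le> D * visits K A n x"
proof (induction n)
  case 0
  then show ?case by (simp add: visits_def pmf_char_def rvec_0)
next
  case (Suc n)
  let ?\<phi> = "pmf_char \<mu> 0 \<theta>" and ?p = "measure_pmf (kpow K n x)"
  have "pmf_char (kpow K (Suc n) x) x \<theta> = (\<integral>y. (\<integral>z. iexp (\<theta> \<bullet> rvec (z - x)) \<partial>measure_pmf (K y)) \<partial>?p)"
    unfolding pmf_char_def kpow_Suc_right by (rule integral_bind_pmf_complex[where C = 1]) simp
  also have "\<dots> = (\<integral>y. iexp (\<theta> \<bullet> rvec (y - x)) * pmf_char (K y) y \<theta> \<partial>?p)"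
  proof (rule Bochner_Integration.integral_cong)
    fix y
    have "(\<lambda>z. iexp (\<theta> \<bullet> rvec (z - x))) = (\<lambda>z. iexp (\<theta> \<bullet> rvec (y - x)) * iexp (\<theta> \<bullet> rvec (z - y)))"
      by (rule ext) (simp add: rvec_diff inner_diff_right algebra_simps flip: exp_add)
    then show "(\<integral>z. iexp (\<theta> \<bullet> rvec (z - x)) \<partial>measure_pmf (K y)) = iexp (\<theta> \<bullet> rvec (y - x)) * pmf_char (K y) y \<theta>"
      by (simp add: pmf_char_def)
  qed simp
  finally have 1: "pmf_char (kpow K (Suc n) x) x \<theta> = \<dots>" .
  have 2: "?\<phi> * pmf_char (kpow K n x) x \<theta> = (\<integral>y. iexp (\<theta> \<bullet> rvec (y - x)) * ?\<phi> \<partial>?p)"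
    by (simp add: pmf_char_def mult.commute)
  have i1: "integrable ?p (\<lambda>y. iexp (\<theta> \<bullet> rvec (y - x)) * pmf_char (K y) y \<theta>)"
    and i2: "integrable ?p (\<lambda>y. iexp (\<theta> \<bullet> rvec (y - x)) * ?\<phi>)"
    by (rule integrable_measure_pmf_bounded[where C = 1]; simp add: norm_mult norm_pmf_char_le_1)+
  have "norm (pmf_char (kpow K (Suc n) x) x \<theta> - ?\<phi> * pmf_char (kpow K n x) x \<theta>)
     = norm (\<integral>y. iexp (\<theta> \<bullet> rvec (y - x)) * pmf_char (K y) y \<theta> - iexp (\<theta> \<bullet> rvec (y - x)) * ?\<phi> \<partial>?p)"
    unfolding 1 2 by (subst Bochner_Integration.integral_diff[OF i1 i2]) simp
  also have "\<dots> \<le> (\<integral>y. norm (iexp (\<theta> \<bullet> rvec (y - x)) * pmf_char (K y) y \<theta> - iexp (\<theta> \<bullet> rvec (y - x)) * ?\<phi>) \<partial>?p)"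
    by (rule integral_norm_bound)
  also have "\<dots> \<le> (\<integral>y. D * indicator A y \<partial>?p)"
  proof (rule integral_mono)
    show "norm (iexp (\<theta> \<bullet> rvec (y - x)) * pmf_char (K y) y \<theta> - iexp (\<theta> \<bullet> rvec (y - x)) * ?\<phi>) \<le> D * indicator A y" for y
    proof (cases "y \<in> A")
      case True
      have "norm (iexp (\<theta> \<bullet> rvec (y - x)) * pmf_char (K y) y \<theta> - iexp (\<theta> \<bullet> rvec (y - x)) * ?\<phi>)
          = norm (iexp (\<theta> \<bullet> rvec (y - x)) * (pmf_char (K y) y \<theta> - ?\<phi>))"
        by (simp only: right_diff_distrib)
      with D[OF True] True show ?thesis by (simp add: norm_mult)
    next
      case False
      then show ?thesis using K[OF False] by (simp add: pmf_char_walk)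
    qed
  qed (intro integrable_norm Bochner_Integration.integrable_diff i1 i2 integrable_mult_right integrable_indicator_pmf)+
  also have "\<dots> = D * measure ?p A" by (simp add: integrable_indicator_pmf)
  finally have s: "norm (pmf_char (kpow K (Suc n) x) x \<theta> - ?\<phi> * pmf_char (kpow K n x) x \<theta>) \<le> D * measure ?p A" .
  have "norm (?\<phi> * pmf_char (kpow K n x) x \<theta> - ?\<phi> ^ Suc n) = norm ?\<phi> * norm (pmf_char (kpow K n x) x \<theta> - ?\<phi> ^ n)"
    by (simp add: norm_mult[symmetric] algebra_simps)
  also have "\<dots> \<le> 1 * (D * visits K A n x)"
    by (intro mult_mono norm_pmf_char_le_1 Suc.IH) auto
  finally have t: "norm (?\<phi> * pmf_char (kpow K n x) x \<theta> - ?\<phi> ^ Suc n) \<le> D * visits K A n x" by simp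
  have "norm (pmf_char (kpow K (Suc n) x) x \<theta> - ?\<phi> ^ Suc n) \<le> D * measure ?p A + D * visits K A n x"
    using norm_triangle_mono[OF s t] by (simp add: algebra_simps)
  then show ?case by (simp add: visits_def algebra_simps)
qed

section \<open>Second-order behaviour of the characteristic function of a step\<close>

definition qform :: "Z2 pmf \<Rightarrow> R2 \<Rightarrow> real" where
  "qform \<mu> \<theta> = (\<integral>y. (\<theta> \<bullet> rvec y)\<^sup>2 \<partial>measure_pmf \<mu>)"

lemma qform_nonneg: "0 \<le> qform \<mu> \<theta>"
  by (simp add: qform_def)

lemma qform_scaleR: "qform \<mu> (c *\<^sub>R \<theta>) = c\<^sup>2 * qform \<mu> \<theta>"
  by (simp add: qform_def power_mult_distrib)

text \<open>The factor n anticipates that the one-step error at frequency \<theta> / sqrt n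
  accumulates over a number of steps of order n.\<close>

definition char_err :: "Z2 pmf \<Rightarrow> nat \<Rightarrow> R2 \<Rightarrow> real" where
  "char_err \<mu> n \<theta> = real n * norm (pmf_char \<mu> 0 (\<theta> /\<^sub>R sqrt (real n)) - of_real (exp (- (qform \<mu> \<theta> / (2 * real n)))))"

lemma char_err_nonneg: "0 \<le> char_err \<mu> n \<theta>"
  by (simp add: char_err_def)

lemma integrable_rvec_inner:
  assumes "integrable (measure_pmf \<mu>) (\<lambda>y. (norm (rvec y))\<^sup>2)"
  shows "integrable (measure_pmf \<mu>) (\<lambda>y. (\<theta> \<bullet> rvec y)\<^sup>2)" "integrable (measure_pmf \<mu>) (\<lambda>y. \<theta> \<bullet> rvec y)"
    "integrable (measure_pmf \<mu>) rvec"
proof -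
  have le: "(\<theta> \<bullet> rvec y)\<^sup>2 \<le> (norm \<theta>)\<^sup>2 * (norm (rvec y))\<^sup>2" for y \<theta>
    using Cauchy_Schwarz_ineq2[of \<theta> "rvec y"] by (metis abs_le_square_iff abs_mult abs_norm_cancel power_mult_distrib)
  show 1: "integrable (measure_pmf \<mu>) (\<lambda>y. (\<theta> \<bullet> rvec y)\<^sup>2)"
    by (rule Bochner_Integration.integrable_bound[OF integrable_mult_right[OF assms, of "(norm \<theta>)\<^sup>2"]]) (use le in auto)
  have "norm (rvec y) \<le> 1 + (norm (rvec y))\<^sup>2" for y
  proof -
    have "0 \<le> (norm (rvec y) - 1)\<^sup>2" by simp
    then have "2 * norm (rvec y) \<le> 1 + (norm (rvec y))\<^sup>2" by (simp add: power2_diff)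
    then show ?thesis using norm_ge_zero[of "rvec y"] by linarith
  qed
  note sq = this
  have i: "integrable (measure_pmf \<mu>) (\<lambda>y. 1 + (norm (rvec y))\<^sup>2)"
    using assms by simp
  show 2: "integrable (measure_pmf \<mu>) rvec"
    by (rule Bochner_Integration.integrable_bound[OF i]) (use sq in auto)
  show "integrable (measure_pmf \<mu>) (\<lambda>y. \<theta> \<bullet> rvec y)"
    using 2 by (rule integrable_inner_right)
qed

text \<open>The minimum is dominated by a multiple of the square and tends to 0 pointwise as t does.
  This makes the error o(t^2) by dominated convergence, with second moments only.\<close>

lemma norm_char_diff_le_third_moment:
  fixes X :: "'a \<Rightarrow> real"
  assumes X: "integrable (measure_pmf \<mu>) X" "integrable (measure_pmf \<mu>) (\<lambda>y. (X y)\<^sup>2)"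
    and EX: "(\<integral>y. X y \<partial>measure_pmf \<mu>) = 0" and var: "measure_pmf.variance \<mu> X = q"
    and \<nu>_def: "\<nu> = distr (measure_pmf \<mu>) borel X"
  shows "norm (char \<nu> t - (1 - t\<^sup>2 * q / 2)) \<le>
    (t\<^sup>2 / 6) * (\<integral>y. min (6 * (X y)\<^sup>2) (\<bar>t\<bar> * \<bar>X y\<bar> ^ 3) \<partial>measure_pmf \<mu>)"
  by (rule prob_space.char_approx3'[where X = X and M = "measure_pmf \<mu>"])
    (rule prob_space_measure_pmf X EX var \<nu>_def | simp)+

lemma one_minus_exp_bound:
  assumes "0 \<le> (u::real)"
  shows "\<bar>(1 - u) - exp (- u)\<bar> \<le> u\<^sup>2"
proof -
  have "exp (- u) * (1 + u) \<le> exp (- u) * exp u"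
    using exp_ge_add_one_self[of u] by (intro mult_left_mono) auto
  then have "exp (- u) * (1 + u) \<le> 1" by (simp add: exp_minus)
  then have "(exp (- u) - (1 - u)) * (1 + u) \<le> u\<^sup>2" by (simp add: algebra_simps power2_eq_square)
  moreover have "0 \<le> exp (- u) - (1 - u)" using exp_ge_add_one_self[of "- u"] by simp
  ultimately show ?thesis
    using mult_left_mono[of 1 "1 + u" "exp (- u) - (1 - u)"] assms by simp
qed

text \<open>The quadratic expansion 1 - q / (2n) mediates: it is within o(1 / n) of the
  characteristic function and within O(1 / n^2) of the Gaussian factor.\<close>

lemma char_err_tendsto_0:
  assumes int: "integrable (measure_pmf \<mu>) (\<lambda>y. (norm (rvec y))\<^sup>2)"
    and mean: "(\<integral>y. rvec y \<partial>measure_pmf \<mu>) = 0"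
  shows "(\<lambda>n. char_err \<mu> n \<theta>) \<longlonglongrightarrow> 0"
proof -
  define X where "X y = \<theta> \<bullet> rvec y" for y
  define q where "q = qform \<mu> \<theta>"
  define \<nu> where "\<nu> = distr (measure_pmf \<mu>) borel X"
  have X: "integrable (measure_pmf \<mu>) X" "integrable (measure_pmf \<mu>) (\<lambda>y. (X y)\<^sup>2)"
    unfolding X_def by (rule integrable_rvec_inner[OF int])+
  have EX: "(\<integral>y. X y \<partial>measure_pmf \<mu>) = 0"
    unfolding X_def using integrable_rvec_inner(3)[OF int] mean by simp
  have var: "measure_pmf.variance \<mu> X = q"
    by (simp add: EX) (simp add: q_def qform_def X_def)
  define h where "h n = (\<integral>y. min (6 * (X y)\<^sup>2) (\<bar>1 / sqrt (real n)\<bar> * \<bar>X y\<bar> ^ 3) \<partial>measure_pmf \<mu>)" for n :: nat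
  have h: "h \<longlonglongrightarrow> 0"
  proof -
    have "h \<longlonglongrightarrow> (\<integral>y. 0 \<partial>measure_pmf \<mu>)"
      unfolding h_def
    proof (rule integral_dominated_convergence[where w = "\<lambda>y. 6 * (X y)\<^sup>2"])
      show "AE y in measure_pmf \<mu>. (\<lambda>n. min (6 * (X y)\<^sup>2) (\<bar>1 / sqrt (real n)\<bar> * \<bar>X y\<bar> ^ 3)) \<longlonglongrightarrow> 0"
      proof (rule AE_I2)
        fix y
        have "(\<lambda>n. \<bar>1 / sqrt (real n)\<bar> * \<bar>X y\<bar> ^ 3) \<longlonglongrightarrow> 0"
          by real_asymp
        then have "(\<lambda>n. min (6 * (X y)\<^sup>2) (\<bar>1 / sqrt (real n)\<bar> * \<bar>X y\<bar> ^ 3)) \<longlonglongrightarrow> min (6 * (X y)\<^sup>2) 0"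
          by (intro tendsto_min tendsto_const)
        then show "(\<lambda>n. min (6 * (X y)\<^sup>2) (\<bar>1 / sqrt (real n)\<bar> * \<bar>X y\<bar> ^ 3)) \<longlonglongrightarrow> 0"
          by (simp add: min_absorb2)
      qed
    qed (use X in auto)
    then show ?thesis by simp
  qed
  have char: "char \<nu> t = pmf_char \<mu> 0 (t *\<^sub>R \<theta>)" for t
    unfolding char_def \<nu>_def pmf_char_def by (subst integral_distr) (auto simp: X_def)
  have le: "char_err \<mu> n \<theta> \<le> 1 / 6 * h n + real n * \<bar>(1 - q / (2 * real n)) - exp (- (q / (2 * real n)))\<bar>"
    if n: "n \<ge> 1" for n
  proof -
    let ?t = "1 / sqrt (real n)"
    have t2: "?t\<^sup>2 = 1 / real n" by (simp add: power_divide)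
    have "norm (char \<nu> ?t - (1 - ?t\<^sup>2 * q / 2)) \<le> (?t\<^sup>2 / 6) * h n"
      unfolding h_def by (rule norm_char_diff_le_third_moment[OF X EX var \<nu>_def])
    then have a: "norm (pmf_char \<mu> 0 (\<theta> /\<^sub>R sqrt (real n)) - of_real (1 - q / (2 * real n))) \<le> h n / (6 * real n)"
    proof -
      have "?t *\<^sub>R \<theta> = \<theta> /\<^sub>R sqrt (real n)" "1 / real n * q / 2 = q / (2 * real n)" "1 / real n / 6 * h n = h n / (6 * real n)"
        by (simp_all add: inverse_eq_divide)
      then show "norm (char \<nu> ?t - (1 - ?t\<^sup>2 * q / 2)) \<le> (?t\<^sup>2 / 6) * h n \<Longrightarrow> ?thesis"
        unfolding t2 char by (simp only:)
    qed
    have "norm (pmf_char \<mu> 0 (\<theta> /\<^sub>R sqrt (real n)) - of_real (exp (- (q / (2 * real n)))))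
       \<le> norm (pmf_char \<mu> 0 (\<theta> /\<^sub>R sqrt (real n)) - of_real (1 - q / (2 * real n)))
         + norm (of_real (1 - q / (2 * real n)) - of_real (exp (- (q / (2 * real n)))) :: complex)"
      by norm
    also have "norm (of_real (1 - q / (2 * real n)) - of_real (exp (- (q / (2 * real n)))) :: complex)
       = \<bar>(1 - q / (2 * real n)) - exp (- (q / (2 * real n)))\<bar>"
      by (simp only: of_real_diff[symmetric] norm_of_real)
    finally have "norm (pmf_char \<mu> 0 (\<theta> /\<^sub>R sqrt (real n)) - of_real (exp (- (q / (2 * real n)))))
       \<le> h n / (6 * real n) + \<bar>(1 - q / (2 * real n)) - exp (- (q / (2 * real n)))\<bar>" using a by linarith
    from mult_left_mono[OF this, of "real n"] n show ?thesis
      by (simp add: char_err_def q_def distrib_left)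
  qed
  have "(\<lambda>n. real n * \<bar>(1 - q / (2 * real n)) - exp (- (q / (2 * real n)))\<bar>) \<longlonglongrightarrow> 0"
  proof (rule Lim_null_comparison)
    show "(\<lambda>n. q\<^sup>2 / 4 * (1 / real n)) \<longlonglongrightarrow> 0"
      by (intro tendsto_mult_right_zero) real_asymp
    show "\<forall>\<^sub>F n in sequentially. norm (real n * \<bar>(1 - q / (2 * real n)) - exp (- (q / (2 * real n)))\<bar>) \<le> q\<^sup>2 / 4 * (1 / real n)"
    proof (intro eventually_sequentiallyI)
      fix n :: nat assume n: "1 \<le> n"
      have "real n * \<bar>(1 - q / (2 * real n)) - exp (- (q / (2 * real n)))\<bar> \<le> real n * (q / (2 * real n))\<^sup>2"
        by (intro mult_left_mono one_minus_exp_bound) (auto simp: q_def qform_nonneg)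
      also have "\<dots> = q\<^sup>2 / 4 * (1 / real n)" using n by (simp add: power2_eq_square)
      finally show "norm (real n * \<bar>(1 - q / (2 * real n)) - exp (- (q / (2 * real n)))\<bar>) \<le> q\<^sup>2 / 4 * (1 / real n)"
        by simp
    qed
  qed
  then have "(\<lambda>n. 1 / 6 * h n + real n * \<bar>(1 - q / (2 * real n)) - exp (- (q / (2 * real n)))\<bar>) \<longlonglongrightarrow> 0"
    using tendsto_add[OF tendsto_mult_right_zero[OF h, of "1/6"]] by fastforce
  then show ?thesis
    by (rule Lim_null_comparison[rotated])
       (use le in \<open>auto simp: char_err_nonneg eventually_sequentially intro!: exI[of _ 1]\<close>)
qed

section \<open>Perturbed walks at the diffusive scale\<close>

lemma two_le_mult: "2 \<le> n \<Longrightarrow> 0 < T \<Longrightarrow> 2 \<le> T * (n::nat)"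
  using mult_le_mono[of 1 T 2 n] by simp

lemma ln_mult_nonneg: "2 \<le> n \<Longrightarrow> 0 < T \<Longrightarrow> 0 \<le> ln (real (T * n))"
  using two_le_mult[of n T] by (intro ln_ge_zero) linarith

text \<open>\<open>tails\<close> controls the effect of a single visit to A and
  \<open>visits_log\<close> the number of visits. Concentration, escape and accessibility enter what
  follows only through \<open>visits_log\<close>.\<close>

locale perturbed_walk =
  fixes \<mu> :: "Z2 pmf" and K :: "Z2 \<Rightarrow> Z2 pmf" and A :: "Z2 set" and C :: real
  assumes finite_A: "finite A"
    and K_eq: "\<And>x. x \<notin> A \<Longrightarrow> K x = walk \<mu> x"
    and mean_0: "(\<integral>y. rvec y \<partial>measure_pmf \<mu>) = 0"
    and second_moment: "integrable (measure_pmf \<mu>) (\<lambda>y. (norm (rvec y))\<^sup>2)"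
    and tails: "\<And>a. a \<in> A \<Longrightarrow> ((\<lambda>t. measure (measure_pmf (K a)) {y. norm (rvec (y - a)) > t} * ln t) \<longlongrightarrow> 0) at_top"
    and visits_log: "\<And>n x. 2 \<le> n \<Longrightarrow> visits K A n x \<le> C * ln (real n)"
    and C_nonneg: "0 \<le> C"
begin

definition perturb_err :: "nat \<Rightarrow> R2 \<Rightarrow> real" where
  "perturb_err n \<theta> = (\<Sum>a\<in>A. norm (pmf_char (K a) a (\<theta> /\<^sub>R sqrt (real n)) - pmf_char \<mu> 0 (\<theta> /\<^sub>R sqrt (real n))))"

lemma perturb_err_nonneg: "0 \<le> perturb_err n \<theta>"
  by (simp add: perturb_err_def sum_nonneg)

text \<open>The truncation level is n^(1/4). Being a power of n, it has a logarithm comparable to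
  log n, so the tail assumption at this level yields o(1 / log n); being of smaller order than sqrt
  n, it leaves a truncated part of order n^(-1/4), which beats the logarithm.\<close>

lemma perturb_err_tendsto_0: "(\<lambda>n. perturb_err n \<theta> * ln (real (T * n))) \<longlonglongrightarrow> 0" if T: "0 < T"
proof -
  have "(\<lambda>n. norm (pmf_char (K a) a (\<theta> /\<^sub>R sqrt (real n)) - pmf_char \<mu> 0 (\<theta> /\<^sub>R sqrt (real n))) * ln (real (T * n))) \<longlonglongrightarrow> 0"
    if a: "a \<in> A" for a
  proof -
    define tl where "tl t = measure (measure_pmf (K a)) {y. norm (rvec (y - a)) > t}" for t
    have tl: "(\<lambda>n::nat. tl (real n powr (1/4)) * ln (real n powr (1/4))) \<longlonglongrightarrow> 0"
    proof -
      have f: "filterlim (\<lambda>n::nat. real n powr (1/4)) at_top sequentially" by real_asymp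
      show ?thesis using filterlim_compose[OF tails[OF a] f] by (simp add: tl_def)
    qed
    have lim_ratio: "(\<lambda>n::nat. ln (real (T * n)) / ln (real n powr (1/4))) \<longlonglongrightarrow> 4"
      using T by real_asymp
    have 1: "(\<lambda>n::nat. 2 * (tl (real n powr (1/4)) * ln (real n powr (1/4)) * (ln (real (T * n)) / ln (real n powr (1/4))))) \<longlonglongrightarrow> 2 * (0 * 4)"
      by (intro tendsto_intros tl lim_ratio)
    have 2: "(\<lambda>n::nat. norm \<theta> / sqrt (real n) * real n powr (1/4) * ln (real (T * n))) \<longlonglongrightarrow> 0"
      using T by real_asymp
    have 3: "(\<lambda>n::nat. char_err \<mu> n \<theta> * (ln (real (T * n)) / real n)) \<longlonglongrightarrow> 0 * 0"
      by (intro tendsto_mult char_err_tendsto_0 second_moment mean_0) (use T in real_asymp)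
    have 4: "(\<lambda>n::nat. qform \<mu> \<theta> / (2 * real n) * ln (real (T * n))) \<longlonglongrightarrow> 0"
      using T by real_asymp
    let ?b = "\<lambda>n::nat. 2 * (tl (real n powr (1/4)) * ln (real n powr (1/4)) * (ln (real (T * n)) / ln (real n powr (1/4))))
        + norm \<theta> / sqrt (real n) * real n powr (1/4) * ln (real (T * n))
        + char_err \<mu> n \<theta> * (ln (real (T * n)) / real n)
        + qform \<mu> \<theta> / (2 * real n) * ln (real (T * n))"
    have b: "?b \<longlonglongrightarrow> 0"
      using tendsto_add[OF tendsto_add[OF tendsto_add[OF 1 2] 3] 4] by simp
    have "norm (pmf_char (K a) a (\<theta> /\<^sub>R sqrt (real n)) - pmf_char \<mu> 0 (\<theta> /\<^sub>R sqrt (real n))) * ln (real (T * n)) \<le> ?b n"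
      if n: "n \<ge> 2" for n
    proof -
      let ?th = "\<theta> /\<^sub>R sqrt (real n)" and ?e = "exp (- (qform \<mu> \<theta> / (2 * real n)))"
      have ln0: "ln (real (T * n)) \<ge> 0" using n T by (rule ln_mult_nonneg)
      have "pmf_char (K a) a ?th - pmf_char \<mu> 0 ?th = (pmf_char (K a) a ?th - 1) - (pmf_char \<mu> 0 ?th - of_real ?e) - of_real (?e - 1)"
        by simp
      then have "norm (pmf_char (K a) a ?th - pmf_char \<mu> 0 ?th)
         \<le> norm (pmf_char (K a) a ?th - 1) + norm (pmf_char \<mu> 0 ?th - of_real ?e) + norm (of_real (?e - 1) :: complex)"
        by (metis (no_types, lifting) add_right_mono norm_triangle_ineq4 order_trans)
      also have "norm (pmf_char \<mu> 0 ?th - of_real ?e) = char_err \<mu> n \<theta> / real n"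
        using n by (simp add: char_err_def)
      also have "norm (of_real (?e - 1) :: complex) \<le> qform \<mu> \<theta> / (2 * real n)"
        unfolding norm_of_real using exp_ge_add_one_self[of "- (qform \<mu> \<theta> / (2 * real n))"] qform_nonneg[of \<mu> \<theta>] by simp
      also have "norm (pmf_char (K a) a ?th - 1) \<le> 2 * tl (real n powr (1/4)) + norm ?th * real n powr (1/4)"
        unfolding tl_def by (rule pmf_char_near_1) simp
      also have "norm ?th = norm \<theta> / sqrt (real n)" by (simp add: inverse_eq_divide)
      finally have "norm (pmf_char (K a) a ?th - pmf_char \<mu> 0 ?th)
         \<le> 2 * tl (real n powr (1/4)) + norm \<theta> / sqrt (real n) * real n powr (1/4) + char_err \<mu> n \<theta> / real n + qform \<mu> \<theta> / (2 * real n)"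
        by simp
      from mult_right_mono[OF this ln0] have "norm (pmf_char (K a) a ?th - pmf_char \<mu> 0 ?th) * ln (real (T * n))
         \<le> (2 * tl (real n powr (1/4)) + norm \<theta> / sqrt (real n) * real n powr (1/4) + char_err \<mu> n \<theta> / real n + qform \<mu> \<theta> / (2 * real n)) * ln (real (T * n))" .
      also have "ln (real n powr (1/4)) \<noteq> 0" using n by (simp add: ln_powr)
      then have "(2 * tl (real n powr (1/4)) + norm \<theta> / sqrt (real n) * real n powr (1/4) + char_err \<mu> n \<theta> / real n + qform \<mu> \<theta> / (2 * real n)) * ln (real (T * n)) = ?b n"
        by (simp add: distrib_right)
      finally show ?thesis .
    qed
    note key = this
    show ?thesis
    proof (rule Lim_null_comparison[OF eventually_sequentiallyI[of 2] b])
      fix n :: nat assume n: "2 \<le> n"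
      have "norm (norm z * ln (real (T * n))) = norm z * ln (real (T * n))" for z :: complex
        using ln_mult_nonneg[OF n T] by (simp only: real_norm_def abs_mult abs_of_nonneg norm_ge_zero)
      then show "norm (norm (pmf_char (K a) a (\<theta> /\<^sub>R sqrt (real n)) - pmf_char \<mu> 0 (\<theta> /\<^sub>R sqrt (real n))) * ln (real (T * n))) \<le> ?b n"
        using key[OF n] by (simp only:)
    qed
  qed
  then have "(\<lambda>n. \<Sum>a\<in>A. norm (pmf_char (K a) a (\<theta> /\<^sub>R sqrt (real n)) - pmf_char \<mu> 0 (\<theta> /\<^sub>R sqrt (real n))) * ln (real (T * n))) \<longlonglongrightarrow> (\<Sum>a\<in>A. 0)"
    by (intro tendsto_sum)
  then show ?thesis by (simp add: perturb_err_def sum_distrib_right)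
qed

text \<open>The cap 2 is the trivial bound for a difference of characteristic functions. It makes
  the error bounded in the frequency, as needed for dominated convergence when tails are computed by
  integrating over frequencies.\<close>

definition total_err :: "nat \<Rightarrow> nat \<Rightarrow> R2 \<Rightarrow> real" where
  "total_err T n \<theta> = min 2 (real T * char_err \<mu> n \<theta> + C * (perturb_err n \<theta> * ln (real (T * n))))"

lemma total_err_tendsto_0: "0 < T \<Longrightarrow> (\<lambda>n. total_err T n \<theta>) \<longlonglongrightarrow> 0"
proof -
  assume T: "0 < T"
  have "(\<lambda>n. min 2 (real T * char_err \<mu> n \<theta> + C * (perturb_err n \<theta> * ln (real (T * n))))) \<longlonglongrightarrow> min 2 (real T * 0 + C * 0)"
    by (intro tendsto_intros char_err_tendsto_0 second_moment mean_0 perturb_err_tendsto_0 T)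
  then show ?thesis by (simp add: total_err_def[abs_def])
qed

lemma total_err_bounds: "2 \<le> n \<Longrightarrow> 0 < T \<Longrightarrow> 0 \<le> total_err T n \<theta>" "total_err T n \<theta> \<le> 2"
  unfolding total_err_def
  by (auto simp del: of_nat_mult intro!: add_nonneg_nonneg mult_nonneg_nonneg ln_mult_nonneg
      C_nonneg perturb_err_nonneg char_err_nonneg)

text \<open>Two replacements: the kernel by that of the walk, at the price of
  \<open>perturb_err\<close> per visit to A, and the m-th power of the characteristic function of a
  step by its Gaussian counterpart, at the price of m one-step errors. Neither price depends on x or
  on the individual m \<le> T n.\<close>

lemma char_kpow:
  assumes n: "2 \<le> n" and T: "0 < T" and m: "m \<le> T * n"
  shows "norm (pmf_char (kpow K m x) x (\<theta> /\<^sub>R sqrt (real n)) - of_real (exp (- (qform \<mu> \<theta> * (real m / real n) / 2)))) \<le> total_err T n \<theta>"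
proof -
  let ?th = "\<theta> /\<^sub>R sqrt (real n)"
  let ?\<phi> = "pmf_char \<mu> 0 ?th"
  let ?e = "exp (- (qform \<mu> \<theta> / (2 * real n)))"
  have e1: "?e \<le> 1" using qform_nonneg[of \<mu> \<theta>] by simp
  have ee: "?e ^ m = exp (- (qform \<mu> \<theta> * (real m / real n) / 2))"
    by (simp add: exp_of_nat_mult[symmetric] algebra_simps)
  have "norm (pmf_char (kpow K m x) x ?th - of_real (?e ^ m)) \<le> 2"
  proof -
    have "norm (pmf_char (kpow K m x) x ?th - of_real (?e ^ m)) \<le> norm (pmf_char (kpow K m x) x ?th) + norm (of_real (?e ^ m) :: complex)"
      by (rule norm_triangle_ineq4)
    also have "\<dots> \<le> 1 + 1"
      using e1 by (intro add_mono norm_pmf_char_le_1) (simp add: power_le_one norm_power)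
    finally show ?thesis by simp
  qed
  moreover have "norm (pmf_char (kpow K m x) x ?th - of_real (?e ^ m)) \<le> real T * char_err \<mu> n \<theta> + C * (perturb_err n \<theta> * ln (real (T * n)))"
  proof -
    have "norm (pmf_char (kpow K m x) x ?th - ?\<phi> ^ m) \<le> perturb_err n \<theta> * visits K A m x"
    proof (rule kpow_char_perturbation[OF K_eq])
      show "norm (pmf_char (K a) a ?th - ?\<phi>) \<le> perturb_err n \<theta>" if "a \<in> A" for a
        unfolding perturb_err_def using finite_A that by (intro member_le_sum) auto
    qed
    also have "visits K A m x \<le> C * ln (real (T * n))"
      using visits_mono[OF m, of K A x] visits_log[OF two_le_mult[OF n T], of x] by linarith
    finally have 1: "norm (pmf_char (kpow K m x) x ?th - ?\<phi> ^ m) \<le> C * (perturb_err n \<theta> * ln (real (T * n)))"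
      using perturb_err_nonneg by (simp add: mult_left_mono mult.left_commute)
    have "norm (?\<phi> ^ m - of_real ?e ^ m) \<le> real m * norm (?\<phi> - of_real ?e)"
      using e1 by (intro norm_power_diff norm_pmf_char_le_1) simp
    also have "\<dots> = real m / real n * char_err \<mu> n \<theta>"
      using n by (simp add: char_err_def)
    also have "\<dots> \<le> real T * char_err \<mu> n \<theta>"
    proof (rule mult_right_mono[OF _ char_err_nonneg])
      have "real m \<le> real (T * n)" using m by (simp only: of_nat_le_iff)
      then show "real m / real n \<le> real T" using n by (simp add: pos_divide_le_eq)
    qed
    finally have 2: "norm (?\<phi> ^ m - of_real (?e ^ m)) \<le> real T * char_err \<mu> n \<theta>" by simp
    have "pmf_char (kpow K m x) x ?th - of_real (?e ^ m) = (pmf_char (kpow K m x) x ?th - ?\<phi> ^ m) + (?\<phi> ^ m - of_real (?e ^ m))"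
      by simp
    then show ?thesis using norm_triangle_mono[OF 1 2] by (simp only: add.commute)
  qed
  ultimately show ?thesis unfolding total_err_def ee by simp
qed

end

section \<open>Tail and maximal estimates\<close>

text \<open>The integrand is the expectation of \<open>(1 - cos (u x))\<^sup>2\<close>, which is of fourth order in \<open>u\<close>; the usual truncation
  inequality with \<open>1 - cos (u x)\<close> would only give tails of order \<open>m / n\<close>, too large for tightness.\<close>

lemma (in real_distribution) tail_le_char_integral:
  assumes U: "0 < U"
  shows "3 / 4 * U * measure M {x. 3 / U \<le> \<bar>x\<bar>} \<le>
    (\<integral>u. indicator {0..U} u * (3 / 2 - 2 * Re (char M u) + Re (char M (2 * u)) / 2) \<partial>lborel)"
proof -
  interpret P: pair_sigma_finite lborel M ..
  define f :: "real \<Rightarrow> real \<Rightarrow> real" where "f u x = indicator {0..U} u * (1 - cos (u * x))\<^sup>2" for u x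
  have f_nonneg: "0 \<le> f u x" for u x by (simp add: f_def)
  have cos_sq: "(1 - cos s)\<^sup>2 = 3 / 2 - 2 * cos s + cos (2 * s) / 2" for s :: real
    using cos_double_cos[of s] by (simp add: power2_diff field_simps)
  have f_le: "(1 - cos s)\<^sup>2 \<le> 4" for s :: real
    using power_mono[of "\<bar>1 - cos s\<bar>" 2 2] abs_cos_le_one[of s] by (simp add: abs_le_iff)
  have int: "integrable (lborel \<Otimes>\<^sub>M M) (case_prod f)"
  proof (rule integrableI_bounded_set[where A = "{0..U} \<times> space M" and B = 4])
    have "emeasure M UNIV = 1" using emeasure_space_1 by simp
    then show "emeasure (lborel \<Otimes>\<^sub>M M) ({0..U} \<times> space M) < \<infinity>"
      using U by (subst emeasure_pair_measure_Times) (auto simp: ennreal_less_top)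
    show "case_prod f \<in> borel_measurable (lborel \<Otimes>\<^sub>M M)"
      unfolding f_def[abs_def] split_beta' by measurable
    show "AE z in lborel \<Otimes>\<^sub>M M. z \<notin> {0..U} \<times> space M \<longrightarrow> case_prod f z = 0"
      by (intro AE_I2) (auto simp: f_def indicator_def)
  qed (auto simp: f_def f_le split: split_indicator)
  have g: "(\<integral>u. f u x \<partial>lborel) \<ge> 3 / 4 * U * indicator {x. 3 / U \<le> \<bar>x\<bar>} x" for x
  proof (cases "3 / U \<le> \<bar>x\<bar>")
    case False
    then show ?thesis by (simp add: f_nonneg)
  next
    case True
    have x: "x \<noteq> 0" using True U by auto
    define F where "F u = 3 / 2 * u - 2 * (sin (u * x) / x) + sin (2 * (u * x)) / (4 * x)" for u
    have "(\<integral>u. (1 - cos (u * x))\<^sup>2 * indicator {0..U} u \<partial>lborel) = F U - F 0"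
    proof (rule integral_FTC_Icc_real)
      show "DERIV F u :> (1 - cos (u * x))\<^sup>2" for u
        unfolding F_def cos_sq by (auto intro!: derivative_eq_intros simp: x field_simps)
      show "isCont (\<lambda>u. (1 - cos (u * x))\<^sup>2) u" for u by (intro continuous_intros)
    qed (use U in auto)
    then have eq: "(\<integral>u. f u x \<partial>lborel) = F U" by (simp add: f_def F_def mult.commute)
    \<comment> \<open>For U |x| \<ge> 3 the oscillating terms of F U take away at most 2 U / 3 and U
      / 12 from 3 U / 2, which leaves 3 U / 4.\<close>
    have ax: "U * \<bar>x\<bar> \<ge> 3" using True U by (simp add: field_simps)
    have "\<bar>sin (U * x) / x\<bar> \<le> 1 / \<bar>x\<bar>"
      unfolding abs_divide by (intro divide_right_mono) auto
    moreover have "1 / \<bar>x\<bar> \<le> U / 3"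
      using ax x by (simp add: field_simps)
    ultimately have a: "sin (U * x) / x \<le> U / 3" by linarith
    have "- (1 / \<bar>4 * x\<bar>) \<le> sin (2 * (U * x)) / (4 * x)"
    proof -
      have "\<bar>sin (2 * (U * x)) / (4 * x)\<bar> \<le> 1 / \<bar>4 * x\<bar>"
        unfolding abs_divide by (intro divide_right_mono) auto
      then show ?thesis by linarith
    qed
    moreover have "1 / \<bar>4 * x\<bar> \<le> U / 12"
      using ax x by (simp add: field_simps abs_mult)
    ultimately have "- (U / 12) \<le> sin (2 * (U * x)) / (4 * x)" by linarith
    with a have "3 / 4 * U \<le> F U" unfolding F_def by linarith
    then show ?thesis using True eq by simp
  qed
  have "3 / 4 * U * measure M {x. 3 / U \<le> \<bar>x\<bar>} = (\<integral>x. 3 / 4 * U * indicator {x. 3 / U \<le> \<bar>x\<bar>} x \<partial>M)"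
    by simp
  also have "\<dots> \<le> (\<integral>x. (\<integral>u. f u x \<partial>lborel) \<partial>M)"
  proof (rule integral_mono[OF _ _ g])
    have "{x. 3 / U \<le> \<bar>x\<bar>} \<in> sets borel" by measurable
    then show "integrable M (\<lambda>x. 3 / 4 * U * indicator {x. 3 / U \<le> \<bar>x\<bar>} x)"
      by (intro integrable_mult_right integrable_real_indicator) (auto simp: less_top[symmetric])
    show "integrable M (\<lambda>x. \<integral>u. f u x \<partial>lborel)"
      using P.integrable_snd[OF int] by simp
  qed
  also have "\<dots> = (\<integral>u. (\<integral>x. f u x \<partial>M) \<partial>lborel)"
    by (rule P.Fubini_integral[OF int])
  also have "\<dots> = (\<integral>u. indicator {0..U} u * (3 / 2 - 2 * Re (char M u) + Re (char M (2 * u)) / 2) \<partial>lborel)"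
  proof (rule Bochner_Integration.integral_cong)
    fix u
    have i: "integrable M (\<lambda>x. iexp (t * x))" for t
      by (intro integrable_const_bound[where B = 1]) auto
    have re: "Re (char M t) = (\<integral>x. cos (t * x) \<partial>M)" for t
      unfolding char_def by (subst integral_Re[OF i, symmetric]) (simp add: Re_exp)
    have ic: "integrable M (\<lambda>x. cos (t * x))" for t
      by (intro integrable_const_bound[where B = 1]) auto
    have "(\<integral>x. (1 - cos (u * x))\<^sup>2 \<partial>M) = 3 / 2 - 2 * Re (char M u) + Re (char M (2 * u)) / 2"
      unfolding cos_sq re using ic[of u] ic[of "2 * u"] prob_space
      by (simp add: mult.assoc)
    then show "(\<integral>x. f u x \<partial>M) = indicator {0..U} u * (3 / 2 - 2 * Re (char M u) + Re (char M (2 * u)) / 2)"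
      by (simp add: f_def)
  qed simp
  finally show ?thesis .
qed

text \<open>This is the integrand above for a Gaussian law, where doubling the frequency multiplies
  the exponent by 4. In w = exp (- s) the expression 3 / 2 - 2 w + w^4 / 2 has a double zero at w =
  1, so it is of order s^2.\<close>

lemma exp_fourth_order_bound:
  assumes "0 \<le> (s::real)"
  shows "3 / 2 - 2 * exp (- s) + exp (- (4 * s)) / 2 \<le> 3 * s\<^sup>2"
proof -
  define w where "w = exp (- s)"
  have w: "0 \<le> w" "w \<le> 1" "1 - w \<le> s"
    using assms exp_ge_add_one_self[of "- s"] by (auto simp: w_def)
  have "3 / 2 - 2 * exp (- s) + exp (- (4 * s)) / 2 = 3 / 2 - 2 * w + w ^ 4 / 2"
    by (simp add: w_def exp_of_nat_mult[symmetric])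
  also have "\<dots> = (1 - w)\<^sup>2 * ((w\<^sup>2 + 2 * w + 3) / 2)"
    by (simp add: power2_eq_square power4_eq_xxxx field_simps)
  also have "\<dots> \<le> s\<^sup>2 * 3"
  proof (intro mult_mono power_mono)
    have "w\<^sup>2 \<le> 1" using w by (simp add: power_le_one)
    then show "(w\<^sup>2 + 2 * w + 3) / 2 \<le> 3" using w by simp
  qed (use w in auto)
  finally show ?thesis by simp
qed

section \<open>Tails of the perturbed walk at a fixed time\<close>

lemma pmf_char_eq_char:
  "pmf_char p x (u *\<^sub>R \<theta>) = char (distr (measure_pmf p) borel (\<lambda>y. \<theta> \<bullet> rvec (y - x))) u"
  unfolding char_def pmf_char_def by (subst integral_distr) auto

lemma real_distribution_distr_pmf: "real_distribution (distr (measure_pmf p) borel f)"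
  by (rule prob_space.real_distribution_distr[OF prob_space_measure_pmf]) simp

lemma measurable_pmf_char: "(\<lambda>u. pmf_char p x (u *\<^sub>R \<theta>)) \<in> borel_measurable borel"
  unfolding pmf_char_eq_char by (rule real_distribution.char_measurable[OF real_distribution_distr_pmf])

context perturbed_walk
begin

lemma measurable_total_err: "(\<lambda>u. total_err T n (u *\<^sub>R \<theta>)) \<in> borel_measurable borel"
proof -
  have [measurable]: "(\<lambda>u. pmf_char p x ((u *\<^sub>R \<theta>) /\<^sub>R sqrt (real n))) \<in> borel_measurable borel" for p x
    using measurable_pmf_char[of p x "\<theta> /\<^sub>R sqrt (real n)"] by (simp add: mult.commute)
  show ?thesis
    unfolding total_err_def char_err_def perturb_err_def qform_scaleR by measurable
qed

text \<open>With U = 3 / r the Gaussian part of the frequency integral contributes at most 4 (s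
  U)^2, where s U = q U^2 (m / n) / 2; this is the term with 81. Its quadratic dependence on m / n
  is what tightness needs. The deviation from the Gaussian is integrated over [0, U] and tends to 0
  uniformly in m and x.\<close>

lemma kpow_coordinate_tail:
  assumes r: "0 < r" and T: "0 < T"
  shows "\<exists>\<epsilon>. \<epsilon> \<longlonglongrightarrow> 0 \<and> (\<forall>n\<ge>2. \<forall>m\<le>T * n. \<forall>x.
    measure (measure_pmf (kpow K m x)) {y. r * sqrt (real n) \<le> \<bar>\<theta> \<bullet> rvec (y - x)\<bar>}
      \<le> 81 * (qform \<mu> \<theta>)\<^sup>2 / r ^ 4 * (real m / real n)\<^sup>2 + \<epsilon> n)"
proof -
  define U where "U = 3 / r"
  have U: "0 < U" "3 / U = r" using r by (auto simp: U_def)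
  define e where "e n u = 2 * total_err T n (u *\<^sub>R \<theta>) + total_err T n ((2 * u) *\<^sub>R \<theta>) / 2" for n u
  define \<epsilon> where "\<epsilon> n = 4 / (3 * U) * (\<integral>u. indicator {0..U} u * e n u \<partial>lborel)" for n
  have e_meas[measurable]: "e n \<in> borel_measurable borel" for n
  proof -
    have "(\<lambda>u. total_err T n ((2 * u) *\<^sub>R \<theta>)) \<in> borel_measurable borel"
      using measurable_compose[OF _ measurable_total_err, of "\<lambda>u. 2 * u" borel T n \<theta>] by simp
    then show ?thesis
      unfolding e_def[abs_def] using measurable_total_err[of T n \<theta>] by measurable
  qed
  have e_bd: "0 \<le> e n u" "e n u \<le> 5" if "2 \<le> n" for n u
    using total_err_bounds(1)[OF that T, of "u *\<^sub>R \<theta>"] total_err_bounds(1)[OF that T, of "(2 * u) *\<^sub>R \<theta>"]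
      total_err_bounds(2)[of T n "u *\<^sub>R \<theta>"] total_err_bounds(2)[of T n "(2 * u) *\<^sub>R \<theta>"]
    unfolding e_def by linarith+
  have ind5: "integrable lborel (\<lambda>u. indicator {0..U} u * 5 :: real)"
    using U by (intro integrable_mult_left integrable_real_indicator) auto
  have ie: "integrable lborel (\<lambda>u. indicator {0..U} u * e n u)" if "2 \<le> n" for n
    by (rule Bochner_Integration.integrable_bound[OF ind5])
       (use e_bd[OF that] in \<open>auto split: split_indicator\<close>)
  \<comment> \<open>The bounds 0 \<le> e n u \<le> 5 are available for n \<ge> 2 only, so dominated
    convergence is applied to the shifted sequence.\<close>
  have "(\<lambda>n. \<integral>u. indicator {0..U} u * e (n + 2) u \<partial>lborel) \<longlonglongrightarrow> (\<integral>u. 0 \<partial>(lborel :: real measure))"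
  proof (rule integral_dominated_convergence[where w = "\<lambda>u. indicator {0..U} u * 5"])
    show "integrable lborel (\<lambda>u. indicator {0..U} u * 5 :: real)" by (rule ind5)
    show "AE u in lborel. (\<lambda>n. indicator {0..U} u * e (n + 2) u) \<longlonglongrightarrow> 0"
    proof (rule AE_I2)
      fix u
      have "(\<lambda>n. e n u) \<longlonglongrightarrow> 2 * 0 + 0 / 2"
        unfolding e_def by (intro tendsto_intros total_err_tendsto_0 T) simp
      then have "(\<lambda>n. e n u) \<longlonglongrightarrow> 0" by simp
      then have "(\<lambda>n. e (n + 2) u) \<longlonglongrightarrow> 0" by (rule LIMSEQ_ignore_initial_segment)
      then show "(\<lambda>n. indicator {0..U} u * e (n + 2) u) \<longlonglongrightarrow> 0" by (rule tendsto_mult_right_zero)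
    qed
    show "AE u in lborel. norm (indicator {0..U} u * e (n + 2) u) \<le> indicator {0..U} u * 5" for n
      using e_bd[of "n + 2"] by (intro AE_I2) (auto split: split_indicator)
  qed auto
  then have "(\<lambda>n. \<integral>u. indicator {0..U} u * e (n + 2) u \<partial>lborel) \<longlonglongrightarrow> 0"
    by (simp del: add_2_eq_Suc')
  then have "(\<lambda>n. \<integral>u. indicator {0..U} u * e n u \<partial>lborel) \<longlonglongrightarrow> 0"
    by (rule LIMSEQ_offset)
  then have \<epsilon>: "\<epsilon> \<longlonglongrightarrow> 0"
    unfolding \<epsilon>_def by (rule tendsto_mult_right_zero)
  have main: "measure (measure_pmf (kpow K m x)) {y. r * sqrt (real n) \<le> \<bar>\<theta> \<bullet> rvec (y - x)\<bar>}
      \<le> 81 * (qform \<mu> \<theta>)\<^sup>2 / r ^ 4 * (real m / real n)\<^sup>2 + \<epsilon> n"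
    if n: "2 \<le> n" and m: "m \<le> T * n" for n m x
  proof -
    let ?p = "measure_pmf (kpow K m x)"
    define q where "q = qform \<mu> \<theta>"
    define \<nu> where "\<nu> = distr ?p borel (\<lambda>y. (\<theta> /\<^sub>R sqrt (real n)) \<bullet> rvec (y - x))"
    interpret \<nu>: real_distribution \<nu> unfolding \<nu>_def by (rule real_distribution_distr_pmf)
    define s where "s u = q * u\<^sup>2 * (real m / real n) / 2" for u
    have s0: "0 \<le> s u" for u by (simp add: s_def q_def qform_nonneg)
    have ch: "\<bar>Re (char \<nu> u) - exp (- s u)\<bar> \<le> total_err T n (u *\<^sub>R \<theta>)" for u
    proof -
      have "char \<nu> u = pmf_char (kpow K m x) x ((u *\<^sub>R \<theta>) /\<^sub>R sqrt (real n))"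
        unfolding \<nu>_def pmf_char_eq_char[symmetric] by (simp add: mult.commute)
      then have "norm (char \<nu> u - of_real (exp (- s u))) \<le> total_err T n (u *\<^sub>R \<theta>)"
        using char_kpow[OF n T m, of x "u *\<^sub>R \<theta>"] by (simp add: qform_scaleR s_def q_def mult_ac)
      then show ?thesis using abs_Re_le_cmod[of "char \<nu> u - of_real (exp (- s u))"] by simp
    qed
    have pt: "indicator {0..U} u * (3 / 2 - 2 * Re (char \<nu> u) + Re (char \<nu> (2 * u)) / 2)
        \<le> indicator {0..U} u * (3 * (s U)\<^sup>2) + indicator {0..U} u * e n u" for u
    proof (cases "u \<in> {0..U}")
      case True
      have "s (2 * u) = 4 * s u" by (simp add: s_def power_mult_distrib)
      then have "3 / 2 - 2 * Re (char \<nu> u) + Re (char \<nu> (2 * u)) / 2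
          \<le> (3 / 2 - 2 * exp (- s u) + exp (- (4 * s u)) / 2) + e n u"
        using ch[of u] ch[of "2 * u"] unfolding e_def by (simp add: abs_le_iff)
      also have "3 / 2 - 2 * exp (- s u) + exp (- (4 * s u)) / 2 \<le> 3 * (s u)\<^sup>2"
        by (rule exp_fourth_order_bound[OF s0])
      also have "3 * (s u)\<^sup>2 \<le> 3 * (s U)\<^sup>2"
      proof (intro mult_left_mono power_mono)
        show "s u \<le> s U" unfolding s_def using True
          by (intro divide_right_mono mult_right_mono mult_left_mono power_mono) (auto simp: q_def qform_nonneg)
      qed (auto simp: s0)
      finally show ?thesis using True by simp
    qed simp
    have i3: "integrable lborel (\<lambda>u. indicator {0..U} u * (3 * (s U)\<^sup>2))"
      using U by (intro integrable_mult_left integrable_real_indicator) auto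
    have "3 / 4 * U * measure \<nu> {z. 3 / U \<le> \<bar>z\<bar>} \<le> (\<integral>u. indicator {0..U} u * (3 / 2 - 2 * Re (char \<nu> u) + Re (char \<nu> (2 * u)) / 2) \<partial>lborel)"
      by (rule \<nu>.tail_le_char_integral[OF U(1)])
    also have "\<dots> \<le> (\<integral>u. indicator {0..U} u * (3 * (s U)\<^sup>2) + indicator {0..U} u * e n u \<partial>lborel)"
    proof (rule integral_mono[OF _ _ pt])
      show "integrable lborel (\<lambda>u. indicator {0..U} u * (3 / 2 - 2 * Re (char \<nu> u) + Re (char \<nu> (2 * u)) / 2))"
      proof (rule Bochner_Integration.integrable_bound[OF ind5])
        show "(\<lambda>u. indicator {0..U} u * (3 / 2 - 2 * Re (char \<nu> u) + Re (char \<nu> (2 * u)) / 2)) \<in> borel_measurable lborel"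
          using \<nu>.char_measurable by measurable
        have "\<bar>3 / 2 - 2 * Re (char \<nu> u) + Re (char \<nu> (2 * u)) / 2\<bar> \<le> 5" for u
          using \<nu>.cmod_char_le_1[of u] \<nu>.cmod_char_le_1[of "2 * u"] abs_Re_le_cmod[of "char \<nu> u"] abs_Re_le_cmod[of "char \<nu> (2 * u)"]
          by (simp add: abs_le_iff)
        then show "AE u in lborel. norm (indicator {0..U} u * (3 / 2 - 2 * Re (char \<nu> u) + Re (char \<nu> (2 * u)) / 2)) \<le> norm (indicator {0..U} u * 5 :: real)"
          by (intro AE_I2) (simp split: split_indicator)
      qed
      show "integrable lborel (\<lambda>u. indicator {0..U} u * (3 * (s U)\<^sup>2) + indicator {0..U} u * e n u)"
        by (intro Bochner_Integration.integrable_add i3 ie n)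
    qed
    also have "\<dots> = 3 * (s U)\<^sup>2 * U + (\<integral>u. indicator {0..U} u * e n u \<partial>lborel)"
      using U by (subst Bochner_Integration.integral_add[OF i3 ie[OF n]]) simp
    finally have "measure \<nu> {z. r \<le> \<bar>z\<bar>} \<le> 4 / (3 * U) * (3 * (s U)\<^sup>2 * U + (\<integral>u. indicator {0..U} u * e n u \<partial>lborel))"
      using U by (simp add: field_simps)
    also have "\<dots> = 4 * (s U)\<^sup>2 + \<epsilon> n" using U by (simp add: \<epsilon>_def distrib_left)
    also have "4 * (s U)\<^sup>2 = 81 * q\<^sup>2 / r ^ 4 * (real m / real n)\<^sup>2"
      by (simp add: s_def U_def power_divide power_mult_distrib power2_eq_square power4_eq_xxxx)
    also have "measure \<nu> {z. r \<le> \<bar>z\<bar>} = measure ?p {y. r * sqrt (real n) \<le> \<bar>\<theta> \<bullet> rvec (y - x)\<bar>}"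
    proof -
      have "r \<le> \<bar>(\<theta> /\<^sub>R sqrt (real n)) \<bullet> rvec (y - x)\<bar> \<longleftrightarrow> r * sqrt (real n) \<le> \<bar>\<theta> \<bullet> rvec (y - x)\<bar>" for y
        using n by (simp add: abs_mult field_simps)
      then show ?thesis unfolding \<nu>_def by (subst measure_distr) (auto simp: vimage_def)
    qed
    finally show ?thesis by (simp add: q_def)
  qed
  show ?thesis using \<epsilon> main by blast
qed

text \<open>A vector longer than r has a coordinate of modulus at least r / 2, and 16 is the fourth
  power of that 2. The constant c is fixed before r and T, while the vanishing error may depend on
  both.\<close>

lemma kpow_tail:
  "\<exists>c\<ge>0. \<forall>r>0. \<forall>T>0. \<exists>\<epsilon>. \<epsilon> \<longlonglongrightarrow> 0 \<and> (\<forall>n\<ge>2. \<forall>m\<le>T * n. \<forall>x.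
    measure (measure_pmf (kpow K m x)) {y. r * sqrt (real n) < norm (rvec (y - x))} \<le> c / r ^ 4 * (real m / real n)\<^sup>2 + \<epsilon> n)"
proof (intro exI[of _ "16 * 81 * ((qform \<mu> (axis 1 1))\<^sup>2 + (qform \<mu> (axis 2 1))\<^sup>2)"] conjI allI impI)
  fix r :: real and T :: nat assume r: "0 < r" and T: "0 < T"
  obtain \<epsilon>1 where e1: "\<epsilon>1 \<longlonglongrightarrow> 0" "\<And>n m x. 2 \<le> n \<Longrightarrow> m \<le> T * n \<Longrightarrow>
    measure (measure_pmf (kpow K m x)) {y. r / 2 * sqrt (real n) \<le> \<bar>axis 1 1 \<bullet> rvec (y - x)\<bar>}
      \<le> 81 * (qform \<mu> (axis 1 1))\<^sup>2 / (r / 2) ^ 4 * (real m / real n)\<^sup>2 + \<epsilon>1 n"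
    using kpow_coordinate_tail[OF _ T, of "r / 2" "axis 1 1"] r by auto
  obtain \<epsilon>2 where e2: "\<epsilon>2 \<longlonglongrightarrow> 0" "\<And>n m x. 2 \<le> n \<Longrightarrow> m \<le> T * n \<Longrightarrow>
    measure (measure_pmf (kpow K m x)) {y. r / 2 * sqrt (real n) \<le> \<bar>axis 2 1 \<bullet> rvec (y - x)\<bar>}
      \<le> 81 * (qform \<mu> (axis 2 1))\<^sup>2 / (r / 2) ^ 4 * (real m / real n)\<^sup>2 + \<epsilon>2 n"
    using kpow_coordinate_tail[OF _ T, of "r / 2" "axis 2 1"] r by auto
  show "\<exists>\<epsilon>. \<epsilon> \<longlonglongrightarrow> 0 \<and> (\<forall>n\<ge>2. \<forall>m\<le>T * n. \<forall>x.
    measure (measure_pmf (kpow K m x)) {y. r * sqrt (real n) < norm (rvec (y - x))}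
      \<le> 16 * 81 * ((qform \<mu> (axis 1 1))\<^sup>2 + (qform \<mu> (axis 2 1))\<^sup>2) / r ^ 4 * (real m / real n)\<^sup>2 + \<epsilon> n)"
  proof (intro exI[of _ "\<lambda>n. \<epsilon>1 n + \<epsilon>2 n"] conjI allI impI)
    show "(\<lambda>n. \<epsilon>1 n + \<epsilon>2 n) \<longlonglongrightarrow> 0" using tendsto_add[OF e1(1) e2(1)] by simp
    fix n m :: nat and x assume n: "2 \<le> n" and m: "m \<le> T * n"
    let ?p = "measure_pmf (kpow K m x)"
    let ?S = "\<lambda>i::2. {y. r / 2 * sqrt (real n) \<le> \<bar>axis i 1 \<bullet> rvec (y - x)\<bar>}"
    have "{y. r * sqrt (real n) < norm (rvec (y - x))} \<subseteq> ?S 1 \<union> ?S 2"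
    proof
      fix y assume "y \<in> {y. r * sqrt (real n) < norm (rvec (y - x))}"
      moreover have "norm (rvec (y - x)) \<le> \<bar>rvec (y - x) $ 1\<bar> + \<bar>rvec (y - x) $ 2\<bar>"
        using norm_le_l1_cart[of "rvec (y - x)"] by (simp add: sum_2)
      ultimately show "y \<in> ?S 1 \<union> ?S 2" by (auto simp: inner_axis')
    qed
    then have "measure ?p {y. r * sqrt (real n) < norm (rvec (y - x))} \<le> measure ?p (?S 1 \<union> ?S 2)"
      by (intro measure_pmf.finite_measure_mono) auto
    also have "\<dots> \<le> measure ?p (?S 1) + measure ?p (?S 2)"
      by (rule measure_Un_le) auto
    also have "\<dots> \<le> (81 * (qform \<mu> (axis 1 1))\<^sup>2 / (r / 2) ^ 4 * (real m / real n)\<^sup>2 + \<epsilon>1 n)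
       + (81 * (qform \<mu> (axis 2 1))\<^sup>2 / (r / 2) ^ 4 * (real m / real n)\<^sup>2 + \<epsilon>2 n)"
      by (intro add_mono e1(2) e2(2) n m)
    also have "\<dots> = 16 * 81 * ((qform \<mu> (axis 1 1))\<^sup>2 + (qform \<mu> (axis 2 1))\<^sup>2) / r ^ 4 * (real m / real n)\<^sup>2 + (\<epsilon>1 n + \<epsilon>2 n)"
      by (simp add: power_divide add_divide_distrib distrib_left distrib_right)
    finally show "measure ?p {y. r * sqrt (real n) < norm (rvec (y - x))}
      \<le> 16 * 81 * ((qform \<mu> (axis 1 1))\<^sup>2 + (qform \<mu> (axis 2 1))\<^sup>2) / r ^ 4 * (real m / real n)\<^sup>2 + (\<epsilon>1 n + \<epsilon>2 n)" .
  qed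
qed simp

end

section \<open>Ottaviani's inequality for leaving a ball\<close>

primrec exit_prob :: "(Z2 \<Rightarrow> Z2 pmf) \<Rightarrow> real \<Rightarrow> Z2 \<Rightarrow> nat \<Rightarrow> Z2 \<Rightarrow> real" where
  "exit_prob K r x0 0 x = of_bool (r < norm (rvec (x - x0)))"
| "exit_prob K r x0 (Suc m) x =
    (if r < norm (rvec (x - x0)) then 1 else \<integral>y. exit_prob K r x0 m y \<partial>measure_pmf (K x))"

lemma exit_prob_bounds: "0 \<le> exit_prob K r x0 m x" "exit_prob K r x0 m x \<le> 1"
proof -
  have "0 \<le> exit_prob K r x0 m x \<and> exit_prob K r x0 m x \<le> 1"
  proof (induction m arbitrary: x)
    case (Suc m)
    have "norm (\<integral>y. exit_prob K r x0 m y \<partial>measure_pmf (K x)) \<le> 1"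
      by (rule norm_integral_pmf_le) (use Suc.IH in auto)
    then have "(\<integral>y. exit_prob K r x0 m y \<partial>measure_pmf (K x)) \<le> 1" by (simp add: abs_le_iff)
    then show ?case using Suc.IH by auto
  qed simp
  then show "0 \<le> exit_prob K r x0 m x" "exit_prob K r x0 m x \<le> 1" by auto
qed

text \<open>When the chain is for the first time farther than 2 r from x0, it moves by at most r
  during the remaining steps with probability at least 1 / 2, and then ends farther than r from x0.
  For a Markov chain this requires the hypothesis at every state and every remaining time. The
  centre x0 is kept apart from the moving start x, so that the induction can follow the
  chain.\<close>

lemma exit_prob_ottaviani:
  assumes half: "\<And>k y. k \<le> m \<Longrightarrow> measure (measure_pmf (kpow K k y)) {z. r < norm (rvec (z - y))} \<le> 1 / 2"
  shows "exit_prob K (2 * r) x0 m x \<le> 2 * measure (measure_pmf (kpow K m x)) {z. r < norm (rvec (z - x0))}"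
  using half
proof (induction m arbitrary: x)
  case 0
  show ?case
  proof (cases "2 * r < norm (rvec (x - x0))")
    case True
    then have "r < norm (rvec (x - x0))" using norm_ge_zero[of "rvec (x - x0)"] by linarith
    then show ?thesis by simp
  qed simp
next
  case (Suc m)
  show ?case
  proof (cases "2 * r < norm (rvec (x - x0))")
    case True
    let ?p = "measure_pmf (kpow K (Suc m) x)"
    have "1 / 2 \<le> 1 - measure ?p {z. r < norm (rvec (z - x))}" using Suc.prems[of "Suc m" x] by simp
    also have "\<dots> = measure ?p (- {z. r < norm (rvec (z - x))})"
      using measure_pmf.prob_compl[of "{z. r < norm (rvec (z - x))}" "kpow K (Suc m) x"] by (simp add: Compl_eq_Diff_UNIV)
    also have "\<dots> \<le> measure ?p {z. r < norm (rvec (z - x0))}"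
    proof (intro measure_pmf.finite_measure_mono)
      show "- {z. r < norm (rvec (z - x))} \<subseteq> {z. r < norm (rvec (z - x0))}"
      proof
        fix z assume "z \<in> - {z. r < norm (rvec (z - x))}"
        moreover have "norm (rvec (x - x0)) \<le> norm (rvec (z - x0)) + norm (rvec (z - x))"
        proof -
          have "rvec (x - x0) = rvec (z - x0) - rvec (z - x)" by (simp add: rvec_diff)
          then show ?thesis by (metis norm_triangle_ineq4)
        qed
        ultimately show "z \<in> {z. r < norm (rvec (z - x0))}" using True by simp
      qed
    qed simp
    finally show ?thesis using True by simp
  next
    case False
    have "exit_prob K (2 * r) x0 (Suc m) x = (\<integral>y. exit_prob K (2 * r) x0 m y \<partial>measure_pmf (K x))"
      using False by simp
    also have "\<dots> \<le> (\<integral>y. 2 * measure (measure_pmf (kpow K m y)) {z. r < norm (rvec (z - x0))} \<partial>measure_pmf (K x))"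
    proof (rule integral_mono)
      show "integrable (measure_pmf (K x)) (exit_prob K (2 * r) x0 m)"
        by (rule integrable_measure_pmf_bounded[where C = 1]) (simp add: exit_prob_bounds)
      show "integrable (measure_pmf (K x)) (\<lambda>y. 2 * measure (measure_pmf (kpow K m y)) {z. r < norm (rvec (z - x0))})"
        by (rule integrable_measure_pmf_bounded[where C = 2]) simp
      show "exit_prob K (2 * r) x0 m y \<le> 2 * measure (measure_pmf (kpow K m y)) {z. r < norm (rvec (z - x0))}" for y
        by (rule Suc.IH) (use Suc.prems in auto)
    qed
    also have "\<dots> = 2 * measure (measure_pmf (kpow K (Suc m) x)) {z. r < norm (rvec (z - x0))}"
      by (simp add: measure_bind_pmf)
    finally show ?thesis .
  qed
qed

context perturbed_walk
begin

lemma exit_prob_tail: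
  "\<exists>c\<ge>0. \<forall>r>0. \<forall>T>0. \<exists>\<epsilon>. \<epsilon> \<longlonglongrightarrow> 0 \<and> (\<forall>n\<ge>2. \<forall>m\<le>T * n. \<forall>x.
    exit_prob K (r * sqrt (real n)) x m x \<le> c / r ^ 4 * (real m / real n)\<^sup>2 + \<epsilon> n)"
proof -
  obtain c where c: "0 \<le> c" and tail: "\<forall>r>0. \<forall>T>0. \<exists>\<epsilon>. \<epsilon> \<longlonglongrightarrow> 0 \<and> (\<forall>n\<ge>2. \<forall>m\<le>T * n. \<forall>x.
    measure (measure_pmf (kpow K m x)) {y. r * sqrt (real n) < norm (rvec (y - x))} \<le> c / r ^ 4 * (real m / real n)\<^sup>2 + \<epsilon> n)"
    using kpow_tail by (elim exE conjE) (rule that)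
  show ?thesis
  proof (intro exI[of _ "32 * c"] conjI allI impI)
    fix r :: real and T :: nat assume r: "0 < r" and T: "0 < T"
    obtain \<epsilon> where e: "\<epsilon> \<longlonglongrightarrow> 0" "\<And>n m x. 2 \<le> n \<Longrightarrow> m \<le> T * n \<Longrightarrow>
      measure (measure_pmf (kpow K m x)) {y. r / 2 * sqrt (real n) < norm (rvec (y - x))} \<le> c / (r / 2) ^ 4 * (real m / real n)\<^sup>2 + \<epsilon> n"
      using tail[rule_format, of "r / 2" T] r T by auto
    show "\<exists>\<epsilon>. \<epsilon> \<longlonglongrightarrow> 0 \<and> (\<forall>n\<ge>2. \<forall>m\<le>T * n. \<forall>x.
      exit_prob K (r * sqrt (real n)) x m x \<le> 32 * c / r ^ 4 * (real m / real n)\<^sup>2 + \<epsilon> n)"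
    proof (intro exI[of _ "\<lambda>n. 2 * \<epsilon> n"] conjI allI impI)
      show "(\<lambda>n. 2 * \<epsilon> n) \<longlonglongrightarrow> 0" using tendsto_mult_right_zero[OF e(1)] by simp
      fix n m :: nat and x assume n: "2 \<le> n" and m: "m \<le> T * n"
      define b where "b = c / (r / 2) ^ 4 * (real m / real n)\<^sup>2 + \<epsilon> n"
      have b2: "2 * b = 32 * c / r ^ 4 * (real m / real n)\<^sup>2 + 2 * \<epsilon> n"
        by (simp add: b_def power_divide)
      have "exit_prob K (r * sqrt (real n)) x m x \<le> 2 * b"
      \<comment> \<open>If b > 1 / 2 the claimed bound exceeds 1. Otherwise b, which is increasing
        in m, provides Ottaviani's hypothesis at all times k \<le> m.\<close>
      proof (cases "b \<le> 1 / 2")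
        case True
        have "measure (measure_pmf (kpow K k y)) {z. r / 2 * sqrt (real n) < norm (rvec (z - y))} \<le> 1 / 2" if "k \<le> m" for k y
        proof -
          have "measure (measure_pmf (kpow K k y)) {z. r / 2 * sqrt (real n) < norm (rvec (z - y))} \<le> c / (r / 2) ^ 4 * (real k / real n)\<^sup>2 + \<epsilon> n"
            using that m by (intro e(2) n) auto
          also have "\<dots> \<le> b" unfolding b_def using that c r
            by (intro add_right_mono mult_left_mono power_mono divide_right_mono) auto
          finally show ?thesis using True by linarith
        qed
        from exit_prob_ottaviani[OF this, of m x x]
        have "exit_prob K (2 * (r / 2 * sqrt (real n))) x m x \<le> 2 * measure (measure_pmf (kpow K m x)) {z. r / 2 * sqrt (real n) < norm (rvec (z - x))}"
          by blast
        then show ?thesis using e(2)[OF n m, of x] by (simp add: b_def)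
      next
        case False
        then show ?thesis using exit_prob_bounds(2)[of K "r * sqrt (real n)" x m x] by linarith
      qed
      then show "exit_prob K (r * sqrt (real n)) x m x \<le> 32 * c / r ^ 4 * (real m / real n)\<^sup>2 + 2 * \<epsilon> n"
        by (simp only: b2)
    qed
  qed (use c in simp)
qed

end

section \<open>Weak convergence from characteristic functions\<close>

text \<open>Real trigonometric polynomials in y 0, ..., y J. The phase b supplies the sines, and
  products of cosines are sums of cosines, so this is an algebra whose expectations are determined
  by joint characteristic functions.\<close>

inductive trig :: "nat \<Rightarrow> ((nat \<Rightarrow> R2) \<Rightarrow> real) \<Rightarrow> bool" for J where
  trig_cos: "trig J (\<lambda>y. cos ((\<Sum>j\<le>J. z j \<bullet> y j) + b))"
| trig_add: "trig J p \<Longrightarrow> trig J q \<Longrightarrow> trig J (\<lambda>y. p y + q y)"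
| trig_scale: "trig J p \<Longrightarrow> trig J (\<lambda>y. c * p y)"

lemma trig_const: "trig J (\<lambda>_. c)"
  using trig_scale[OF trig_cos[of J "\<lambda>_. 0" 0], of c] by simp

lemma trig_cos_mult:
  assumes "trig J q"
  shows "trig J (\<lambda>y. cos ((\<Sum>j\<le>J. z j \<bullet> y j) + b) * q y)"
  using assms
proof induction
  case (trig_cos w d)
  have "trig J (\<lambda>y. (1 / 2) * (cos ((\<Sum>j\<le>J. (z j - w j) \<bullet> y j) + (b - d)) + cos ((\<Sum>j\<le>J. (z j + w j) \<bullet> y j) + (b + d))))"
    by (intro trig.intros)
  moreover have "(1 / 2) * (cos ((\<Sum>j\<le>J. (z j - w j) \<bullet> y j) + (b - d)) + cos ((\<Sum>j\<le>J. (z j + w j) \<bullet> y j) + (b + d)))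
    = cos ((\<Sum>j\<le>J. z j \<bullet> y j) + b) * cos ((\<Sum>j\<le>J. w j \<bullet> y j) + d)" for y
    by (simp add: cos_times_cos inner_diff_left inner_add_left sum_subtractf sum.distrib algebra_simps)
  ultimately show ?case by simp
next
  case (trig_add p q)
  then show ?case using trig.trig_add[OF trig_add.IH] by (simp add: distrib_left)
next
  case (trig_scale p c)
  then show ?case using trig.trig_scale[OF trig_scale.IH, of c] by (simp add: mult.left_commute)
qed

lemma trig_mult:
  assumes "trig J p" "trig J q"
  shows "trig J (\<lambda>y. p y * q y)"
  using assms(1)
proof induction
  case (trig_cos w d)
  show ?case by (rule trig_cos_mult[OF assms(2)])
next
  case (trig_add p p')
  then show ?case using trig.trig_add[OF trig_add.IH] by (simp add: distrib_right)
next
  case (trig_scale p c)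
  then show ?case using trig.trig_scale[OF trig_scale.IH, of c] by (simp add: mult.assoc)
qed

lemma trig_sin_coordinate:
  assumes "j \<le> J"
  shows "trig J (\<lambda>y. sin (a * y j $ i))"
proof -
  have "(\<Sum>l\<le>J. (if l = j then axis i a else 0) \<bullet> y l) = a * y j $ i" for y :: "nat \<Rightarrow> R2"
  proof -
    have "(\<Sum>l\<le>J. (if l = j then axis i a else 0) \<bullet> y l) = (\<Sum>l\<le>J. if l = j then axis i a \<bullet> y l else 0)"
      by (rule sum.cong) auto
    also have "\<dots> = a * y j $ i" using assms by (simp add: inner_axis')
    finally show ?thesis .
  qed
  moreover have "cos (t + (- (pi / 2))) = sin t" for t :: real
    unfolding cos_add by simp
  ultimately show ?thesis
    using trig_cos[of J "\<lambda>l. if l = j then axis i a else 0" "- (pi / 2)"] by simp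
qed

lemma trig_bounded: "trig J p \<Longrightarrow> \<exists>C. \<forall>y. \<bar>p y\<bar> \<le> C"
proof (induction rule: trig.induct)
  case (trig_cos z b)
  then show ?case by (intro exI[of _ 1]) simp
next
  case (trig_add p q)
  then obtain C D where "\<And>y. \<bar>p y\<bar> \<le> C" "\<And>y. \<bar>q y\<bar> \<le> D" by blast
  then show ?case by (intro exI[of _ "C + D"]) (meson abs_triangle_ineq add_mono order_trans)
next
  case (trig_scale p c)
  then obtain C where "\<And>y. \<bar>p y\<bar> \<le> C" by blast
  then show ?case by (intro exI[of _ "\<bar>c\<bar> * C"]) (simp add: abs_mult mult_left_mono)
qed

lemma continuous_on_coordinate: "continuous_on S (\<lambda>y::nat \<Rightarrow> 'b::topological_space. y j)"
  by (rule continuous_on_product_then_coordinatewise[OF continuous_on_id])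

lemma trig_continuous: "trig J p \<Longrightarrow> continuous_on UNIV p"
  by (induction rule: trig.induct) (auto intro!: continuous_intros continuous_on_coordinate)

text \<open>The substitution \<open>v = sin (a y)\<close> turns \<open>g\<close> into a continuous function on a cube, where the Stone--Weierstrass
  theorem applies; unlike an approximation on a box in the variable \<open>y\<close>, the result stays bounded outside.\<close>

lemma trig_approximation:
  fixes g :: "(nat \<Rightarrow> R2) \<Rightarrow> real"
  assumes g: "continuous_on UNIV g" and bd: "\<And>v. \<bar>g v\<bar> \<le> C"
    and dep: "\<And>v. g v = g (\<lambda>j. if j \<le> J then v j else 0)"
    and e: "0 < e" and R: "0 < R"
  shows "\<exists>p. trig J p \<and> (\<forall>y. \<bar>g y - p y\<bar> \<le> e + 2 * C * of_bool (\<exists>j\<le>J. R < norm (y j)))"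
proof -
  \<comment> \<open>With this factor sin (a t) is injective for |t| \<le> R and is inverted there by
    arcsin.\<close>
  define a where "a = pi / (2 * R)"
  have a: "0 < a" using R by (simp add: a_def)
  \<comment> \<open>Coordinates beyond J are pinned to 0. This keeps S compact and lets the
    coordinates up to J, which are trigonometric polynomials in y, separate its points.\<close>
  define S where "S = Pi\<^sub>E UNIV (\<lambda>j. if j \<le> J then cbox (-1) (1::R2) else {0})"
  define \<sigma> where "\<sigma> y = (\<lambda>j. if j \<le> J then (\<chi> i. sin (a * y j $ i)) else 0)" for y :: "nat \<Rightarrow> R2"
  define h where "h v = g (\<lambda>j. if j \<le> J then (\<chi> i. arcsin (v j $ i) / a) else 0)" for v :: "nat \<Rightarrow> R2"
  have compact: "compact S"
  proof -
    have "compactin (product_topology (\<lambda>_. euclidean) UNIV) S"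
      unfolding S_def compactin_PiE by auto
    then show ?thesis by (simp add: euclidean_product_topology compactin_euclidean_iff)
  qed
  have S_bd: "-1 \<le> v j $ i \<and> v j $ i \<le> 1" if "v \<in> S" for v j i
  proof (cases "j \<le> J")
    case True
    then have "v j \<in> cbox (-1) 1" using that unfolding S_def by (auto simp: PiE_iff split: if_splits)
    then show ?thesis by (simp add: mem_box_cart)
  next
    case False
    then have "v j = 0" using that unfolding S_def by (auto simp: PiE_iff split: if_splits)
    then show ?thesis by simp
  qed
  have \<sigma>S: "\<sigma> y \<in> S" for y
    by (auto simp: \<sigma>_def S_def PiE_iff mem_box_cart)
  have h: "continuous_on S h"
    unfolding h_def
  proof (rule continuous_on_compose2[OF g])
    have "continuous_on S (\<lambda>v. if j \<le> J then (\<chi> i. arcsin (v j $ i) / a) else 0 :: R2)" for j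
    proof (cases "j \<le> J")
      case True
      then show ?thesis using a S_bd
        by (auto intro!: continuous_intros continuous_on_arcsin continuous_on_coordinate)
    qed simp
    then show "continuous_on S (\<lambda>v j. if j \<le> J then (\<chi> i. arcsin (v j $ i) / a) else 0 :: R2)"
      by (rule continuous_on_coordinatewise_then_product)
  qed simp
  define P where "P q \<longleftrightarrow> trig J (\<lambda>y. q (\<sigma> y)) \<and> continuous_on S q" for q
  have "\<exists>q. P q \<and> (\<forall>v\<in>S. \<bar>h v - q v\<bar> < e)"
  proof (rule Stone_Weierstrass_HOL[where P = P, OF compact _ _ _ _ _ h e])
    show "P (\<lambda>_. c)" for c by (simp add: P_def trig_const)
    show "P f \<Longrightarrow> continuous_on S f" for f by (simp add: P_def)
    show "P f \<and> P f' \<Longrightarrow> P (\<lambda>x. f x + f' x)" for f f'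
      by (auto simp: P_def intro!: trig_add continuous_intros)
    show "P f \<and> P f' \<Longrightarrow> P (\<lambda>x. f x * f' x)" for f f'
      by (auto simp: P_def intro!: trig_mult continuous_intros)
    fix x y assume xy: "x \<in> S \<and> y \<in> S \<and> x \<noteq> y"
    then obtain j i where ji: "x j $ i \<noteq> y j $ i" by (auto simp: fun_eq_iff vec_eq_iff)
    have "x j = 0 \<and> y j = 0" if "\<not> j \<le> J"
      using xy that unfolding S_def by (auto simp: PiE_iff split: if_splits)
    then have "j \<le> J" using ji by (cases "j \<le> J") auto
    then have "P (\<lambda>v. v j $ i)"
      using trig_sin_coordinate[of j J a i] by (auto simp: P_def \<sigma>_def intro!: continuous_intros continuous_on_coordinate)
    with ji show "\<exists>f. P f \<and> f x \<noteq> f y" by blast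
  qed
  then obtain q where q: "P q" "\<And>v. v \<in> S \<Longrightarrow> \<bar>h v - q v\<bar> < e" by blast
  have C: "0 \<le> C" using bd[of "\<lambda>_. 0"] by linarith
  show ?thesis
  proof (intro exI[of _ "\<lambda>y. q (\<sigma> y)"] conjI allI)
    show "trig J (\<lambda>y. q (\<sigma> y))" using q by (simp add: P_def)
    fix y :: "nat \<Rightarrow> R2"
    have hq: "\<bar>h (\<sigma> y) - q (\<sigma> y)\<bar> < e" by (rule q(2)[OF \<sigma>S])
    show "\<bar>g y - q (\<sigma> y)\<bar> \<le> e + 2 * C * of_bool (\<exists>j\<le>J. R < norm (y j))"
    proof (cases "\<exists>j\<le>J. R < norm (y j)")
      case True
      have "\<bar>g y - h (\<sigma> y)\<bar> \<le> 2 * C" using bd[of y] bd[of "\<lambda>j. if j \<le> J then (\<chi> i. arcsin (\<sigma> y j $ i) / a) else 0"]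
        unfolding h_def by linarith
      then show ?thesis using hq True by simp
    next
      case False
      have "arcsin (sin (a * y j $ i)) / a = y j $ i" if "j \<le> J" for j i
      proof -
        have "\<bar>y j $ i\<bar> \<le> R" using False that component_le_norm_cart[of "y j" i] by force
        then have "\<bar>a * y j $ i\<bar> \<le> a * R" using a by (simp add: abs_mult)
        also have "a * R = pi / 2" using R by (simp add: a_def)
        finally show ?thesis using a by (subst arcsin_sin) auto
      qed
      then have "h (\<sigma> y) = g (\<lambda>j. if j \<le> J then y j else 0)"
        unfolding h_def \<sigma>_def by (intro arg_cong[where f = g]) (auto simp: vec_eq_iff fun_eq_iff)
      then have "\<bar>g y - q (\<sigma> y)\<bar> < e" using hq dep[of y] by simp
      moreover have z: "of_bool (\<exists>j\<le>J. R < norm (y j)) = (0::real)" using False by auto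
      ultimately show ?thesis unfolding z by linarith
    qed
  qed
qed

section \<open>Joint characteristic functions and tightness\<close>

lemma tight_single:
  fixes V :: "'a \<Rightarrow> real"
  assumes "prob_space M" and V: "V \<in> borel_measurable M" and e: "0 < e"
  shows "\<exists>R>0. measure M {\<omega>\<in>space M. R < V \<omega>} \<le> e"
proof -
  interpret prob_space M by fact
  have "(\<lambda>n. measure M {\<omega>\<in>space M. real n < V \<omega>}) \<longlonglongrightarrow> measure M (\<Inter>n. {\<omega>\<in>space M. real n < V \<omega>})"
    using V by (intro finite_Lim_measure_decseq) (auto simp: decseq_def)
  also have "(\<Inter>n. {\<omega>\<in>space M. real n < V \<omega>}) = {}"
  proof -
    have "\<exists>n. \<not> real n < V \<omega>" for \<omega> using reals_Archimedean2[of "V \<omega>"] by (metis less_asym)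
    then show ?thesis by blast
  qed
  finally have "(\<lambda>n. measure M {\<omega>\<in>space M. real n < V \<omega>}) \<longlonglongrightarrow> 0" by simp
  then have "\<forall>\<^sub>F n in sequentially. measure M {\<omega>\<in>space M. real n < V \<omega>} < e"
    using e by (rule order_tendstoD)
  then have "\<forall>\<^sub>F n in sequentially. 0 < n \<and> measure M {\<omega>\<in>space M. real n < V \<omega>} < e"
    using eventually_gt_at_top[of 0] by eventually_elim auto
  then obtain n :: nat where "0 < n" "measure M {\<omega>\<in>space M. real n < V \<omega>} < e"
    by (auto simp: eventually_sequentially)
  then show ?thesis by (intro exI[of _ "real n"]) auto
qed

text \<open>The multivariate continuity theorem of Levy, with tightness supplied separately by the
  maximal estimates. Vectors are sequences of which g sees the entries up to J, so that the number
  of sampling times can be an ordinary number. On a large box g is approximated by a trigonometric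
  polynomial; the failure outside is paid for by tightness.\<close>

theorem weak_convergence_from_char:
  fixes Y :: "nat \<Rightarrow> 'c \<Rightarrow> nat \<Rightarrow> R2" and Z :: "'d \<Rightarrow> nat \<Rightarrow> R2" and g :: "(nat \<Rightarrow> R2) \<Rightarrow> real"
  assumes M: "prob_space M" and B: "prob_space B"
    and Ym: "\<And>n j. (\<lambda>\<omega>. Y n \<omega> j) \<in> borel_measurable M" and Zm: "\<And>j. (\<lambda>\<omega>. Z \<omega> j) \<in> borel_measurable B"
    and char: "\<And>z. (\<lambda>n. \<integral>\<omega>. iexp (\<Sum>j\<le>J. z j \<bullet> Y n \<omega> j) \<partial>M) \<longlonglongrightarrow> (\<integral>\<omega>. iexp (\<Sum>j\<le>J. z j \<bullet> Z \<omega> j) \<partial>B)"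
    and g: "continuous_on UNIV g" and bd: "\<And>v. \<bar>g v\<bar> \<le> C"
    and dep: "\<And>v. g v = g (\<lambda>j. if j \<le> J then v j else 0)"
    and tight: "\<And>e. 0 < e \<Longrightarrow> \<exists>R>0. \<forall>\<^sub>F n in sequentially. measure M {\<omega>\<in>space M. \<exists>j\<le>J. R < norm (Y n \<omega> j)} \<le> e"
  shows "(\<lambda>n. \<integral>\<omega>. g (Y n \<omega>) \<partial>M) \<longlonglongrightarrow> (\<integral>\<omega>. g (Z \<omega>) \<partial>B)"
proof -
  interpret M: prob_space M by fact
  interpret B: prob_space B by fact
  have Ymeas: "Y n \<in> borel_measurable M" for n
    by (rule measurable_coordinatewise_then_product) (rule Ym)
  have Zmeas: "Z \<in> borel_measurable B"
    by (rule measurable_coordinatewise_then_product) (rule Zm)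
  have cm: "f \<in> borel_measurable borel" if "continuous_on UNIV f" for f :: "(nat \<Rightarrow> R2) \<Rightarrow> real"
    by (rule borel_measurable_continuous_onI[OF that])
  have intM: "integrable M (\<lambda>\<omega>. f (Y n \<omega>))" and intB: "integrable B (\<lambda>\<omega>. f (Z \<omega>))"
    if "continuous_on UNIV f" "\<And>v. \<bar>f v\<bar> \<le> D" for f :: "(nat \<Rightarrow> R2) \<Rightarrow> real" and D n
    using that measurable_compose[OF Ymeas cm[OF that(1)]] measurable_compose[OF Zmeas cm[OF that(1)]]
    by (auto intro!: M.integrable_const_bound[where B = D] B.integrable_const_bound[where B = D])
  have conv: "(\<lambda>n. \<integral>\<omega>. p (Y n \<omega>) \<partial>M) \<longlonglongrightarrow> (\<integral>\<omega>. p (Z \<omega>) \<partial>B)" if "trig J p" for p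
    using that
  proof induction
    case (trig_cos z b)
    have iM: "integrable M (\<lambda>\<omega>. iexp (\<Sum>j\<le>J. z j \<bullet> Y n \<omega> j))" for n
      using Ym by (intro M.integrable_const_bound[where B = 1]) auto
    have iB: "integrable B (\<lambda>\<omega>. iexp (\<Sum>j\<le>J. z j \<bullet> Z \<omega> j))"
      using Zm by (intro B.integrable_const_bound[where B = 1]) auto
    have eM: "(\<integral>\<omega>. cos ((\<Sum>j\<le>J. z j \<bullet> Y n \<omega> j) + b) \<partial>M) = Re (iexp b * (\<integral>\<omega>. iexp (\<Sum>j\<le>J. z j \<bullet> Y n \<omega> j) \<partial>M))" for n
    proof -
      have "Re (iexp b * (\<integral>\<omega>. iexp (\<Sum>j\<le>J. z j \<bullet> Y n \<omega> j) \<partial>M)) = Re (\<integral>\<omega>. iexp b * iexp (\<Sum>j\<le>J. z j \<bullet> Y n \<omega> j) \<partial>M)"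
        by simp
      also have "\<dots> = (\<integral>\<omega>. Re (iexp b * iexp (\<Sum>j\<le>J. z j \<bullet> Y n \<omega> j)) \<partial>M)"
        by (rule integral_Re[symmetric]) (intro integrable_mult_right iM)
      finally show ?thesis by (simp add: Re_exp algebra_simps flip: exp_add)
    qed
    have eB: "(\<integral>\<omega>. cos ((\<Sum>j\<le>J. z j \<bullet> Z \<omega> j) + b) \<partial>B) = Re (iexp b * (\<integral>\<omega>. iexp (\<Sum>j\<le>J. z j \<bullet> Z \<omega> j) \<partial>B))"
    proof -
      have "Re (iexp b * (\<integral>\<omega>. iexp (\<Sum>j\<le>J. z j \<bullet> Z \<omega> j) \<partial>B)) = Re (\<integral>\<omega>. iexp b * iexp (\<Sum>j\<le>J. z j \<bullet> Z \<omega> j) \<partial>B)"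
        by simp
      also have "\<dots> = (\<integral>\<omega>. Re (iexp b * iexp (\<Sum>j\<le>J. z j \<bullet> Z \<omega> j)) \<partial>B)"
        by (rule integral_Re[symmetric]) (intro integrable_mult_right iB)
      finally show ?thesis by (simp add: Re_exp algebra_simps flip: exp_add)
    qed
    show ?case unfolding eM eB by (intro tendsto_Re tendsto_mult tendsto_const char)
  next
    case (trig_add p q)
    obtain D E where "\<And>y. \<bar>p y\<bar> \<le> D" "\<And>y. \<bar>q y\<bar> \<le> E"
      using trig_bounded[OF trig_add.hyps(1)] trig_bounded[OF trig_add.hyps(2)] by blast
    note ints = intM[OF trig_continuous[OF trig_add.hyps(1)] this(1)] intM[OF trig_continuous[OF trig_add.hyps(2)] this(2)]
      intB[OF trig_continuous[OF trig_add.hyps(1)] this(1)] intB[OF trig_continuous[OF trig_add.hyps(2)] this(2)]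
    show ?case using tendsto_add[OF trig_add.IH] ints by simp
  next
    case (trig_scale p c)
    show ?case using tendsto_mult_left[OF trig_scale.IH, of c] by simp
  qed
  have C: "0 \<le> C" using bd[of "\<lambda>_. 0"] by linarith
  show ?thesis
  proof (rule LIMSEQ_I)
    fix r :: real assume r: "0 < r"
    \<comment> \<open>Two approximation errors of e + 2 C e each, under M and under B, and one error
      e for the trigonometric polynomial add up to less than r.\<close>
    define e where "e = r / (4 * C + 4)"
    have e: "0 < e" using r C by (simp add: e_def)
    obtain R1 where R1: "R1 > 0" "\<forall>\<^sub>F n in sequentially. measure M {\<omega>\<in>space M. \<exists>j\<le>J. R1 < norm (Y n \<omega> j)} \<le> e"
      using tight[OF e] by blast
    obtain R2 where R2: "R2 > 0" "measure B {\<omega>\<in>space B. R2 < Max ((\<lambda>j. norm (Z \<omega> j)) ` {..J})} \<le> e"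
    proof -
      have "(\<lambda>\<omega>. Max ((\<lambda>j. norm (Z \<omega> j)) ` {..J})) \<in> borel_measurable B"
        using Zm by (intro borel_measurable_Max) auto
      then show ?thesis using tight_single[OF B _ e] that by blast
    qed
    define R where "R = max R1 R2"
    have R: "0 < R" using R1 by (simp add: R_def)
    obtain p where p: "trig J p" "\<And>y. \<bar>g y - p y\<bar> \<le> e + 2 * C * of_bool (\<exists>j\<le>J. R < norm (y j))"
      using trig_approximation[OF g bd dep e R] by blast
    obtain D where D: "\<And>y. \<bar>p y\<bar> \<le> D" using trig_bounded[OF p(1)] by blast
    have diff: "\<bar>(\<integral>\<omega>. g (V \<omega>) \<partial>Q) - (\<integral>\<omega>. p (V \<omega>) \<partial>Q)\<bar> \<le> e + 2 * C * measure Q {\<omega>\<in>space Q. \<exists>j\<le>J. R < norm (V \<omega> j)}"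
      if Q: "prob_space Q" and V: "\<And>j. (\<lambda>\<omega>. V \<omega> j) \<in> borel_measurable Q" for Q :: "'z measure" and V
    proof -
      interpret Q: prob_space Q by fact
      have Vm: "V \<in> borel_measurable Q"
        by (rule measurable_coordinatewise_then_product) (rule V)
      let ?S = "{\<omega>\<in>space Q. \<exists>j\<le>J. R < norm (V \<omega> j)}"
      have S: "?S \<in> sets Q" using V by measurable
      have ig: "integrable Q (\<lambda>\<omega>. g (V \<omega>))"
        using bd measurable_compose[OF Vm cm[OF g]] by (intro Q.integrable_const_bound[where B = C]) auto
      have ip: "integrable Q (\<lambda>\<omega>. p (V \<omega>))"
        using D measurable_compose[OF Vm cm[OF trig_continuous[OF p(1)]]] by (intro Q.integrable_const_bound[where B = D]) auto
      have iS0: "integrable Q (indicat_real ?S)"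
        by (rule Q.integrable_const_bound[where B = 1, OF _ borel_measurable_indicator[OF S]])
           (intro AE_I2, simp add: indicator_def)
      have iS: "integrable Q (\<lambda>\<omega>. 2 * C * indicator ?S \<omega>)"
        by (rule integrable_mult_right) (rule iS0)
      have "\<bar>(\<integral>\<omega>. g (V \<omega>) \<partial>Q) - (\<integral>\<omega>. p (V \<omega>) \<partial>Q)\<bar> = \<bar>\<integral>\<omega>. g (V \<omega>) - p (V \<omega>) \<partial>Q\<bar>"
        using ig ip by simp
      also have "\<dots> \<le> (\<integral>\<omega>. \<bar>g (V \<omega>) - p (V \<omega>)\<bar> \<partial>Q)" by (rule integral_abs_bound)
      also have "\<dots> \<le> (\<integral>\<omega>. e + 2 * C * indicator ?S \<omega> \<partial>Q)"
      proof (rule integral_mono)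
        show "integrable Q (\<lambda>\<omega>. \<bar>g (V \<omega>) - p (V \<omega>)\<bar>)" using ig ip by auto
        show "integrable Q (\<lambda>\<omega>. e + 2 * C * indicator ?S \<omega>)" 
          by (rule Bochner_Integration.integrable_add[OF Q.integrable_const iS])
        show "\<bar>g (V \<omega>) - p (V \<omega>)\<bar> \<le> e + 2 * C * indicator ?S \<omega>" if "\<omega> \<in> space Q" for \<omega>
          using p(2)[of "V \<omega>"] that by (simp add: indicator_def)
      qed
      also have "\<dots> = e + 2 * C * measure Q ?S"
        by (subst Bochner_Integration.integral_add[OF Q.integrable_const iS]) (simp add: Q.prob_space S)
      finally show ?thesis .
    qed
    have "measure B {\<omega>\<in>space B. \<exists>j\<le>J. R < norm (Z \<omega> j)} \<le> measure B {\<omega>\<in>space B. R2 < Max ((\<lambda>j. norm (Z \<omega> j)) ` {..J})}"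
    proof (rule B.finite_measure_mono)
      show "{\<omega>\<in>space B. \<exists>j\<le>J. R < norm (Z \<omega> j)} \<subseteq> {\<omega>\<in>space B. R2 < Max ((\<lambda>j. norm (Z \<omega> j)) ` {..J})}"
        by (auto simp: R_def Max_gr_iff)
      have "(\<lambda>\<omega>. Max ((\<lambda>j. norm (Z \<omega> j)) ` {..J})) \<in> borel_measurable B"
        using Zm by (intro borel_measurable_Max) auto
      then show "{\<omega>\<in>space B. R2 < Max ((\<lambda>j. norm (Z \<omega> j)) ` {..J})} \<in> sets B" by measurable
    qed
    with R2 have eB: "measure B {\<omega>\<in>space B. \<exists>j\<le>J. R < norm (Z \<omega> j)} \<le> e" by linarith
    have dB: "\<bar>(\<integral>\<omega>. g (Z \<omega>) \<partial>B) - (\<integral>\<omega>. p (Z \<omega>) \<partial>B)\<bar> \<le> e + 2 * C * e"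
      using diff[of B Z, OF B Zm] mult_left_mono[OF eB, of "2 * C"] C by linarith
    have "\<forall>\<^sub>F n in sequentially. \<bar>(\<integral>\<omega>. p (Y n \<omega>) \<partial>M) - (\<integral>\<omega>. p (Z \<omega>) \<partial>B)\<bar> < e"
      using tendstoD[OF conv[OF p(1)] e] by (simp add: dist_real_def)
    with R1(2) have "\<forall>\<^sub>F n in sequentially. norm ((\<integral>\<omega>. g (Y n \<omega>) \<partial>M) - (\<integral>\<omega>. g (Z \<omega>) \<partial>B)) < r"
    proof eventually_elim
      case (elim n)
      have "measure M {\<omega>\<in>space M. \<exists>j\<le>J. R < norm (Y n \<omega> j)} \<le> measure M {\<omega>\<in>space M. \<exists>j\<le>J. R1 < norm (Y n \<omega> j)}"
        using Ym by (intro M.finite_measure_mono) (auto simp: R_def)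
      with elim(1) have "measure M {\<omega>\<in>space M. \<exists>j\<le>J. R < norm (Y n \<omega> j)} \<le> e" by linarith
      then have dM: "\<bar>(\<integral>\<omega>. g (Y n \<omega>) \<partial>M) - (\<integral>\<omega>. p (Y n \<omega>) \<partial>M)\<bar> \<le> e + 2 * C * e"
        using diff[of M "Y n", OF M Ym]
          mult_left_mono[of "measure M {\<omega>\<in>space M. \<exists>j\<le>J. R < norm (Y n \<omega> j)}" e "2 * C"] C by linarith
      have "\<bar>(\<integral>\<omega>. g (Y n \<omega>) \<partial>M) - (\<integral>\<omega>. g (Z \<omega>) \<partial>B)\<bar> < 3 * e + 4 * (C * e)"
        using dM dB elim(2) by linarith
      also have "\<dots> \<le> e * (4 * C + 4)" using e by (simp add: algebra_simps)
      also have "\<dots> = r" using C by (simp add: e_def)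
      finally show ?case by simp
    qed
    then show "\<exists>N. \<forall>n\<ge>N. norm ((\<integral>\<omega>. g (Y n \<omega>) \<partial>M) - (\<integral>\<omega>. g (Z \<omega>) \<partial>B)) < r"
      by (simp add: eventually_sequentially)
  qed
qed

section \<open>Lipschitz functionals on the path space\<close>

text \<open>This pseudometric induces locally uniform convergence, and a small value of it forces a small Skorokhod
  distance.\<close>

definition path_dist :: "(real \<Rightarrow> 'a::metric_space) \<Rightarrow> (real \<Rightarrow> 'a) \<Rightarrow> real" where
  "path_dist x y = (SUP t\<in>{0..}. min (1 / (1 + t)) (dist (x t) (y t)))"

lemma path_dist_upper: "0 \<le> t \<Longrightarrow> min (1 / (1 + t)) (dist (x t) (y t)) \<le> path_dist x y"
  unfolding path_dist_def
proof (rule cSUP_upper)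
  show "bdd_above ((\<lambda>t. min (1 / (1 + t)) (dist (x t) (y t))) ` {0..})"
    by (rule bdd_aboveI2[of _ _ 1]) (auto simp: min_le_iff_disj divide_le_eq)
qed simp

lemma path_dist_least:
  assumes "\<And>t. 0 \<le> t \<Longrightarrow> min (1 / (1 + t)) (dist (x t) (y t)) \<le> c"
  shows "path_dist x y \<le> c"
  unfolding path_dist_def using assms by (intro cSUP_least) auto

lemma path_dist_nonneg: "0 \<le> path_dist x y"
  using path_dist_upper[of 0 x y] by (smt (verit) divide_nonneg_pos zero_le_dist)

lemma path_dist_le_1: "path_dist x y \<le> 1"
  by (rule path_dist_least) (auto simp: min_le_iff_disj divide_le_eq)

lemma path_dist_commute: "path_dist x y = path_dist y x"
  unfolding path_dist_def by (simp add: dist_commute)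

lemma path_dist_self: "path_dist x x = 0"
  using path_dist_least[of x x 0] path_dist_nonneg[of x x] by force

lemma path_dist_triangle: "path_dist x z \<le> path_dist x y + path_dist y z"
proof (rule path_dist_least)
  fix t :: real assume t: "0 \<le> t"
  have "min (1 / (1 + t)) (dist (x t) (z t)) \<le> min (1 / (1 + t)) (dist (x t) (y t)) + min (1 / (1 + t)) (dist (y t) (z t))"
  proof -
    have "min c d3 \<le> min c d1 + min c d2" if "d3 \<le> d1 + d2" "0 \<le> c" "0 \<le> d1" "0 \<le> d2" for c d1 d2 d3 :: real
      using that by (auto simp: min_def)
    then show ?thesis using dist_triangle[of "x t" "z t" "y t"] t by simp
  qed
  then show "min (1 / (1 + t)) (dist (x t) (z t)) \<le> path_dist x y + path_dist y z"
    using path_dist_upper[OF t, of x y] path_dist_upper[OF t, of y z] by linarith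
qed

section \<open>Comparison with the Skorokhod distance\<close>

lemma has_bochner_integral_exp_tail:
  "has_bochner_integral lborel (\<lambda>u::real. exp (- u) * indicator {c..} u) (exp (- c))"
proof (rule has_bochner_integral_nn_integral)
  have "(\<integral>\<^sup>+ u. ennreal (exp (- u)) * indicator {c..} u \<partial>lborel) = ennreal (0 - - exp (- c))"
  proof (rule nn_integral_FTC_atLeast)
    show "((\<lambda>u. - exp (- u)) \<longlongrightarrow> (0::real)) at_top"
      by real_asymp
  qed (auto intro!: derivative_eq_intros)
  then show "(\<integral>\<^sup>+ u. ennreal (exp (- u) * indicator {c..} u) \<partial>lborel) = ennreal (exp (- c))"
    by (simp add: ennreal_mult' ennreal_indicator)
qed auto

lemma log_slopes_id: "log_slopes (\<lambda>t. t) = {0}"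
proof -
  have "x = 0" if "x \<in> log_slopes (\<lambda>t. t)" for x using that by (auto simp: log_slopes_def)
  moreover have "0 \<in> log_slopes (\<lambda>t. t)"
    unfolding log_slopes_def by (intro CollectI exI[of _ 1] exI[of _ 0]) simp
  ultimately show ?thesis by blast
qed

lemma skorokhod_dist_le_stopped:
  "skorokhod_dist x y \<le> max 0 (LINT u:{0..}|lborel. exp (- u) * stopped_dist x y (\<lambda>t. t) u)"
proof -
  have id: "(\<lambda>t. t) \<in> time_changes"
    by (auto simp: time_changes_def strict_mono_on_def log_slopes_id)
  have "0 \<le> Sup (log_slopes l)" if "l \<in> time_changes" for l
  proof -
    have "\<bar>ln ((l 1 - l 0) / (1 - 0))\<bar> \<in> log_slopes l"
      unfolding log_slopes_def by (intro CollectI exI[of _ 1] exI[of _ 0]) simp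
    then have "\<bar>ln ((l 1 - l 0) / (1 - 0))\<bar> \<le> Sup (log_slopes l)"
      using that by (intro cSup_upper) (auto simp: time_changes_def)
    then show ?thesis by linarith
  qed
  then have "bdd_below ((\<lambda>l. max (Sup (log_slopes l)) (LINT u:{0..}|lborel. exp (- u) * stopped_dist x y l u)) ` time_changes)"
    by (intro bdd_belowI2[of _ 0]) (auto simp: le_max_iff_disj)
  then have "skorokhod_dist x y \<le> max (Sup (log_slopes (\<lambda>t. t))) (LINT u:{0..}|lborel. exp (- u) * stopped_dist x y (\<lambda>t. t) u)"
    unfolding skorokhod_dist_def using id by (rule cINF_lower)
  then show ?thesis by (simp add: log_slopes_id)
qed

lemma skorokhod_dist_le:
  assumes T: "0 \<le> T" and d: "0 \<le> d" and le: "\<And>t. 0 \<le> t \<Longrightarrow> t \<le> T \<Longrightarrow> dist (x t) (y t) \<le> d"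
  shows "skorokhod_dist x y \<le> d + exp (- T)"
proof -
  let ?s = "stopped_dist x y (\<lambda>t. t)"
  have s1: "?s u \<le> 1" for u
    unfolding stopped_dist_def by (rule cSUP_least) auto
  have sd: "?s u \<le> d" if "0 \<le> u" "u \<le> T" for u
    unfolding stopped_dist_def using that by (intro cSUP_least) (auto simp: min_le_iff_disj intro!: disjI2 le)
  let ?f = "\<lambda>u. indicator {0..} u *\<^sub>R (exp (- u) * ?s u)"
  let ?g = "\<lambda>u. d * (exp (- u) * indicator {0..} u) + exp (- u) * indicator {T..} u"
  have g: "has_bochner_integral lborel ?g (d * exp (- 0) + exp (- T))"
    by (intro has_bochner_integral_add has_bochner_integral_mult_right has_bochner_integral_exp_tail)
  have fg: "?f u \<le> ?g u" for u
  proof (cases "0 \<le> u")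
    case True
    show ?thesis
    proof (cases "u \<le> T")
      case True
      then have "exp (- u) * ?s u \<le> exp (- u) * d" using sd[OF \<open>0 \<le> u\<close>] by (intro mult_left_mono) auto
      then show ?thesis using \<open>0 \<le> u\<close> by (simp add: mult.commute add_increasing2)
    next
      case False
      then have "exp (- u) * ?s u \<le> exp (- u) * 1" using s1 by (intro mult_left_mono) auto
      then show ?thesis using \<open>0 \<le> u\<close> False d by (simp add: add_increasing)
    qed
  qed (use T in simp)
  \<comment> \<open>Measurability of the stopped distance in u is left open: if the integrand is not
    integrable, its integral is 0 by convention and the bound still holds.\<close>
  have "(\<integral>u. ?f u \<partial>lborel) \<le> d + exp (- T)"
  proof (cases "integrable lborel ?f")
    case True
    have "(\<integral>u. ?f u \<partial>lborel) \<le> (\<integral>u. ?g u \<partial>lborel)"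
      by (rule integral_mono[OF True _ fg]) (use g in \<open>simp add: has_bochner_integral_iff\<close>)
    also have "\<dots> = d + exp (- T)" using g by (simp add: has_bochner_integral_iff)
    finally show ?thesis .
  next
    case False
    then have "(\<integral>u. ?f u \<partial>lborel) = 0" by (rule not_integrable_integral_eq)
    then show ?thesis using d by simp
  qed
  then have "max 0 (LINT u:{0..}|lborel. exp (- u) * ?s u) \<le> d + exp (- T)"
    using d by (simp add: set_lebesgue_integral_def)
  then show ?thesis using skorokhod_dist_le_stopped[of x y] by linarith
qed

lemma skorokhod_dist_small:
  assumes e: "0 < e"
  shows "\<exists>d>0. \<forall>x y :: real \<Rightarrow> 'a::metric_space. path_dist x y < d \<longrightarrow> skorokhod_dist x y < e"
proof -
  have "((\<lambda>T::real. exp (- T)) \<longlongrightarrow> 0) at_top" by real_asymp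
  then have ev: "\<forall>\<^sub>F T in at_top. exp (- T) < e / 2 \<and> 0 \<le> (T::real)"
    using e by (intro eventually_conj eventually_ge_at_top order_tendstoD) auto
  obtain T :: real where T: "exp (- T) < e / 2" "0 \<le> T"
    using eventually_happens[OF ev] by auto
  \<comment> \<open>Below 1 / (1 + T) the cap in \<open>path_dist\<close> is inactive on [0, T], so
    there the pseudometric bounds the actual distance of the paths.\<close>
  define d where "d = min (e / 2) (1 / (1 + T))"
  show ?thesis
  proof (intro exI[of _ d] conjI allI impI)
    show "0 < d" using e T by (simp add: d_def)
    fix x y :: "real \<Rightarrow> 'a" assume xy: "path_dist x y < d"
    have "dist (x t) (y t) \<le> path_dist x y" if "0 \<le> t" "t \<le> T" for t
    proof -
      have "path_dist x y < 1 / (1 + T)" using xy by (simp add: d_def)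
      also have "\<dots> \<le> 1 / (1 + t)" using that by (intro divide_left_mono) auto
      finally show ?thesis using path_dist_upper[OF that(1), of x y] by (auto simp: min_def split: if_splits)
    qed
    then have "skorokhod_dist x y \<le> path_dist x y + exp (- T)"
      by (rule skorokhod_dist_le[OF T(2) path_dist_nonneg])
    then show "skorokhod_dist x y < e" using xy T by (auto simp: d_def)
  qed
qed

section \<open>Reduction of weak convergence to Lipschitz functionals\<close>

definition path_lipschitz :: "((real \<Rightarrow> 'a::metric_space) \<Rightarrow> real) \<Rightarrow> bool" where
  "path_lipschitz g \<longleftrightarrow> (\<exists>L\<ge>0. \<forall>x\<in>cadlag_space. \<forall>y\<in>cadlag_space. \<bar>g x - g y\<bar> \<le> L * path_dist x y)
     \<and> (\<exists>C. \<forall>x\<in>cadlag_space. \<bar>g x\<bar> \<le> C)"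

lemma j1_open_path_ball:
  assumes "j1_open U" "x \<in> U"
  shows "\<exists>d>0. \<forall>y\<in>cadlag_space. path_dist x y < d \<longrightarrow> y \<in> U"
proof -
  obtain e where "0 < e" "\<And>y. y \<in> cadlag_space \<Longrightarrow> skorokhod_dist x y < e \<Longrightarrow> y \<in> U"
    using assms unfolding j1_open_def by blast
  then show ?thesis using skorokhod_dist_small[of e] by blast
qed

text \<open>These Lipschitz functions increase to \<open>f\<close> when \<open>f\<close> is bounded and continuous, which reduces weak convergence
  to Lipschitz functionals.\<close>

definition lip_approx :: "((real \<Rightarrow> 'a::metric_space) \<Rightarrow> real) \<Rightarrow> nat \<Rightarrow> (real \<Rightarrow> 'a) \<Rightarrow> real" where
  "lip_approx f k x = (INF y\<in>cadlag_space. f y + real k * path_dist x y)"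

lemma const_cadlag: "(\<lambda>t\<in>{0..}. c) \<in> cadlag_space"
proof -
  have 1: "((\<lambda>t\<in>{0..}. c) \<longlongrightarrow> c) (at_right t)" if t: "0 \<le> t" for t :: real
  proof (rule tendsto_eventually)
    from eventually_at_right_less[of t] show "\<forall>\<^sub>F s in at_right t. (\<lambda>t\<in>{0..}. c) s = c"
      by eventually_elim (use t in simp)
  qed
  have 2: "((\<lambda>t\<in>{0..}. c) \<longlongrightarrow> c) (at_left t)" if t: "0 < t" for t :: real
  proof (rule tendsto_eventually)
    from eventually_at_left_real[OF t] show "\<forall>\<^sub>F s in at_left t. (\<lambda>t\<in>{0..}. c) s = c"
      by eventually_elim simp
  qed
  show ?thesis using 1 2 by (auto simp: cadlag_space_def)
qed

lemma cadlag_nonempty: "cadlag_space \<noteq> {}"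
  using const_cadlag by blast

context
  fixes f :: "(real \<Rightarrow> 'a::metric_space) \<Rightarrow> real" and C :: real
  assumes bd: "\<And>x. x \<in> cadlag_space \<Longrightarrow> \<bar>f x\<bar> \<le> C"
begin

lemma lip_approx_bdd: "bdd_below ((\<lambda>y. f y + real k * path_dist x y) ` cadlag_space)"
proof (rule bdd_belowI2[of _ "- C"])
  fix y :: "real \<Rightarrow> 'a" assume "y \<in> cadlag_space"
  then show "- C \<le> f y + real k * path_dist x y"
    using bd[of y] path_dist_nonneg[of x y] mult_nonneg_nonneg[of "real k" "path_dist x y"] by linarith
qed

lemma lip_approx_le: "x \<in> cadlag_space \<Longrightarrow> lip_approx f k x \<le> f x"
  unfolding lip_approx_def using cINF_lower[OF lip_approx_bdd[of k x], of x] by (simp add: path_dist_self)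

lemma lip_approx_ge: "- C \<le> lip_approx f k x"
  unfolding lip_approx_def
proof (rule cINF_greatest[OF cadlag_nonempty])
  fix y :: "real \<Rightarrow> 'a" assume "y \<in> cadlag_space"
  then show "- C \<le> f y + real k * path_dist x y"
    using bd[of y] path_dist_nonneg[of x y] mult_nonneg_nonneg[of "real k" "path_dist x y"] by linarith
qed

lemma lip_approx_abs_le: "x \<in> cadlag_space \<Longrightarrow> \<bar>lip_approx f k x\<bar> \<le> C"
  using lip_approx_le[of x k] lip_approx_ge[of k x] bd[of x] by linarith

lemma lip_approx_lipschitz: "path_lipschitz (lip_approx f k)"
proof -
  have 1: "lip_approx f k x \<le> lip_approx f k x' + real k * path_dist x x'" for x x'
  proof -
    have "lip_approx f k x - real k * path_dist x x' \<le> lip_approx f k x'"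
      unfolding lip_approx_def[of f k x']
    proof (rule cINF_greatest[OF cadlag_nonempty])
      fix y :: "real \<Rightarrow> 'a" assume y: "y \<in> cadlag_space"
      have "lip_approx f k x \<le> f y + real k * path_dist x y"
        unfolding lip_approx_def by (rule cINF_lower[OF lip_approx_bdd y])
      also have "real k * path_dist x y \<le> real k * (path_dist x x' + path_dist x' y)"
        by (intro mult_left_mono path_dist_triangle) simp
      finally show "lip_approx f k x - real k * path_dist x x' \<le> f y + real k * path_dist x' y"
        by (simp add: distrib_left)
    qed
    then show ?thesis by simp
  qed
  have "\<bar>lip_approx f k x - lip_approx f k x'\<bar> \<le> real k * path_dist x x'" for x x'
    using 1[of x x'] 1[of x' x] by (simp add: path_dist_commute abs_le_iff)
  then show ?thesis
    unfolding path_lipschitz_def using lip_approx_abs_le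
    by (intro conjI exI[of _ "real k"] exI[of _ C]) auto
qed

text \<open>A competitor y at distance at least d from x pays k d, which from \<open>k0\<close> on
  exceeds the possible gain 2 C; closer competitors have values above f x - r / 2, because J1-open
  sets contain balls of the pseudometric.\<close>

lemma lip_approx_tendsto:
  assumes f: "continuous_map j1_topology euclideanreal f" and x: "x \<in> cadlag_space"
  shows "(\<lambda>k. lip_approx f k x) \<longlonglongrightarrow> f x"
proof (rule LIMSEQ_I)
  fix r :: real assume r: "0 < r"
  have "openin j1_topology {y \<in> topspace j1_topology. f y \<in> {f x - r / 2 <..}}"
    by (intro openin_continuous_map_preimage[OF f]) (simp add: open_openin[symmetric])
  then have "j1_open {y \<in> cadlag_space. f y \<in> {f x - r / 2 <..}}"
    by (simp add: openin_j1_topology topspace_j1_topology)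
  then obtain d where d: "0 < d" "\<And>y. y \<in> cadlag_space \<Longrightarrow> path_dist x y < d \<Longrightarrow> f x - r / 2 < f y"
    using j1_open_path_ball[of _ x] x r by force
  obtain k0 :: nat where k0: "2 * C / d < real k0" using reals_Archimedean2 by blast
  show "\<exists>k0. \<forall>k\<ge>k0. norm (lip_approx f k x - f x) < r"
  proof (intro exI[of _ k0] allI impI)
    fix k assume k: "k0 \<le> k"
    have "f x - r / 2 \<le> lip_approx f k x"
      unfolding lip_approx_def
    proof (rule cINF_greatest[OF cadlag_nonempty])
      fix y :: "real \<Rightarrow> 'a" assume y: "y \<in> cadlag_space"
      show "f x - r / 2 \<le> f y + real k * path_dist x y"
      proof (cases "path_dist x y < d")
        case True
        then show ?thesis using d(2)[OF y] mult_nonneg_nonneg[OF of_nat_0_le_iff path_dist_nonneg, of k x y] by linarith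
      next
        case False
        have "2 * C \<le> real k * d" using k0 k d by (simp add: divide_less_eq) (smt (verit) mult_right_mono of_nat_le_iff)
        also have "\<dots> \<le> real k * path_dist x y" using False by (intro mult_left_mono) auto
        finally show ?thesis using bd[OF x] bd[OF y] r by linarith
      qed
    qed
    then show "norm (lip_approx f k x - f x) < r" using lip_approx_le[OF x, of k] r by simp
  qed
qed

end

lemma space_borel_of: "space (borel_of T) = topspace T"
  unfolding borel_of_def by (rule space_measure_of_conv)

lemma openin_sets_borel_of: "openin T U \<Longrightarrow> U \<in> sets (borel_of T)"
  unfolding borel_of_def by (subst sets_measure_of) (auto dest: openin_subset)

text \<open>A J1-open set U is, within the path space, the set where the distance h to its
  complement is positive, and h is a Lipschitz functional. Every open set is thus handled directly,
  without a countable base of the topology.\<close>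

lemma measurable_j1_from_lipschitz:
  fixes Y :: "'c \<Rightarrow> real \<Rightarrow> 'a::metric_space"
  assumes Y: "\<And>\<omega>. \<omega> \<in> space M \<Longrightarrow> Y \<omega> \<in> cadlag_space"
    and g: "\<And>g. path_lipschitz g \<Longrightarrow> (\<lambda>\<omega>. g (Y \<omega>)) \<in> borel_measurable M"
  shows "Y \<in> measurable M (borel_of j1_topology)"
  unfolding borel_of_def
proof (rule measurable_measure_of)
  show "{U. openin (j1_topology :: (real \<Rightarrow> 'a) topology) U} \<subseteq> Pow (topspace j1_topology)"
    by (auto dest: openin_subset)
  show "Y \<in> space M \<rightarrow> topspace j1_topology" using Y by (auto simp: topspace_j1_topology)
  fix U :: "(real \<Rightarrow> 'a) set" assume "U \<in> {U. openin j1_topology U}"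
  then have U: "j1_open U" by (simp add: openin_j1_topology)
  show "Y -` U \<inter> space M \<in> sets M"
  \<comment> \<open>The infimum defining h is meaningful only if U has a nonempty
    complement.\<close>
  proof (cases "cadlag_space - U = {}")
    case True
    then have "Y -` U \<inter> space M = space M" using Y by blast
    then show ?thesis by simp
  next
    case False
    define h where "h x = (INF y\<in>cadlag_space - U. path_dist x y)" for x
    have bdd: "bdd_below (path_dist x ` (cadlag_space - U))" for x
      by (rule bdd_belowI2[of _ 0]) (rule path_dist_nonneg)
    have 1: "h x \<le> h x' + path_dist x x'" for x x'
    proof -
      have "h x - path_dist x x' \<le> h x'"
        unfolding h_def[of x']
      proof (rule cINF_greatest[OF False])
        fix y assume "y \<in> cadlag_space - U"
        then have "h x \<le> path_dist x y" unfolding h_def by (rule cINF_lower[OF bdd])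
        then show "h x - path_dist x x' \<le> path_dist x' y" using path_dist_triangle[of x y x'] by linarith
      qed
      then show ?thesis by simp
    qed
    have hb: "0 \<le> h x" "h x \<le> 1" for x
    proof -
      show "0 \<le> h x" unfolding h_def by (rule cINF_greatest[OF False]) (rule path_dist_nonneg)
      obtain y where "y \<in> cadlag_space - U" using False by blast
      then have "h x \<le> path_dist x y" unfolding h_def by (rule cINF_lower[OF bdd])
      then show "h x \<le> 1" using path_dist_le_1[of x y] by linarith
    qed
    have "\<bar>h x - h x'\<bar> \<le> 1 * path_dist x x'" for x x'
      using 1[of x x'] 1[of x' x] by (simp add: path_dist_commute abs_le_iff)
    then have "path_lipschitz h"
      unfolding path_lipschitz_def using hb by (intro conjI exI[of _ "1::real"]) auto
    from g[OF this] have "{\<omega> \<in> space M. 0 < h (Y \<omega>)} \<in> sets M" by measurable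
    moreover have "0 < h x \<longleftrightarrow> x \<in> U" if "x \<in> cadlag_space" for x
    proof
      assume "x \<in> U"
      then obtain d where d: "0 < d" "\<And>y. y \<in> cadlag_space \<Longrightarrow> path_dist x y < d \<Longrightarrow> y \<in> U"
        using j1_open_path_ball[OF U] by blast
      have "d \<le> h x" unfolding h_def by (rule cINF_greatest[OF False]) (use d in force)
      then show "0 < h x" using d by linarith
    next
      assume "0 < h x"
      show "x \<in> U"
      proof (rule ccontr)
        assume "x \<notin> U"
        then have "h x \<le> path_dist x x" unfolding h_def using that by (intro cINF_lower[OF bdd]) auto
        then show False using \<open>0 < h x\<close> by (simp add: path_dist_self)
      qed
    qed
    then have "{\<omega> \<in> space M. 0 < h (Y \<omega>)} = Y -` U \<inter> space M" using Y by auto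
    ultimately show ?thesis by simp
  qed
qed

text \<open>Since the approximants lie below f and tend to it, Lipschitz functionals yield the lower
  bound for the limit of the expectations of f. The same bound for - f gives the upper one.\<close>

lemma converges_weakly_from_lipschitz:
  fixes Y :: "nat \<Rightarrow> 'c \<Rightarrow> real \<Rightarrow> 'a::metric_space"
  assumes M: "prob_space M" and B: "prob_space B"
    and Y: "\<And>n \<omega>. \<omega> \<in> space M \<Longrightarrow> Y n \<omega> \<in> cadlag_space" and Z: "\<And>\<omega>. \<omega> \<in> space B \<Longrightarrow> Z \<omega> \<in> cadlag_space"
    and Ym: "\<And>g n. path_lipschitz g \<Longrightarrow> (\<lambda>\<omega>. g (Y n \<omega>)) \<in> borel_measurable M"
    and Zm: "\<And>g. path_lipschitz g \<Longrightarrow> (\<lambda>\<omega>. g (Z \<omega>)) \<in> borel_measurable B"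
    and conv: "\<And>g. path_lipschitz g \<Longrightarrow> (\<lambda>n. \<integral>\<omega>. g (Y n \<omega>) \<partial>M) \<longlonglongrightarrow> (\<integral>\<omega>. g (Z \<omega>) \<partial>B)"
  shows "converges_weakly j1_topology M Y B Z"
proof -
  interpret M: prob_space M by fact
  interpret B: prob_space B by fact
  have mY: "Y n \<in> measurable M (borel_of j1_topology)" for n
    by (rule measurable_j1_from_lipschitz) (auto intro: Y Ym)
  have mZ: "Z \<in> measurable B (borel_of j1_topology)"
    by (rule measurable_j1_from_lipschitz) (auto intro: Z Zm)
  have lower: "\<forall>\<^sub>F n in sequentially. (\<integral>\<omega>. f (Z \<omega>) \<partial>B) - r < (\<integral>\<omega>. f (Y n \<omega>) \<partial>M)"
    if f: "continuous_map j1_topology euclideanreal f" and bd: "\<And>x. x \<in> cadlag_space \<Longrightarrow> \<bar>f x\<bar> \<le> C" and r: "0 < r"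
    for f :: "(real \<Rightarrow> 'a) \<Rightarrow> real" and C r
  proof -
    have fm: "f \<in> borel_measurable (borel_of j1_topology)"
    proof (rule borel_measurableI)
      fix S :: "real set" assume "open S"
      then have "openin j1_topology {x \<in> topspace j1_topology. f x \<in> S}"
        by (intro openin_continuous_map_preimage[OF f]) (simp add: open_openin[symmetric])
      moreover have "f -` S \<inter> space (borel_of j1_topology) = {x \<in> topspace j1_topology. f x \<in> S}"
        unfolding space_borel_of by blast
      ultimately show "f -` S \<inter> space (borel_of j1_topology) \<in> sets (borel_of j1_topology)"
        by (simp only: openin_sets_borel_of)
    qed
    note lip = lip_approx_lipschitz[of f C, OF bd]
    have iY: "integrable M (\<lambda>\<omega>. f (Y n \<omega>))" for n
      using measurable_compose[OF mY fm] Y bd by (intro M.integrable_const_bound[where B = C]) auto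
    have iYk: "integrable M (\<lambda>\<omega>. lip_approx f k (Y n \<omega>))" for n k
      using Ym[OF lip] Y lip_approx_abs_le[of f C, OF bd] by (intro M.integrable_const_bound[where B = C]) auto
    have "(\<lambda>k. \<integral>\<omega>. lip_approx f k (Z \<omega>) \<partial>B) \<longlonglongrightarrow> (\<integral>\<omega>. f (Z \<omega>) \<partial>B)"
    proof (rule integral_dominated_convergence[where w = "\<lambda>_. C"])
      show "(\<lambda>\<omega>. f (Z \<omega>)) \<in> borel_measurable B" by (rule measurable_compose[OF mZ fm])
      show "(\<lambda>\<omega>. lip_approx f k (Z \<omega>)) \<in> borel_measurable B" for k by (rule Zm[OF lip])
      show "AE \<omega> in B. (\<lambda>k. lip_approx f k (Z \<omega>)) \<longlonglongrightarrow> f (Z \<omega>)"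
        using lip_approx_tendsto[of f C, OF bd f] Z by (intro AE_I2) auto
      show "AE \<omega> in B. norm (lip_approx f k (Z \<omega>)) \<le> C" for k
        using lip_approx_abs_le[of f C, OF bd] Z by (intro AE_I2) auto
    qed simp
    then have "\<forall>\<^sub>F k in sequentially. (\<integral>\<omega>. f (Z \<omega>) \<partial>B) - r / 2 < (\<integral>\<omega>. lip_approx f k (Z \<omega>) \<partial>B)"
      using r by (intro order_tendstoD) auto
    then obtain k where k: "(\<integral>\<omega>. f (Z \<omega>) \<partial>B) - r / 2 < (\<integral>\<omega>. lip_approx f k (Z \<omega>) \<partial>B)"
      by (auto simp: eventually_sequentially)
    have "\<forall>\<^sub>F n in sequentially. (\<integral>\<omega>. lip_approx f k (Z \<omega>) \<partial>B) - r / 2 < (\<integral>\<omega>. lip_approx f k (Y n \<omega>) \<partial>M)"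
      using r conv[OF lip] by (intro order_tendstoD) auto
    then show ?thesis
    proof eventually_elim
      case (elim n)
      have "(\<integral>\<omega>. lip_approx f k (Y n \<omega>) \<partial>M) \<le> (\<integral>\<omega>. f (Y n \<omega>) \<partial>M)"
        using Y lip_approx_le[of f C, OF bd] by (intro integral_mono iY iYk) auto
      then show ?case using k elim by linarith
    qed
  qed
  show ?thesis
    unfolding converges_weakly_def
  proof (intro conjI allI impI mY mZ)
    fix f :: "(real \<Rightarrow> 'a) \<Rightarrow> real"
    assume f: "continuous_map j1_topology euclideanreal f \<and> bounded (f ` topspace j1_topology)"
    then obtain C where C: "\<And>x. x \<in> cadlag_space \<Longrightarrow> \<bar>f x\<bar> \<le> C"
      by (auto simp: bounded_iff topspace_j1_topology)
    have f': "continuous_map j1_topology euclideanreal (\<lambda>x. - f x)"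
      using f by (intro continuous_intros) auto
    show "(\<lambda>n. \<integral>\<omega>. f (Y n \<omega>) \<partial>M) \<longlonglongrightarrow> (\<integral>\<omega>. f (Z \<omega>) \<partial>B)"
    proof (rule order_tendstoI)
      fix a assume "a < (\<integral>\<omega>. f (Z \<omega>) \<partial>B)"
      then show "\<forall>\<^sub>F n in sequentially. a < (\<integral>\<omega>. f (Y n \<omega>) \<partial>M)"
        using lower[of f C "(\<integral>\<omega>. f (Z \<omega>) \<partial>B) - a"] f C by simp
    next
      fix a assume "(\<integral>\<omega>. f (Z \<omega>) \<partial>B) < a"
      then show "\<forall>\<^sub>F n in sequentially. (\<integral>\<omega>. f (Y n \<omega>) \<partial>M) < a"
        using lower[OF f', of C "a - (\<integral>\<omega>. f (Z \<omega>) \<partial>B)"] C by simp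
    qed
  qed
qed

lemma cadlag_step:
  fixes c :: "nat \<Rightarrow> 'a::metric_space"
  assumes a: "0 \<le> a"
  shows "(\<lambda>t\<in>{0..}. c (nat \<lfloor>a * t\<rfloor>)) \<in> cadlag_space"
proof (cases "a = 0")
  case True
  then show ?thesis using const_cadlag[of "c 0"] by simp
next
  case False
  with a have a: "0 < a" by simp
  let ?x = "\<lambda>t\<in>{0..}. c (nat \<lfloor>a * t\<rfloor>)"
  have right: "(?x \<longlongrightarrow> ?x t) (at_right t)" if t: "0 \<le> t" for t
  proof (rule tendsto_eventually)
    have "t < (real_of_int \<lfloor>a * t\<rfloor> + 1) / a"
      using a floor_correct[of "a * t"] by (simp add: pos_less_divide_eq mult.commute)
    from eventually_at_right_real[OF this] show "\<forall>\<^sub>F s in at_right t. ?x s = ?x t"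
    proof eventually_elim
      case (elim s)
      then have "a * t \<le> a * s" "a * s < real_of_int \<lfloor>a * t\<rfloor> + 1" using a by (auto simp: field_simps)
      then have "\<lfloor>a * s\<rfloor> = \<lfloor>a * t\<rfloor>" by linarith
      then show ?case using elim t by simp
    qed
  qed
  have left: "\<exists>l. (?x \<longlongrightarrow> l) (at_left t)" if t: "0 < t" for t
  proof (intro exI tendsto_eventually)
    have pos: "0 < \<lceil>a * t\<rceil>" using a t by simp
    have "(real_of_int \<lceil>a * t\<rceil> - 1) / a < t"
      using a ceiling_correct[of "a * t"] by (simp add: pos_divide_less_eq mult.commute)
    \<comment> \<open>Just to the left of t the floor of a s is the ceiling of a t minus 1, whether
      or not a t is an integer.\<close>
    from eventually_at_left_real[OF this] show "\<forall>\<^sub>F s in at_left t. ?x s = c (nat (\<lceil>a * t\<rceil> - 1))"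
    proof eventually_elim
      case (elim s)
      then have "real_of_int \<lceil>a * t\<rceil> - 1 < a * s" "a * s < a * t" using a by (auto simp: field_simps)
      moreover have "a * t \<le> real_of_int \<lceil>a * t\<rceil>" by simp
      ultimately have "\<lfloor>a * s\<rfloor> = \<lceil>a * t\<rceil> - 1" by linarith
      moreover have "0 \<le> s"
      proof -
        have "0 \<le> (real_of_int \<lceil>a * t\<rceil> - 1) / a" using pos a by simp
        then show ?thesis using elim by simp
      qed
      ultimately show ?case by simp
    qed
  qed
  show ?thesis using right left unfolding cadlag_space_def by auto
qed

section \<open>Discretization of paths\<close>

text \<open>The index is frozen at J, so the path is a function of the values v 0, ..., v J.\<close>

definition step_path :: "real \<Rightarrow> nat \<Rightarrow> (nat \<Rightarrow> 'a) \<Rightarrow> real \<Rightarrow> 'a" where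
  "step_path a J v = (\<lambda>t\<in>{0..}. v (min (nat \<lfloor>a * t\<rfloor>) J))"

lemma step_path_cadlag: "0 \<le> a \<Longrightarrow> step_path a J (v :: nat \<Rightarrow> 'a::metric_space) \<in> cadlag_space"
  unfolding step_path_def using cadlag_step[of a "\<lambda>i. v (min i J)"] by simp

lemma step_path_cong: "(\<And>j. j \<le> J \<Longrightarrow> v j = w j) \<Longrightarrow> step_path a J v = step_path a J w"
  unfolding step_path_def by (rule restrict_ext) simp

lemma path_dist_step_path:
  "path_dist (step_path a J v) (step_path a J w) \<le> (\<Sum>j\<le>J. dist (v j) (w j))"
proof (rule path_dist_least)
  fix t :: real assume t: "0 \<le> t"
  let ?i = "min (nat \<lfloor>a * t\<rfloor>) J"
  have "dist (v ?i) (w ?i) \<le> (\<Sum>j\<le>J. dist (v j) (w j))"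
    by (rule member_le_sum[of ?i "{..J}" "\<lambda>j. dist (v j) (w j)"]) auto
  then show "min (1 / (1 + t)) (dist (step_path a J v t) (step_path a J w t)) \<le> (\<Sum>j\<le>J. dist (v j) (w j))"
    using t by (simp add: step_path_def min_le_iff_disj)
qed

lemma continuous_step_functional:
  fixes g :: "(real \<Rightarrow> 'a::metric_space) \<Rightarrow> real"
  assumes g: "path_lipschitz g" and a: "0 \<le> a"
  shows "continuous_on UNIV (\<lambda>v. g (step_path a J v))"
proof -
  obtain L where L: "0 \<le> L" "\<And>x y. x \<in> cadlag_space \<Longrightarrow> y \<in> cadlag_space \<Longrightarrow> \<bar>g x - g y\<bar> \<le> L * path_dist x y"
    using g unfolding path_lipschitz_def by blast
  show ?thesis
    unfolding continuous_on_def
  proof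
    fix v :: "nat \<Rightarrow> 'a"
    have coord: "((\<lambda>w. w j) \<longlongrightarrow> v j) (at v within UNIV)" for j
      using continuous_on_coordinate[of UNIV j] unfolding continuous_on_def by blast
    have "((\<lambda>w. L * (\<Sum>j\<le>J. dist (w j) (v j))) \<longlongrightarrow> L * (\<Sum>j\<le>J. dist (v j) (v j))) (at v within UNIV)"
      by (intro tendsto_intros coord)
    then have lim: "((\<lambda>w. L * (\<Sum>j\<le>J. dist (w j) (v j))) \<longlongrightarrow> 0) (at v within UNIV)" by simp
    have "norm (g (step_path a J w) - g (step_path a J v)) \<le> L * (\<Sum>j\<le>J. dist (w j) (v j))" for w
      using L(2)[OF step_path_cadlag[OF a] step_path_cadlag[OF a], of J w J v]
        mult_left_mono[OF path_dist_step_path[of a J w v] L(1)] by simp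
    then have "((\<lambda>w. g (step_path a J w) - g (step_path a J v)) \<longlongrightarrow> 0) (at v within UNIV)"
      by (intro Lim_null_comparison[OF always_eventually lim]) blast
    then show "((\<lambda>w. g (step_path a J w)) \<longlongrightarrow> g (step_path a J v)) (at v within UNIV)"
      by (simp add: LIM_zero_iff)
  qed
qed

text \<open>Sampling at mesh \<open>1 / m\<^sup>2\<close> up to time \<open>m\<close>: the modulus estimate for one mesh interval is of
  order \<open>m\<close> to the power \<open>-4\<close>, which beats the number \<open>m ^ 3\<close> of intervals.\<close>

definition disc :: "nat \<Rightarrow> (real \<Rightarrow> 'a) \<Rightarrow> real \<Rightarrow> 'a" where
  "disc m x = step_path ((real m)\<^sup>2) (m ^ 3) (\<lambda>j. x (real j / (real m)\<^sup>2))"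

lemma disc_cadlag: "disc m (x :: real \<Rightarrow> 'a::metric_space) \<in> cadlag_space"
  unfolding disc_def by (rule step_path_cadlag) simp

text \<open>The m^3 cells of length 1 / m^2 cover the times below m; later times count at most 1 /
  (1 + m) in the pseudometric whatever the paths do.\<close>

lemma path_dist_disc_le:
  assumes "\<And>t. 0 \<le> t \<Longrightarrow> t < real m \<Longrightarrow> dist (x (real (nat \<lfloor>(real m)\<^sup>2 * t\<rfloor>) / (real m)\<^sup>2)) (x t) \<le> e"
  shows "path_dist (disc m x) x \<le> max e (1 / (1 + real m))"
proof (rule path_dist_least)
  fix t :: real assume t: "0 \<le> t"
  show "min (1 / (1 + t)) (dist (disc m x t) (x t)) \<le> max e (1 / (1 + real m))"
  proof (cases "t < real m")
    case True
    have "(real m)\<^sup>2 * t \<le> (real m)\<^sup>2 * real m" using True by (intro mult_left_mono) auto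
    also have "\<dots> = real (m ^ 3)" by (simp add: power2_eq_square power3_eq_cube)
    finally have "nat \<lfloor>(real m)\<^sup>2 * t\<rfloor> \<le> m ^ 3" by linarith
    then have "disc m x t = x (real (nat \<lfloor>(real m)\<^sup>2 * t\<rfloor>) / (real m)\<^sup>2)"
      using t by (simp add: disc_def step_path_def min_absorb1)
    then show ?thesis using assms[OF t True] by (simp add: min_le_iff_disj le_max_iff_disj)
  next
    case False
    then have "1 / (1 + t) \<le> 1 / (1 + real m)" by (intro divide_left_mono) auto
    then show ?thesis by (simp add: min_le_iff_disj le_max_iff_disj)
  qed
qed

lemma grid_point_bounds:
  fixes t :: real
  assumes "0 \<le> t" "0 < m"
  shows "real (nat \<lfloor>(real m)\<^sup>2 * t\<rfloor>) / (real m)\<^sup>2 \<le> t" "t < (real (nat \<lfloor>(real m)\<^sup>2 * t\<rfloor>) + 1) / (real m)\<^sup>2"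
proof -
  have "0 \<le> (real m)\<^sup>2 * t" using assms by simp
  then have r: "real (nat \<lfloor>(real m)\<^sup>2 * t\<rfloor>) = real_of_int \<lfloor>(real m)\<^sup>2 * t\<rfloor>" by simp
  show "real (nat \<lfloor>(real m)\<^sup>2 * t\<rfloor>) / (real m)\<^sup>2 \<le> t"
    unfolding r using assms by (simp add: pos_divide_le_eq mult.commute)
  show "t < (real (nat \<lfloor>(real m)\<^sup>2 * t\<rfloor>) + 1) / (real m)\<^sup>2"
    unfolding r using assms floor_correct[of "(real m)\<^sup>2 * t"] by (simp add: pos_less_divide_eq mult.commute)
qed

lemma disc_tendsto_continuous:
  fixes x :: "real \<Rightarrow> 'a::metric_space"
  assumes x: "continuous_on {0..} x"
  shows "(\<lambda>m. path_dist (disc m x) x) \<longlonglongrightarrow> 0"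
proof (rule LIMSEQ_I)
  fix e :: real assume e: "0 < e"
  obtain T :: nat where T: "2 / e < real T" using reals_Archimedean2 by blast
  have T0: "0 < real T" using T e by (smt (verit) divide_pos_pos)
  have T1: "1 / (1 + real T) < e / 2"
    using T e T0 by (simp add: field_simps)
  have "uniformly_continuous_on {0..real T} x"
    by (intro compact_uniformly_continuous continuous_on_subset[OF x]) auto
  then obtain \<delta> where \<delta>: "0 < \<delta>" "\<And>s t. s \<in> {0..real T} \<Longrightarrow> t \<in> {0..real T} \<Longrightarrow> dist s t < \<delta> \<Longrightarrow> dist (x s) (x t) < e / 2"
    unfolding uniformly_continuous_on_def using half_gt_zero[OF e] by metis
  obtain m1 :: nat where m1: "1 / \<delta> < real m1" using reals_Archimedean2 by blast
  have m10: "0 < real m1" using m1 \<delta> by (smt (verit) divide_pos_pos)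
  show "\<exists>m0. \<forall>m\<ge>m0. norm (path_dist (disc m x) x - 0) < e"
  proof (intro exI[of _ "max T m1"] allI impI)
    fix m assume m: "max T m1 \<le> m"
    have mpos: "0 < m" using m m10 by auto
    have mesh: "1 / (real m)\<^sup>2 < \<delta>"
    proof -
      have "1 / \<delta> < real m" using m1 m by (simp add: max_def split: if_splits)
      also have "real m \<le> (real m)\<^sup>2" using mpos by (simp add: power2_eq_square)
      finally show ?thesis using \<delta>(1) mpos by (simp add: field_simps)
    qed
    have "path_dist (disc m x) x \<le> e / 2"
    proof (rule path_dist_least)
      fix t :: real assume t: "0 \<le> t"
      show "min (1 / (1 + t)) (dist (disc m x t) (x t)) \<le> e / 2"
      proof (cases "t < real T")
        case True
        then have tm: "t < real m" using m by auto
        have "(real m)\<^sup>2 * t \<le> (real m)\<^sup>2 * real m" using tm by (intro mult_left_mono) auto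
        also have "\<dots> = real (m ^ 3)" by (simp add: power2_eq_square power3_eq_cube)
        finally have "nat \<lfloor>(real m)\<^sup>2 * t\<rfloor> \<le> m ^ 3" by linarith
        then have d: "disc m x t = x (real (nat \<lfloor>(real m)\<^sup>2 * t\<rfloor>) / (real m)\<^sup>2)"
          using t by (simp add: disc_def step_path_def min_absorb1)
        let ?s = "real (nat \<lfloor>(real m)\<^sup>2 * t\<rfloor>) / (real m)\<^sup>2"
        note gp = grid_point_bounds[OF t mpos]
        have "dist ?s t < \<delta>"
          using gp mesh by (simp add: dist_real_def add_divide_distrib)
        moreover have "0 \<le> ?s" by simp
        ultimately have "dist (x ?s) (x t) < e / 2"
          using gp(1) True t by (intro \<delta>(2)) auto
        then show ?thesis unfolding d by linarith
      next
        case False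
        then have "1 / (1 + t) \<le> 1 / (1 + real T)" using T0 by (intro divide_left_mono) auto
        then show ?thesis using T1 by linarith
      qed
    qed
    then show "norm (path_dist (disc m x) x - 0) < e" using e path_dist_nonneg[of "disc m x" x] by simp
  qed
qed

text \<open>For a path with jumps an arbitrary mesh would displace the jumps. Along the multiples of
  n the jump times k / n are grid points, so each cell lies inside one constancy interval and the
  discretization is exact before time n l.\<close>

lemma disc_tendsto_step:
  fixes c :: "nat \<Rightarrow> 'a::metric_space" and n :: nat
  assumes n: "0 < n"
  shows "(\<lambda>l. path_dist (disc (n * l) (\<lambda>t\<in>{0..}. c (nat \<lfloor>real n * t\<rfloor>))) (\<lambda>t\<in>{0..}. c (nat \<lfloor>real n * t\<rfloor>))) \<longlonglongrightarrow> 0"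
proof (rule Lim_null_comparison)
  let ?x = "\<lambda>t\<in>{0..}. c (nat \<lfloor>real n * t\<rfloor>)"
  show "(\<lambda>l. 1 / (1 + real (n * l))) \<longlonglongrightarrow> 0" using n by real_asymp
  show "\<forall>\<^sub>F l in sequentially. norm (path_dist (disc (n * l) ?x) ?x) \<le> 1 / (1 + real (n * l))"
  proof (intro eventually_sequentiallyI[of 1])
    fix l :: nat assume l: "1 \<le> l"
    have "path_dist (disc (n * l) ?x) ?x \<le> max 0 (1 / (1 + real (n * l)))"
    proof (rule path_dist_disc_le)
      fix t :: real assume t: "0 \<le> t"
      \<comment> \<open>The number of cells of length 1 / (n l)^2 in one interval of length 1 /
        n.\<close>
      define q where "q = n * l\<^sup>2"
      have q: "0 < q" using n l by (simp add: q_def)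
      have m2: "(real (n * l))\<^sup>2 = real n * real q" by (simp add: q_def power2_eq_square)
      have "real n * (real (nat \<lfloor>real n * real q * t\<rfloor>) / (real n * real q)) = real_of_int \<lfloor>real n * real q * t\<rfloor> / real_of_int (int q)"
        using n t by simp
      then have "\<lfloor>real n * (real (nat \<lfloor>real n * real q * t\<rfloor>) / (real n * real q))\<rfloor> = \<lfloor>real n * real q * t\<rfloor> div int q"
        by (simp only: floor_divide_of_int_eq)
      also have "\<dots> = \<lfloor>real n * real q * t / real_of_int (int q)\<rfloor>"
        by (rule floor_divide_real_eq_div[symmetric]) simp
      also have "real n * real q * t / real_of_int (int q) = real n * t" using q by simp
      finally have "\<lfloor>real n * (real (nat \<lfloor>real n * real q * t\<rfloor>) / (real n * real q))\<rfloor> = \<lfloor>real n * t\<rfloor>" .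
      then show "dist (?x (real (nat \<lfloor>(real (n * l))\<^sup>2 * t\<rfloor>) / (real (n * l))\<^sup>2)) (?x t) \<le> 0"
        unfolding m2 using t by simp
    qed
    moreover have "max 0 (1 / (1 + real (n * l))) = 1 / (1 + real (n * l))" by (rule max_absorb2) simp
    ultimately have "path_dist (disc (n * l) ?x) ?x \<le> 1 / (1 + real (n * l))" by (simp only:)
    then show "norm (path_dist (disc (n * l) ?x) ?x) \<le> 1 / (1 + real (n * l))"
      unfolding real_norm_def abs_of_nonneg[OF path_dist_nonneg] .
  qed
qed

section \<open>Measurability of path functionals\<close>

lemma measurable_disc_functional:
  fixes Y :: "'c \<Rightarrow> real \<Rightarrow> 'a::{metric_space, second_countable_topology}"
  assumes g: "path_lipschitz g" and Y: "\<And>t. 0 \<le> t \<Longrightarrow> (\<lambda>\<omega>. Y \<omega> t) \<in> borel_measurable M"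
  shows "(\<lambda>\<omega>. g (disc m (Y \<omega>))) \<in> borel_measurable M"
proof -
  have "(\<lambda>\<omega> j. Y \<omega> (real j / (real m)\<^sup>2)) \<in> borel_measurable M"
    by (rule measurable_coordinatewise_then_product) (rule Y, simp)
  from measurable_compose[OF this borel_measurable_continuous_onI[OF continuous_step_functional[OF g]]]
  show ?thesis unfolding disc_def by simp
qed

text \<open>The functional is a pointwise limit of functionals of finitely many coordinates. This
  requires meshes \<open>\<sigma>\<close> that are the same for all outcomes.\<close>

lemma measurable_path_functional:
  fixes Y :: "'c \<Rightarrow> real \<Rightarrow> 'a::{metric_space, second_countable_topology}"
  assumes g: "path_lipschitz g" and Y: "\<And>t. 0 \<le> t \<Longrightarrow> (\<lambda>\<omega>. Y \<omega> t) \<in> borel_measurable M"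
    and cad: "\<And>\<omega>. \<omega> \<in> space M \<Longrightarrow> Y \<omega> \<in> cadlag_space"
    and lim: "\<And>\<omega>. \<omega> \<in> space M \<Longrightarrow> (\<lambda>l. path_dist (disc (\<sigma> l) (Y \<omega>)) (Y \<omega>)) \<longlonglongrightarrow> 0"
  shows "(\<lambda>\<omega>. g (Y \<omega>)) \<in> borel_measurable M"
proof (rule borel_measurable_LIMSEQ_real)
  show "(\<lambda>\<omega>. g (disc (\<sigma> l) (Y \<omega>))) \<in> borel_measurable M" for l
    by (rule measurable_disc_functional[OF g Y])
  fix \<omega> assume \<omega>: "\<omega> \<in> space M"
  obtain L where L: "0 \<le> L" "\<And>x y. x \<in> cadlag_space \<Longrightarrow> y \<in> cadlag_space \<Longrightarrow> \<bar>g x - g y\<bar> \<le> L * path_dist x y"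
    using g unfolding path_lipschitz_def by blast
  have "(\<lambda>l. g (disc (\<sigma> l) (Y \<omega>)) - g (Y \<omega>)) \<longlonglongrightarrow> 0"
  proof (rule Lim_null_comparison)
    show "(\<lambda>l. L * path_dist (disc (\<sigma> l) (Y \<omega>)) (Y \<omega>)) \<longlonglongrightarrow> 0"
      by (rule tendsto_mult_right_zero[OF lim[OF \<omega>]])
    show "\<forall>\<^sub>F l in sequentially. norm (g (disc (\<sigma> l) (Y \<omega>)) - g (Y \<omega>)) \<le> L * path_dist (disc (\<sigma> l) (Y \<omega>)) (Y \<omega>)"
      using L(2)[OF disc_cadlag cad[OF \<omega>]] by (intro always_eventually) simp
  qed
  then show "(\<lambda>l. g (disc (\<sigma> l) (Y \<omega>))) \<longlonglongrightarrow> g (Y \<omega>)" by (simp add: LIM_zero_iff)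
qed

section \<open>Path laws of Markov chains\<close>

definition law :: "'a measure \<Rightarrow> ('a \<Rightarrow> 'b) \<Rightarrow> 'b pmf" where
  "law M X = Abs_pmf (distr M (count_space UNIV) X)"

text \<open>On a countable type a probability measure is carried by its atoms, which is what the
  passage to \<open>pmf\<close> requires.\<close>

lemma measure_pmf_law:
  fixes X :: "'a \<Rightarrow> 'b::countable"
  assumes M: "prob_space M" and X: "X \<in> measurable M (count_space UNIV)"
  shows "measure_pmf (law M X) = distr M (count_space UNIV) X"
proof -
  interpret D: prob_space "distr M (count_space UNIV) X"
    by (rule prob_space.prob_space_distr[OF M X])
  have "AE x in distr M (count_space UNIV) X. measure (distr M (count_space UNIV) X) {x} \<noteq> 0"
  proof (subst D.AE_support_countable)
    show "sets (distr M (count_space UNIV) X) = UNIV" by simp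
    show "\<exists>S. countable S \<and> (AE x in distr M (count_space UNIV) X. x \<in> S)"
      by (intro exI[of _ UNIV]) auto
  qed
  then have "distr M (count_space UNIV) X \<in> {M. prob_space M \<and> sets M = UNIV \<and> (AE x in M. measure M {x} \<noteq> 0)}"
    using D.prob_space_axioms by simp
  then show ?thesis unfolding law_def by (rule Abs_pmf_inverse)
qed

context
  fixes M :: "'a measure" and X :: "'a \<Rightarrow> 'b::countable"
  assumes M: "prob_space M" and X: "X \<in> measurable M (count_space UNIV)"
begin

lemma integral_law:
  fixes f :: "'b \<Rightarrow> 'c::{banach, second_countable_topology}"
  shows "(\<integral>x. f x \<partial>measure_pmf (law M X)) = (\<integral>\<omega>. f (X \<omega>) \<partial>M)"
  unfolding measure_pmf_law[OF M X] using X by (subst integral_distr) auto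

lemma integrable_law:
  fixes f :: "'b \<Rightarrow> 'c::{banach, second_countable_topology}"
  shows "integrable (measure_pmf (law M X)) f \<longleftrightarrow> integrable M (\<lambda>\<omega>. f (X \<omega>))"
  unfolding measure_pmf_law[OF M X] using X by (subst integrable_distr_eq) auto

lemma measure_law: "measure (measure_pmf (law M X)) S = measure M {\<omega> \<in> space M. X \<omega> \<in> S}"
  unfolding measure_pmf_law[OF M X] using X
  by (subst measure_distr) (auto intro!: arg_cong[where f = "measure M"])

lemma pmf_law: "pmf (law M X) x = measure M {\<omega> \<in> space M. X \<omega> = x}"
  using measure_law[of "{x}"] by (simp add: measure_pmf_single)

lemma law_map:
  fixes f :: "'b \<Rightarrow> 'd::countable"
  shows "law M (\<lambda>\<omega>. f (X \<omega>)) = map_pmf f (law M X)"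
proof (rule pmf_eqI)
  fix y
  have "(\<lambda>\<omega>. f (X \<omega>)) \<in> measurable M (count_space UNIV)" using X by simp
  note m = measure_pmf_law[OF M this]
  show "pmf (law M (\<lambda>\<omega>. f (X \<omega>))) y = pmf (map_pmf f (law M X)) y"
    unfolding pmf.rep_eq m map_pmf_rep_eq measure_pmf_law[OF M X]
    using X by (subst distr_distr) (auto simp: o_def)
qed

end

section \<open>Path laws of a kernel and the Markov property\<close>

primrec paths :: "('s \<Rightarrow> 's pmf) \<Rightarrow> nat \<Rightarrow> 's \<Rightarrow> 's list pmf" where
  "paths K 0 x = return_pmf [x]"
| "paths K (Suc n) x = map_pmf ((#) x) (bind_pmf (K x) (paths K n))"

lemma length_paths: "l \<in> set_pmf (paths K n x) \<Longrightarrow> length l = Suc n"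
  by (induction n arbitrary: l x) auto

lemma hd_paths: "l \<in> set_pmf (paths K n x) \<Longrightarrow> hd l = x"
  by (cases n) auto

text \<open>The Markov property of a process appends states to a history, whereas
  \<open>paths\<close> prepends the starting state; this lemma reconciles the two.\<close>

lemma paths_Suc_right:
  "paths K (Suc n) x = bind_pmf (paths K n x) (\<lambda>l. map_pmf (\<lambda>y. l @ [y]) (K (last l)))"
proof (induction n arbitrary: x)
  case 0
  have "paths K 0 = (\<lambda>y. return_pmf [y])" by (rule ext) simp
  then show ?case by (simp add: map_pmf_def bind_assoc_pmf bind_return_pmf)
next
  case (Suc n)
  have "paths K (Suc n) = (\<lambda>y. bind_pmf (paths K n y) (\<lambda>l. map_pmf (\<lambda>z. l @ [z]) (K (last l))))"
    by (rule ext) (rule Suc.IH)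
  then have "paths K (Suc (Suc n)) x =
      bind_pmf (K x) (\<lambda>y. bind_pmf (paths K n y) (\<lambda>l. map_pmf (\<lambda>z. x # l @ [z]) (K (last l))))"
    by (simp only: paths.simps(2)[of K "Suc n"]) (simp add: map_bind_pmf pmf.map_comp o_def)
  also have "\<dots> = bind_pmf (K x) (\<lambda>y. bind_pmf (paths K n y) (\<lambda>l. map_pmf (\<lambda>z. (x # l) @ [z]) (K (last (x # l)))))"
    by (intro bind_pmf_cong refl) (auto dest!: length_paths)
  also have "\<dots> = bind_pmf (paths K (Suc n) x) (\<lambda>l. map_pmf (\<lambda>z. l @ [z]) (K (last l)))"
    by (simp add: bind_map_pmf map_bind_pmf bind_assoc_pmf)
  finally show ?case .
qed

lemma measure_paths_exit:
  "measure (measure_pmf (paths K n x)) {l. \<exists>y\<in>set l. r < norm (rvec (y - x0))} = exit_prob K r x0 n x"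
proof (induction n arbitrary: x)
  case (Suc n)
  have "measure (measure_pmf (paths K (Suc n) x)) {l. \<exists>y\<in>set l. r < norm (rvec (y - x0))}
     = (\<integral>y. measure (measure_pmf (paths K n y)) {l. \<exists>y\<in>set (x # l). r < norm (rvec (y - x0))} \<partial>measure_pmf (K x))"
    by (simp add: measure_map_pmf vimage_def measure_bind_pmf)
  then show ?case using Suc.IH by (cases "r < norm (rvec (x - x0))") simp_all
qed (simp add: indicator_def)

locale chain = prob_space M for M :: "'c measure" +
  fixes X :: "nat \<Rightarrow> 'c \<Rightarrow> 's::countable" and K :: "'s \<Rightarrow> 's pmf"
  assumes markov: "markov_chain M X (\<lambda>x y. pmf (K x) y)"
begin

lemma X_measurable[measurable]: "X n \<in> measurable M (count_space UNIV)"
  using markov by (simp add: markov_chain_def)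

definition hist :: "nat \<Rightarrow> nat \<Rightarrow> 'c \<Rightarrow> 's list" where
  "hist s n \<omega> = map (\<lambda>k. X (s + k) \<omega>) [0..<Suc n]"

lemma hist_Suc: "hist s (Suc n) \<omega> = hist s n \<omega> @ [X (s + Suc n) \<omega>]"
  by (simp add: hist_def)

lemma hist_measurable: "hist s n \<in> measurable M (count_space UNIV)"
proof (induction n)
  case 0
  have "(\<lambda>\<omega>. [X s \<omega>]) \<in> measurable M (count_space UNIV)" by simp
  then show ?case by (simp add: hist_def[abs_def])
next
  case (Suc n)
  have 1: "(\<lambda>\<omega>. (hist s n \<omega>, X (s + Suc n) \<omega>)) \<in> measurable M (count_space UNIV)"
    using measurable_Pair[OF Suc.IH X_measurable] by (simp add: pair_measure_countable)
  have "(\<lambda>(l, y). l @ [y]) \<in> measurable (count_space UNIV) (count_space UNIV)" by simp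
  from measurable_compose[OF 1 this] have "(\<lambda>\<omega>. hist s n \<omega> @ [X (s + Suc n) \<omega>]) \<in> measurable M (count_space UNIV)"
    by simp
  then show ?case by (simp add: hist_Suc[abs_def])
qed

lemma last_hist: "last (hist s n \<omega>) = X (s + n) \<omega>"
  by (simp add: hist_def)

lemma law_hist_Suc_0:
  "law M (hist 0 (Suc n)) = bind_pmf (law M (hist 0 n)) (\<lambda>l. map_pmf (\<lambda>y. l @ [y]) (K (last l)))"
proof (rule pmf_eqI)
  fix l :: "'s list"
  show "pmf (law M (hist 0 (Suc n))) l = pmf (bind_pmf (law M (hist 0 n)) (\<lambda>l. map_pmf (\<lambda>y. l @ [y]) (K (last l)))) l"
  proof (cases l rule: rev_cases)
    case Nil
    have "pmf (map_pmf (\<lambda>y. k @ [y]) (K (last k))) [] = 0" for k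
      by (auto simp: pmf_eq_0_set_pmf)
    then show ?thesis
      unfolding Nil pmf_bind pmf_law[OF prob_space_axioms hist_measurable] by (simp add: hist_def)
  next
    case (snoc h y)
    have p: "pmf (map_pmf (\<lambda>y. k @ [y]) (K (last k))) (h @ [y]) = pmf (K (last h)) y * indicator {h} k" for k
    proof (cases "k = h")
      case True
      then show ?thesis using pmf_map_inj'[of "\<lambda>y. h @ [y]" "K (last h)" y] by (simp add: inj_def)
    next
      case False
      then have "h @ [y] \<notin> set_pmf (map_pmf (\<lambda>y. k @ [y]) (K (last k)))" by auto
      then show ?thesis using False by (simp add: pmf_eq_0_set_pmf)
    qed
    have "pmf (bind_pmf (law M (hist 0 n)) (\<lambda>l. map_pmf (\<lambda>y. l @ [y]) (K (last l)))) l = pmf (K (last h)) y * pmf (law M (hist 0 n)) h"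
      unfolding snoc pmf_bind p by (simp add: measure_pmf_single)
    also have "\<dots> = pmf (law M (hist 0 (Suc n))) l"
    proof (cases "length h = Suc n")
      case False
      then have "hist 0 n \<omega> \<noteq> h" "hist 0 (Suc n) \<omega> \<noteq> h @ [y]" for \<omega> by (auto simp: hist_def)
      then show ?thesis unfolding snoc pmf_law[OF prob_space_axioms hist_measurable] by simp
    next
      case True
      have eqh: "hist 0 n \<omega> = h \<longleftrightarrow> (\<forall>k\<le>n. X k \<omega> = h ! k)" for \<omega>
        using True by (auto simp: hist_def list_eq_iff_nth_eq less_Suc_eq_le simp del: upt_Suc)
      have lh: "last h = h ! n" using True by (metis diff_Suc_1 last_conv_nth length_greater_0_conv zero_less_Suc)
      let ?P = "\<P>(\<omega> in M. \<forall>k\<le>n. X k \<omega> = h ! k)"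
      have 1: "pmf (law M (hist 0 n)) h = ?P"
        unfolding pmf_law[OF prob_space_axioms hist_measurable] eqh ..
      have 2: "pmf (law M (hist 0 (Suc n))) l = \<P>(\<omega> in M. X (Suc n) \<omega> = y \<and> (\<forall>k\<le>n. X k \<omega> = h ! k))"
        unfolding pmf_law[OF prob_space_axioms hist_measurable] snoc hist_Suc
        by (rule arg_cong[where f = "measure M"]) (auto simp: eqh)
      \<comment> \<open>The Markov property speaks only about histories of positive probability. For
        a null history both sides vanish.\<close>
      show ?thesis
      proof (cases "?P > 0")
        case True
        then have "\<P>(\<omega> in M. X (Suc n) \<omega> = y \<bar> \<forall>k\<le>n. X k \<omega> = h ! k) = pmf (K (h ! n)) y"
          using markov unfolding markov_chain_def by blast
        then show ?thesis unfolding 1 2 lh cond_prob_def using True by (simp add: field_simps)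
      next
        case False
        then have P0: "?P = 0" 
          using measure_nonneg[of M "{\<omega> \<in> space M. \<forall>k\<le>n. X k \<omega> = h ! k}"] by linarith
        have "{\<omega> \<in> space M. hist 0 n \<omega> = h} \<in> sets M" using hist_measurable[of 0 n] by simp
        then have "{\<omega> \<in> space M. \<forall>k\<le>n. X k \<omega> = h ! k} \<in> sets M" by (simp only: eqh)
        then have "\<P>(\<omega> in M. X (Suc n) \<omega> = y \<and> (\<forall>k\<le>n. X k \<omega> = h ! k)) \<le> ?P"
          by (intro finite_measure_mono) auto
        then have "\<P>(\<omega> in M. X (Suc n) \<omega> = y \<and> (\<forall>k\<le>n. X k \<omega> = h ! k)) = 0"
          using P0 measure_nonneg[of M "{\<omega> \<in> space M. X (Suc n) \<omega> = y \<and> (\<forall>k\<le>n. X k \<omega> = h ! k)}"] by linarith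
        then show ?thesis unfolding 1 2 P0 by simp
      qed
    qed
    finally show ?thesis ..
  qed
qed

text \<open>The case s = 0 is pushed forward under \<open>drop s\<close>. Dropping commutes with
  appending a state and keeps the last entry, since the histories that occur are longer than
  s.\<close>

lemma law_hist: "law M (hist s n) = bind_pmf (law M (X s)) (paths K n)"
proof (induction n)
  case 0
  have "paths K 0 = (\<lambda>x. return_pmf [x])" by (rule ext) simp
  then have "bind_pmf (law M (X s)) (paths K 0) = map_pmf (\<lambda>x. [x]) (law M (X s))"
    by (simp add: map_pmf_def)
  also have "\<dots> = law M (\<lambda>\<omega>. [X s \<omega>])" by (rule law_map[symmetric, OF prob_space_axioms X_measurable])
  finally show ?case
  proof -
    have "hist s 0 = (\<lambda>\<omega>. [X s \<omega>])" by (rule ext) (simp add: hist_def)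
    then show "bind_pmf (law M (X s)) (paths K 0) = law M (\<lambda>\<omega>. [X s \<omega>]) \<Longrightarrow> ?thesis" by (simp only:)
  qed
next
  case (Suc n)
  have drop: "hist s k = (\<lambda>\<omega>. drop s (hist 0 (s + k) \<omega>))" for k
    by (rule ext) (auto simp: hist_def list_eq_iff_nth_eq simp del: upt_Suc)
  have "law M (hist s (Suc n)) = map_pmf (drop s) (law M (hist 0 (Suc (s + n))))"
    unfolding drop by (subst law_map[OF prob_space_axioms hist_measurable]) simp
  also have "\<dots> = bind_pmf (law M (hist 0 (s + n))) (\<lambda>l. map_pmf (\<lambda>y. drop s (l @ [y])) (K (last l)))"
    unfolding law_hist_Suc_0 by (simp add: map_bind_pmf pmf.map_comp o_def del: drop_append)
  also have "\<dots> = bind_pmf (law M (hist 0 (s + n))) (\<lambda>l. map_pmf (\<lambda>y. drop s l @ [y]) (K (last (drop s l))))"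
  proof (rule bind_pmf_cong[OF refl])
    fix l assume l: "l \<in> set_pmf (law M (hist 0 (s + n)))"
    have "length l = Suc (s + n)"
    proof (rule ccontr)
      assume "length l \<noteq> Suc (s + n)"
      then have "hist 0 (s + n) \<omega> \<noteq> l" for \<omega> by (auto simp: hist_def)
      then have "pmf (law M (hist 0 (s + n))) l = 0"
        unfolding pmf_law[OF prob_space_axioms hist_measurable] by simp
      then show False using l by (simp add: set_pmf_iff)
    qed
    then show "map_pmf (\<lambda>y. drop s (l @ [y])) (K (last l)) = map_pmf (\<lambda>y. drop s l @ [y]) (K (last (drop s l)))"
      by (simp add: last_drop)
  qed
  also have "\<dots> = bind_pmf (map_pmf (drop s) (law M (hist 0 (s + n)))) (\<lambda>l. map_pmf (\<lambda>y. l @ [y]) (K (last l)))"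
    by (simp add: bind_map_pmf)
  also have "map_pmf (drop s) (law M (hist 0 (s + n))) = law M (hist s n)"
    unfolding drop[of n] by (rule law_map[symmetric, OF prob_space_axioms hist_measurable])
  finally show ?case unfolding Suc.IH by (simp only: paths_Suc_right[abs_def] bind_assoc_pmf)
qed

lemma one_step:
  fixes G :: "'s list \<Rightarrow> complex"
  assumes G: "\<And>l. norm (G l) \<le> C"
  shows "(\<integral>\<omega>. G (hist 0 (Suc n) \<omega>) \<partial>M) = (\<integral>\<omega>. (\<integral>y. G (hist 0 n \<omega> @ [y]) \<partial>measure_pmf (K (X n \<omega>))) \<partial>M)"
proof -
  have "(\<integral>\<omega>. G (hist 0 (Suc n) \<omega>) \<partial>M) = (\<integral>l. G l \<partial>measure_pmf (law M (hist 0 (Suc n))))"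
    by (rule integral_law[symmetric, OF prob_space_axioms hist_measurable])
  also have "\<dots> = (\<integral>l. (\<integral>y. G (l @ [y]) \<partial>measure_pmf (K (last l))) \<partial>measure_pmf (law M (hist 0 n)))"
    unfolding law_hist_Suc_0 by (subst integral_bind_pmf_complex[OF G]) simp
  also have "\<dots> = (\<integral>\<omega>. (\<integral>y. G (hist 0 n \<omega> @ [y]) \<partial>measure_pmf (K (X n \<omega>))) \<partial>M)"
    by (subst integral_law[OF prob_space_axioms hist_measurable]) (simp add: last_hist)
  finally show ?thesis .
qed

text \<open>The Markov property given the whole past up to time s, recorded by F. The induction
  integrates out the final step, which replaces u by its average under K and shortens the
  time.\<close>

lemma multi_step:
  fixes F :: "'s list \<Rightarrow> complex" and u :: "'s \<Rightarrow> complex"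
  assumes F: "\<And>l. norm (F l) \<le> 1" and u: "\<And>x. norm (u x) \<le> 1"
  shows "(\<integral>\<omega>. F (hist 0 s \<omega>) * u (X (s + m) \<omega>) \<partial>M)
    = (\<integral>\<omega>. F (hist 0 s \<omega>) * (\<integral>y. u y \<partial>measure_pmf (kpow K m (X s \<omega>))) \<partial>M)"
  using u
proof (induction m arbitrary: u)
  case (Suc m)
  let ?G = "\<lambda>l. F (take (Suc s) l) * u (last l)"
  have take: "take (Suc s) (hist 0 (Suc (s + m)) \<omega>) = hist 0 s \<omega>" "take (Suc s) (hist 0 (s + m) \<omega> @ [y]) = hist 0 s \<omega>" for \<omega> y
    by (auto simp: hist_def list_eq_iff_nth_eq nth_append simp del: upt_Suc)
  have G: "norm (?G l) \<le> 1" for l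
    using F[of "take (Suc s) l"] Suc.prems[of "last l"] by (simp add: norm_mult mult_le_one)
  have "(\<integral>\<omega>. F (hist 0 s \<omega>) * u (X (s + Suc m) \<omega>) \<partial>M) = (\<integral>\<omega>. ?G (hist 0 (Suc (s + m)) \<omega>) \<partial>M)"
    by (simp only: take last_hist) simp
  also have "\<dots> = (\<integral>\<omega>. (\<integral>y. ?G (hist 0 (s + m) \<omega> @ [y]) \<partial>measure_pmf (K (X (s + m) \<omega>))) \<partial>M)"
    by (rule one_step[OF G])
  also have "\<dots> = (\<integral>\<omega>. F (hist 0 s \<omega>) * (\<integral>y. u y \<partial>measure_pmf (K (X (s + m) \<omega>))) \<partial>M)"
    by (simp only: take last_snoc integral_mult_right_zero)
  also have "\<dots> = (\<integral>\<omega>. F (hist 0 s \<omega>) * (\<integral>x. (\<integral>y. u y \<partial>measure_pmf (K x)) \<partial>measure_pmf (kpow K m (X s \<omega>))) \<partial>M)"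
    by (rule Suc.IH) (rule norm_integral_pmf_le[OF Suc.prems])
  also have "\<dots> = (\<integral>\<omega>. F (hist 0 s \<omega>) * (\<integral>y. u y \<partial>measure_pmf (kpow K (Suc m) (X s \<omega>))) \<partial>M)"
    unfolding kpow_Suc_right by (subst integral_bind_pmf_complex[OF Suc.prems]) simp
  finally show ?case .
qed simp

end

lemma (in chain) integrable_hist:
  fixes G :: "'s list \<Rightarrow> 'b::{banach, second_countable_topology}"
  assumes "\<And>l. norm (G l) \<le> C"
  shows "integrable M (\<lambda>\<omega>. G (hist s n \<omega>))"
  using integrable_law[OF prob_space_axioms hist_measurable, where f = G] integrable_measure_pmf_bounded[of G C] assms by blast

text \<open>Conditioning on the state at time s: a bound uniform in the start survives averaging
  over whatever law that state has.\<close>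

lemma chain_exit_le:
  fixes X :: "nat \<Rightarrow> 'c \<Rightarrow> Z2"
  assumes "chain M X K" and c: "\<And>x. exit_prob K r x n x \<le> c"
  shows "measure M {\<omega> \<in> space M. \<exists>k\<le>n. r < norm (rvec (X (s + k) \<omega> - X s \<omega>))} \<le> c"
proof -
  interpret chain M X K by fact
  let ?S = "{l. \<exists>y\<in>set l. r < norm (rvec (y - hd l))}"
  have "hist s n \<omega> \<in> ?S \<longleftrightarrow> (\<exists>k\<le>n. r < norm (rvec (X (s + k) \<omega> - X s \<omega>)))" for \<omega>
  proof -
    have "hd (hist s n \<omega>) = X s \<omega>" by (simp add: hist_def hd_map del: upt_Suc)
    then show ?thesis by (auto simp: hist_def less_Suc_eq_le simp del: upt_Suc)
  qed
  then have "measure M {\<omega> \<in> space M. \<exists>k\<le>n. r < norm (rvec (X (s + k) \<omega> - X s \<omega>))} = measure (measure_pmf (law M (hist s n))) ?S"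
    unfolding measure_law[OF prob_space_axioms hist_measurable] by simp
  also have "\<dots> = (\<integral>x. measure (measure_pmf (paths K n x)) ?S \<partial>measure_pmf (law M (X s)))"
    unfolding law_hist by (rule measure_bind_pmf)
  also have "\<dots> = (\<integral>x. exit_prob K r x n x \<partial>measure_pmf (law M (X s)))"
  proof (rule Bochner_Integration.integral_cong[OF refl])
    fix x
    have "measure (measure_pmf (paths K n x)) ?S = measure (measure_pmf (paths K n x)) {l. \<exists>y\<in>set l. r < norm (rvec (y - x))}"
      by (rule measure_pmf.finite_measure_eq_AE) (auto simp: AE_measure_pmf_iff dest: hd_paths)
    then show "measure (measure_pmf (paths K n x)) ?S = exit_prob K r x n x" by (simp only: measure_paths_exit)
  qed
  also have "\<dots> \<le> c"
    using c by (intro measure_pmf.integral_le_const integrable_measure_pmf_bounded[where C = 1])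
      (auto simp: exit_prob_bounds)
  finally show ?thesis .
qed

section \<open>Finite-dimensional distributions\<close>

lemma nat_floor_div_tendsto:
  assumes "0 \<le> a"
  shows "(\<lambda>n. real (nat \<lfloor>real n * a\<rfloor>) / real n) \<longlonglongrightarrow> a"
proof -
  have "(\<lambda>n. real (nat \<lfloor>real n * a\<rfloor>) / real n - a) \<longlonglongrightarrow> 0"
  proof (rule Lim_null_comparison)
    show "(\<lambda>n. 1 / real n) \<longlonglongrightarrow> 0" by real_asymp
    show "\<forall>\<^sub>F n in sequentially. norm (real (nat \<lfloor>real n * a\<rfloor>) / real n - a) \<le> 1 / real n"
    proof (intro eventually_sequentiallyI[of 1])
      fix n :: nat assume n: "1 \<le> n"
      have "real (nat \<lfloor>real n * a\<rfloor>) = real_of_int \<lfloor>real n * a\<rfloor>" using assms by simp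
      then have "\<bar>real (nat \<lfloor>real n * a\<rfloor>) - real n * a\<bar> \<le> 1" by linarith
      moreover have "real (nat \<lfloor>real n * a\<rfloor>) / real n - a = (real (nat \<lfloor>real n * a\<rfloor>) - real n * a) / real n"
        using n by (simp add: diff_divide_distrib)
      ultimately show "norm (real (nat \<lfloor>real n * a\<rfloor>) / real n - a) \<le> 1 / real n"
        using n by (simp add: abs_divide divide_right_mono)
    qed
  qed
  then show ?thesis by (simp add: LIM_zero_iff)
qed

lemma sum_upd_tail:
  fixes z :: "nat \<Rightarrow> 'v::comm_monoid_add"
  assumes "l < J"
  shows "(\<Sum>j\<in>{l<..J}. (z(J := z J + z (Suc J))) j) = (\<Sum>j\<in>{l<..Suc J}. z j)"
proof -
  have 1: "{l<..J} = insert J {l<..<J}" and 2: "{l<..Suc J} = insert (Suc J) (insert J {l<..<J})"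
    using assms by auto
  have "(\<Sum>j\<in>{l<..<J}. (z(J := z J + z (Suc J))) j) = (\<Sum>j\<in>{l<..<J}. z j)"
    by (rule sum.cong) auto
  then show ?thesis unfolding 1 2 by (simp add: ac_simps)
qed

lemma sum_upd_inner:
  fixes z y :: "nat \<Rightarrow> 'v::real_inner"
  shows "(\<Sum>j\<le>J. (z(J := z J + z (Suc J))) j \<bullet> y j) = (\<Sum>j\<le>J. z j \<bullet> y j) + z (Suc J) \<bullet> y J"
proof -
  have "(\<Sum>j<J. (z(J := z J + z (Suc J))) j \<bullet> y j) = (\<Sum>j<J. z j \<bullet> y j)"
    by (rule sum.cong) auto
  then show ?thesis by (simp add: lessThan_Suc_atMost[symmetric] inner_add_left)
qed

text \<open>Summation by parts writes the sum of z j times the positions at times j / D through the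
  increments, where the increment from l to l + 1 carries the sum of z j over l < j \<le> J. The
  formula is the product of the Gaussian factors of these increments of length 1 / D; z 0 is absent
  because the limit starts at 0.\<close>

definition gauss_char :: "(R2 \<Rightarrow> real) \<Rightarrow> real \<Rightarrow> nat \<Rightarrow> (nat \<Rightarrow> R2) \<Rightarrow> real" where
  "gauss_char q D J z = (\<Prod>l<J. exp (- (q (\<Sum>j\<in>{l<..J}. z j) * (1 / D) / 2)))"

lemma gauss_char_Suc:
  "gauss_char q D (Suc J) z = exp (- (q (z (Suc J)) * (1 / D) / 2)) * gauss_char q D J (z(J := z J + z (Suc J)))"
proof -
  have "{J<..Suc J} = {Suc J}" by auto
  moreover have "(\<Prod>l<J. exp (- (q (\<Sum>j\<in>{l<..Suc J}. z j) * (1 / D) / 2)))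
      = (\<Prod>l<J. exp (- (q (\<Sum>j\<in>{l<..J}. (z(J := z J + z (Suc J))) j) * (1 / D) / 2)))"
    by (rule prod.cong) (simp_all only: sum_upd_tail lessThan_iff)
  ultimately show ?thesis by (simp add: gauss_char_def mult.commute)
qed

locale perturbed_chain = perturbed_walk \<mu> K A C + chain M X K
  for \<mu> K A C M and X :: "nat \<Rightarrow> 'c \<Rightarrow> Z2"
begin

text \<open>Induction on the number of times. Given the past, the last increment has a
  characteristic function that is, uniformly in the current state, close to the constant e n; after
  this constant is taken out, the vector z (Suc J) acts on the position at time J and is added to z
  J.\<close>

lemma char_finite_dimensional:
  assumes D: "0 < D"
  shows "(\<lambda>n. \<integral>\<omega>. iexp (\<Sum>j\<le>J. z j \<bullet> ((1 / sqrt (real n)) *\<^sub>R rvec (X (nat \<lfloor>real n * (real j / D)\<rfloor>) \<omega>))) \<partial>M)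
    \<longlonglongrightarrow> of_real (gauss_char (qform \<mu>) D J z)"
proof (induction J arbitrary: z)
  case 0
  \<comment> \<open>The initial state has an arbitrary law, but it is divided by sqrt n; dominated
    convergence suffices.\<close>
  have "(\<lambda>n. \<integral>\<omega>. iexp (z 0 \<bullet> ((1 / sqrt (real n)) *\<^sub>R rvec (X 0 \<omega>))) \<partial>M) \<longlonglongrightarrow> (\<integral>\<omega>. 1 \<partial>M)"
  proof (rule integral_dominated_convergence[where w = "\<lambda>_. 1"])
    have "(\<lambda>n. 1 / sqrt (real n) * (z 0 \<bullet> rvec (X 0 \<omega>))) \<longlonglongrightarrow> 0" for \<omega>
      by (rule tendsto_mult_left_zero) real_asymp
    then have "(\<lambda>n. iexp (1 / sqrt (real n) * (z 0 \<bullet> rvec (X 0 \<omega>)))) \<longlonglongrightarrow> iexp 0" for \<omega>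
      by (intro tendsto_intros)
    then show "AE \<omega> in M. (\<lambda>n. iexp (z 0 \<bullet> ((1 / sqrt (real n)) *\<^sub>R rvec (X 0 \<omega>)))) \<longlonglongrightarrow> 1"
      by simp
    have "(\<lambda>x. iexp (z 0 \<bullet> ((1 / sqrt (real n)) *\<^sub>R rvec x))) \<in> borel_measurable (count_space UNIV)" for n by simp
    from measurable_compose[OF X_measurable this]
    show "(\<lambda>\<omega>. iexp (z 0 \<bullet> ((1 / sqrt (real n)) *\<^sub>R rvec (X 0 \<omega>)))) \<in> borel_measurable M" for n .
  qed simp_all
  then show ?case by (simp add: gauss_char_def prob_space)
next
  case (Suc J)
  define s where "s j n = nat \<lfloor>real n * (real j / D)\<rfloor>" for j n
  have s_mono: "s j n \<le> s j' n" if "j \<le> j'" for j j' n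
    unfolding s_def using that D by (intro nat_mono floor_mono mult_left_mono divide_right_mono) auto
  define y where "y n \<omega> j = (1 / sqrt (real n)) *\<^sub>R rvec (X (s j n) \<omega>)" for n \<omega> j
  define m where "m n = s (Suc J) n - s J n" for n
  define z' where "z' = z(J := z J + z (Suc J))"
  \<comment> \<open>Any integer bound for (J + 1) / D would do; it puts all step counts below T n,
    the range in which \<open>char_kpow\<close> is uniform.\<close>
  define T where "T = nat \<lceil>real (Suc J) / D\<rceil> + 1"
  have T: "0 < T" by (simp add: T_def)
  have mT: "m n \<le> T * n" for n
  proof -
    have "real (s (Suc J) n) \<le> real n * (real (Suc J) / D)"
      unfolding s_def using D by simp
    also have "\<dots> \<le> real n * real T"
      unfolding T_def by (intro mult_left_mono) linarith+
    finally have "s (Suc J) n \<le> T * n" by (simp only: of_nat_mult[symmetric] of_nat_le_iff mult.commute)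
    then show ?thesis by (simp add: m_def)
  qed
  define e where "e n = exp (- (qform \<mu> (z (Suc J)) * (real (m n) / real n) / 2))" for n
  have e: "e \<longlonglongrightarrow> exp (- (qform \<mu> (z (Suc J)) * (1 / D) / 2))"
  proof -
    have "(\<lambda>n. real (s (Suc J) n) / real n - real (s J n) / real n) \<longlonglongrightarrow> real (Suc J) / D - real J / D"
      unfolding s_def using D by (intro tendsto_diff nat_floor_div_tendsto) auto
    moreover have "real (s (Suc J) n) / real n - real (s J n) / real n = real (m n) / real n" for n
      unfolding m_def using s_mono[of J "Suc J" n] by (simp add: diff_divide_distrib)
    moreover have "real (Suc J) / D - real J / D = 1 / D" by (simp add: diff_divide_distrib[symmetric])
    ultimately have "(\<lambda>n. real (m n) / real n) \<longlonglongrightarrow> 1 / D" by simp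
    from tendsto_exp[OF tendsto_minus[OF tendsto_divide[OF tendsto_mult[OF tendsto_const this] tendsto_const]]]
    show ?thesis unfolding e_def by simp
  qed
  define E where "E n = (\<integral>\<omega>. iexp (\<Sum>j\<le>Suc J. z j \<bullet> y n \<omega> j) \<partial>M)" for n
  define E' where "E' n = (\<integral>\<omega>. iexp (\<Sum>j\<le>J. z' j \<bullet> y n \<omega> j) \<partial>M)" for n
  have E': "E' \<longlonglongrightarrow> of_real (gauss_char (qform \<mu>) D J z')"
    unfolding E'_def y_def s_def by (rule Suc.IH)
  have key: "norm (E n - of_real (e n) * E' n) \<le> total_err T n (z (Suc J))" if n: "2 \<le> n" for n
  proof -
    define F where "F l = iexp (\<Sum>j\<le>J. z j \<bullet> ((1 / sqrt (real n)) *\<^sub>R rvec (l ! s j n)))" for l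
    define \<theta> where "\<theta> = z (Suc J) /\<^sub>R sqrt (real n)"
    have F1: "norm (F l) \<le> 1" for l by (simp add: F_def)
    have Fh: "F (hist 0 (s J n) \<omega>) = iexp (\<Sum>j\<le>J. z j \<bullet> y n \<omega> j)" for \<omega>
    proof -
      have "hist 0 (s J n) \<omega> ! s j n = X (s j n) \<omega>" if "j \<le> J" for j
        using s_mono[OF that, of n] by (simp add: hist_def nth_map del: upt_Suc)
      then show ?thesis by (simp add: F_def y_def)
    qed
    have sm: "s J n + m n = s (Suc J) n" using s_mono[of J "Suc J" n] by (simp add: m_def)
    have th: "\<theta> \<bullet> rvec (X (s j n) \<omega>) = z (Suc J) \<bullet> y n \<omega> j" for j \<omega>
      by (simp add: \<theta>_def y_def inverse_eq_divide)
    have "E n = (\<integral>\<omega>. F (hist 0 (s J n) \<omega>) * iexp (\<theta> \<bullet> rvec (X (s J n + m n) \<omega>)) \<partial>M)"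
      unfolding E_def Fh sm th by (simp add: distrib_left exp_add)
    also have "\<dots> = (\<integral>\<omega>. F (hist 0 (s J n) \<omega>) * (\<integral>x. iexp (\<theta> \<bullet> rvec x) \<partial>measure_pmf (kpow K (m n) (X (s J n) \<omega>))) \<partial>M)"
      by (rule multi_step[OF F1]) simp
    also have "\<dots> = (\<integral>\<omega>. F (hist 0 (s J n) \<omega>) * (iexp (\<theta> \<bullet> rvec (X (s J n) \<omega>)) * pmf_char (kpow K (m n) (X (s J n) \<omega>)) (X (s J n) \<omega>) \<theta>) \<partial>M)"
      by (rule Bochner_Integration.integral_cong[OF refl], rule arg_cong[where f = "\<lambda>w. _ * w"], rule pmf_char_shift)
    finally have En: "E n = (\<integral>\<omega>. F (hist 0 (s J n) \<omega>) * (iexp (\<theta> \<bullet> rvec (X (s J n) \<omega>)) * pmf_char (kpow K (m n) (X (s J n) \<omega>)) (X (s J n) \<omega>) \<theta>) \<partial>M)" .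
    have E'n: "E' n = (\<integral>\<omega>. F (hist 0 (s J n) \<omega>) * iexp (\<theta> \<bullet> rvec (X (s J n) \<omega>)) \<partial>M)"
      unfolding E'_def z'_def sum_upd_inner Fh th by (simp add: distrib_left exp_add)
    define G where "G l = F l * (iexp (\<theta> \<bullet> rvec (last l)) * pmf_char (kpow K (m n) (last l)) (last l) \<theta>)" for l
    define H where "H l = of_real (e n) * (F l * iexp (\<theta> \<bullet> rvec (last l)))" for l
    have G1: "norm (G l) \<le> 1" for l
      by (simp add: G_def norm_mult F_def norm_pmf_char_le_1)
    have e1: "0 \<le> e n" "e n \<le> 1" by (simp_all add: e_def qform_nonneg)
    have H1: "norm (H l) \<le> 1" for l using e1 by (simp add: H_def norm_mult F_def)
    have l: "last (hist 0 (s J n) \<omega>) = X (s J n) \<omega>" for \<omega> using last_hist[of 0 "s J n" \<omega>] by simp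
    have GH: "norm (G l - H l) \<le> total_err T n (z (Suc J))" for l
    proof -
      have "G l - H l = F l * iexp (\<theta> \<bullet> rvec (last l)) * (pmf_char (kpow K (m n) (last l)) (last l) \<theta> - of_real (e n))"
        by (simp add: G_def H_def algebra_simps)
      then have "norm (G l - H l) = norm (pmf_char (kpow K (m n) (last l)) (last l) \<theta> - of_real (e n))"
        by (simp add: norm_mult F_def)
      also have "\<dots> \<le> total_err T n (z (Suc J))"
        unfolding \<theta>_def e_def by (rule char_kpow[OF n T mT])
      finally show ?thesis .
    qed
    have "E n - of_real (e n) * E' n = (\<integral>\<omega>. G (hist 0 (s J n) \<omega>) \<partial>M) - (\<integral>\<omega>. H (hist 0 (s J n) \<omega>) \<partial>M)"
      unfolding En E'n G_def H_def l by simp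
    also have "\<dots> = (\<integral>\<omega>. G (hist 0 (s J n) \<omega>) - H (hist 0 (s J n) \<omega>) \<partial>M)"
      by (rule Bochner_Integration.integral_diff[symmetric]) (rule integrable_hist[OF G1], rule integrable_hist[OF H1])
    also have "norm \<dots> \<le> (\<integral>\<omega>. norm (G (hist 0 (s J n) \<omega>) - H (hist 0 (s J n) \<omega>)) \<partial>M)"
      by (rule integral_norm_bound)
    also have "\<dots> \<le> total_err T n (z (Suc J))"
      by (rule integral_le_const)
         (use GH in \<open>auto intro!: integrable_norm Bochner_Integration.integrable_diff integrable_hist[OF G1] integrable_hist[OF H1]\<close>)
    finally show ?thesis .
  qed
  have "(\<lambda>n. E n - of_real (e n) * E' n) \<longlonglongrightarrow> 0"
    by (rule Lim_null_comparison[OF eventually_sequentiallyI[of 2] total_err_tendsto_0[OF T]]) (rule key)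
  moreover have "(\<lambda>n. of_real (e n) * E' n) \<longlonglongrightarrow> of_real (exp (- (qform \<mu> (z (Suc J)) * (1 / D) / 2))) * of_real (gauss_char (qform \<mu>) D J z')"
    by (intro tendsto_mult tendsto_of_real e E')
  ultimately have "(\<lambda>n. (E n - of_real (e n) * E' n) + of_real (e n) * E' n) \<longlonglongrightarrow>
      0 + of_real (exp (- (qform \<mu> (z (Suc J)) * (1 / D) / 2))) * of_real (gauss_char (qform \<mu>) D J z')"
    by (rule tendsto_add)
  then have "E \<longlonglongrightarrow> of_real (gauss_char (qform \<mu>) D (Suc J) z)"
    by (simp add: gauss_char_Suc z'_def)
  then show ?case by (simp only: E_def[abs_def] y_def s_def)
qed

end

text \<open>Summation by parts and independence of the increments factorize the expectation, and
  stationarity gives each factor the variance length 1 / D. The remaining term contains W 0, which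
  vanishes almost surely.\<close>

lemma wiener_char_finite_dimensional:
  assumes W: "wiener_process B W \<Gamma>" and D: "0 < D"
  shows "(\<integral>\<omega>. iexp (\<Sum>j\<le>J. z j \<bullet> W (real j / D) \<omega>) \<partial>B) = of_real (gauss_char (\<lambda>w. (\<Gamma> *v w) \<bullet> w) D J z)"
proof -
  interpret prob_space B using W by (simp add: wiener_process_def)
  define w where "w l = (\<Sum>j\<in>{l<..J}. z j)" for l
  define I where "I l \<omega> = W (real (Suc l) / D) \<omega> - W (real l / D) \<omega>" for l \<omega>
  have W0: "AE \<omega> in B. W 0 \<omega> = 0" and Wm: "\<And>t. 0 \<le> t \<Longrightarrow> W t \<in> borel_measurable B"
    and Wi: "\<And>s n. mono s \<Longrightarrow> 0 \<le> s (0::nat) \<Longrightarrow> indep_vars (\<lambda>_. borel) (\<lambda>i \<omega>. W (s (Suc i)) \<omega> - W (s i) \<omega>) {..<n}"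
    and Wd: "\<And>s t. 0 \<le> s \<Longrightarrow> s \<le> t \<Longrightarrow> distr B borel (\<lambda>\<omega>. W t \<omega> - W s \<omega>) = distr B borel (W (t - s))"
    and Wc: "\<And>t z. 0 \<le> t \<Longrightarrow> (\<integral>\<omega>. iexp (z \<bullet> W t \<omega>) \<partial>B) = of_real (exp (- (((\<Gamma> *v z) \<bullet> z) * t / 2)))"
    using W unfolding wiener_process_def by blast+
  have abel: "(\<Sum>j\<le>J. z j \<bullet> W (real j / D) \<omega>) = (\<Sum>j\<le>J. z j) \<bullet> W 0 \<omega> + (\<Sum>l<J. (\<Sum>j\<in>{l<..J}. z j) \<bullet> I l \<omega>)" for J z \<omega>
  proof (induction J arbitrary: z)
    case (Suc J)
    let ?z = "z(J := z J + z (Suc J))"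
    have "{J<..Suc J} = {Suc J}" by auto
    then have 1: "(\<Sum>l<Suc J. (\<Sum>j\<in>{l<..Suc J}. z j) \<bullet> I l \<omega>) = (\<Sum>l<J. (\<Sum>j\<in>{l<..J}. ?z j) \<bullet> I l \<omega>) + z (Suc J) \<bullet> I J \<omega>"
    proof -
      have "(\<Sum>l<J. (\<Sum>j\<in>{l<..Suc J}. z j) \<bullet> I l \<omega>) = (\<Sum>l<J. (\<Sum>j\<in>{l<..J}. ?z j) \<bullet> I l \<omega>)"
        by (rule sum.cong) (simp_all only: sum_upd_tail lessThan_iff)
      then show "{J<..Suc J} = {Suc J} \<Longrightarrow> ?thesis" by simp
    qed
    have 2: "(\<Sum>j\<le>Suc J. z j) = (\<Sum>j\<le>J. ?z j)"
    proof -
      have "(\<Sum>j<J. ?z j) = (\<Sum>j<J. z j)" by (rule sum.cong) auto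
      then show ?thesis by (simp add: lessThan_Suc_atMost[symmetric])
    qed
    have "(\<Sum>j\<le>Suc J. z j \<bullet> W (real j / D) \<omega>) = (\<Sum>j\<le>J. ?z j \<bullet> W (real j / D) \<omega>) + z (Suc J) \<bullet> I J \<omega>"
      using sum_upd_inner[of z J "\<lambda>j. W (real j / D) \<omega>"]
      by (simp add: I_def inner_diff_right del: fun_upd_apply)
    then show ?case unfolding 1 2 Suc.IH[of ?z] by simp
  qed simp
  have indep: "indep_vars (\<lambda>_. borel) I {..<J}"
  proof -
    have "mono (\<lambda>i. real i / D)" using D by (intro monoI divide_right_mono) auto
    from Wi[OF this, of J] show ?thesis by (simp add: I_def[abs_def])
  qed
  have indep': "indep_vars (\<lambda>_. borel) (\<lambda>l \<omega>. iexp (w l \<bullet> I l \<omega>)) {..<J}"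
    by (rule indep_vars_compose2[OF indep]) measurable
  have Im: "I l \<in> borel_measurable B" for l
    unfolding I_def[abs_def] using D by (intro borel_measurable_diff Wm) auto
  have single: "(\<integral>\<omega>. iexp (w l \<bullet> I l \<omega>) \<partial>B) = of_real (exp (- (((\<Gamma> *v w l) \<bullet> w l) * (1 / D) / 2)))" for l
  proof -
    have d: "distr B borel (I l) = distr B borel (W (1 / D))"
    proof -
      have "real (Suc l) / D - real l / D = 1 / D" by (simp add: diff_divide_distrib[symmetric])
      moreover have "distr B borel (I l) = distr B borel (W (real (Suc l) / D - real l / D))"
        unfolding I_def[abs_def] using D by (intro Wd) (auto simp: divide_right_mono)
      ultimately show ?thesis by simp
    qed
    have "(\<integral>\<omega>. iexp (w l \<bullet> I l \<omega>) \<partial>B) = (\<integral>x. iexp (w l \<bullet> x) \<partial>distr B borel (I l))"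
      by (rule integral_distr[symmetric, OF Im]) measurable
    also have "\<dots> = (\<integral>\<omega>. iexp (w l \<bullet> W (1 / D) \<omega>) \<partial>B)"
      unfolding d using D by (intro integral_distr Wm) (simp, measurable)
    finally show ?thesis using Wc[of "1 / D" "w l"] D by simp
  qed
  have "(\<integral>\<omega>. iexp (\<Sum>j\<le>J. z j \<bullet> W (real j / D) \<omega>) \<partial>B) = (\<integral>\<omega>. (\<Prod>l<J. iexp (w l \<bullet> I l \<omega>)) \<partial>B)"
  proof (rule integral_cong_AE)
    have [measurable]: "W (real j / D) \<in> borel_measurable B" for j using D by (intro Wm) auto
    show "(\<lambda>\<omega>. iexp (\<Sum>j\<le>J. z j \<bullet> W (real j / D) \<omega>)) \<in> borel_measurable B" by measurable
    show "(\<lambda>\<omega>. \<Prod>l<J. iexp (w l \<bullet> I l \<omega>)) \<in> borel_measurable B"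
      using Im by measurable
    from W0 show "AE \<omega> in B. iexp (\<Sum>j\<le>J. z j \<bullet> W (real j / D) \<omega>) = (\<Prod>l<J. iexp (w l \<bullet> I l \<omega>))"
    proof eventually_elim
      case (elim \<omega>)
      then show ?case unfolding abel w_def by (simp add: sum_distrib_left exp_sum)
    qed
  qed
  also have "\<dots> = (\<Prod>l<J. \<integral>\<omega>. iexp (w l \<bullet> I l \<omega>) \<partial>B)"
    by (rule indep_vars_lebesgue_integral[OF _ indep'])
       (use Im in \<open>auto intro!: integrable_const_bound[where B = 1]\<close>)
  also have "\<dots> = of_real (gauss_char (\<lambda>w. (\<Gamma> *v w) \<bullet> w) D J z)"
    unfolding single unfolding gauss_char_def w_def by (simp only: of_real_prod)
  finally show ?thesis .
qed

section \<open>The functional limit theorem\<close>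

lemma continuous_imp_cadlag:
  assumes e: "x \<in> extensional {0..}" and c: "continuous_on {0..} x"
  shows "x \<in> cadlag_space"
proof -
  have lim: "(x \<longlongrightarrow> x t) (at t within {0..})" if "0 \<le> t" for t
    using c that by (simp add: continuous_on_def)
  have "(x \<longlongrightarrow> x t) (at_right t)" if "0 \<le> t" for t
    by (rule tendsto_within_subset[OF lim[OF that]]) (use that in auto)
  moreover have "(x \<longlongrightarrow> x t) (at_left t)" if t: "0 < t" for t
  proof -
    have "at t within {0..} = at t" using t by (intro at_within_interior) (simp add: interior_Ici[of 0 _, OF _])
    then have "(x \<longlongrightarrow> x t) (at t)" using lim[of t] t by simp
    then show ?thesis by (rule tendsto_within_subset) auto
  qed
  ultimately show ?thesis using e by (auto simp: cadlag_space_def)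
qed

lemma sample_path_continuous: "continuous_on {0..} (\<lambda>t. W t \<omega>) \<Longrightarrow> continuous_on {0..} (sample_path W \<omega>)"
  unfolding sample_path_def by (rule continuous_on_eq) auto

lemma rescaled_path_cadlag: "rescaled_path X n \<omega> \<in> cadlag_space"
  unfolding rescaled_path_def
  using cadlag_step[of "real n" "\<lambda>k. (1 / sqrt (real n)) *\<^sub>R rvec (X k \<omega>)"] by simp

lemma rescaled_path_disc:
  "\<exists>\<sigma>. \<forall>\<omega>. (\<lambda>l. path_dist (disc (\<sigma> l) (rescaled_path X n \<omega>)) (rescaled_path X n \<omega>)) \<longlonglongrightarrow> 0"
proof (cases "n = 0")
  case True
  \<comment> \<open>For n = 0 the factor 1 / sqrt 0 is 0 by convention, so the path is
    constant.\<close>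
  then have "rescaled_path X n \<omega> = (\<lambda>t\<in>{0..}. 0)" for \<omega>
    by (simp add: rescaled_path_def)
  moreover have "continuous_on {0..} (\<lambda>t\<in>{0::real..}. 0 :: R2)"
    by (rule continuous_on_eq[OF continuous_on_const]) auto
  ultimately have "(\<lambda>l. path_dist (disc l (rescaled_path X n \<omega>)) (rescaled_path X n \<omega>)) \<longlonglongrightarrow> 0" for \<omega>
    using disc_tendsto_continuous by metis
  then show ?thesis by (intro exI[of _ "\<lambda>l. l"]) blast
next
  case False
  then show ?thesis
    unfolding rescaled_path_def
    using disc_tendsto_step[of n "\<lambda>k. (1 / sqrt (real n)) *\<^sub>R rvec (X k _)"] by (intro exI[of _ "\<lambda>l. n * l"]) blast
qed

text \<open>During one cell of length 1 / m^2 the chain makes at most n / m^2 steps up to rounding.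
  Rounding this quotient and the step numbers at both ends of the cell is covered by the two extra
  steps.\<close>

lemma path_dist_disc_rescaled:
  assumes n: "0 < n" and m: "0 < m"
    and good: "\<And>j k. j < m ^ 3 \<Longrightarrow> k \<le> n div m\<^sup>2 + 2 \<Longrightarrow>
      norm (rvec (X (nat \<lfloor>real n * (real j / (real m)\<^sup>2)\<rfloor> + k) \<omega> - X (nat \<lfloor>real n * (real j / (real m)\<^sup>2)\<rfloor>) \<omega>)) \<le> e * sqrt (real n)"
  shows "path_dist (disc m (rescaled_path X n \<omega>)) (rescaled_path X n \<omega>) \<le> max e (1 / (1 + real m))"
proof (rule path_dist_disc_le)
  fix t :: real assume t: "0 \<le> t" "t < real m"
  define j where "j = nat \<lfloor>(real m)\<^sup>2 * t\<rfloor>"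
  note gp = grid_point_bounds[OF t(1) m, folded j_def]
  define s where "s = nat \<lfloor>real n * (real j / (real m)\<^sup>2)\<rfloor>"
  define k where "k = nat \<lfloor>real n * t\<rfloor> - s"
  have j3: "j < m ^ 3"
  proof -
    have "(real m)\<^sup>2 * t < (real m)\<^sup>2 * real m" using t m by (intro mult_strict_left_mono) auto
    also have "\<dots> = real (m ^ 3)" by (simp add: power2_eq_square power3_eq_cube)
    finally have "\<lfloor>(real m)\<^sup>2 * t\<rfloor> < int (m ^ 3)" by (simp add: floor_less_iff)
    moreover have "0 \<le> \<lfloor>(real m)\<^sup>2 * t\<rfloor>" using t by simp
    ultimately show ?thesis unfolding j_def using nat_less_iff by blast
  qed
  have st: "s \<le> nat \<lfloor>real n * t\<rfloor>"
    unfolding s_def using gp(1) by (intro nat_mono floor_mono mult_left_mono) auto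
  have k: "k \<le> n div m\<^sup>2 + 2"
  proof -
    have "real n * t \<le> real n * ((real j + 1) / (real m)\<^sup>2)"
      using gp(2) by (intro mult_left_mono) auto
    also have "\<dots> = real n * (real j / (real m)\<^sup>2) + real n / real (m\<^sup>2)"
      by (simp add: add_divide_distrib distrib_left)
    also have "real n / real (m\<^sup>2) \<le> real (n div m\<^sup>2) + 1"
    proof -
      have "real_of_int \<lfloor>real n / real (m\<^sup>2)\<rfloor> = real (n div m\<^sup>2)" by (simp only: floor_divide_of_nat_eq of_int_of_nat_eq)
      then show ?thesis using floor_correct[of "real n / real (m\<^sup>2)"] by linarith
    qed
    finally have "real n * t \<le> real n * (real j / (real m)\<^sup>2) + (real (n div m\<^sup>2) + 1)" by simp
    then have "\<lfloor>real n * t\<rfloor> \<le> \<lfloor>real n * (real j / (real m)\<^sup>2)\<rfloor> + int (n div m\<^sup>2) + 2"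
      by linarith
    then show ?thesis unfolding k_def s_def by linarith
  qed
  have "dist (rescaled_path X n \<omega> (real j / (real m)\<^sup>2)) (rescaled_path X n \<omega> t)
      = norm ((1 / sqrt (real n)) *\<^sub>R rvec (X (s + k) \<omega> - X s \<omega>))"
    using t st by (simp add: rescaled_path_def dist_norm norm_minus_commute k_def s_def rvec_diff flip: scaleR_diff_right)
  also have "\<dots> = norm (rvec (X (s + k) \<omega> - X s \<omega>)) / sqrt (real n)" by simp
  also have "\<dots> \<le> e"
    using good[OF j3 k] n by (simp add: s_def pos_divide_le_eq)
  finally show "dist (rescaled_path X n \<omega> (real (nat \<lfloor>(real m)\<^sup>2 * t\<rfloor>) / (real m)\<^sup>2)) (rescaled_path X n \<omega> t) \<le> e"
    by (simp add: j_def)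
qed

section \<open>Displacements of the chain and the limit theorem\<close>

context perturbed_chain
begin

lemma rescaled_measurable: "(\<lambda>\<omega>. rescaled_path X n \<omega> t) \<in> borel_measurable M"
proof (cases "0 \<le> t")
  case True
  have "(\<lambda>x. (1 / sqrt (real n)) *\<^sub>R rvec x) \<in> borel_measurable (count_space UNIV)" by simp
  from measurable_compose[OF X_measurable this] True show ?thesis by (simp add: rescaled_path_def)
qed (simp add: rescaled_path_def)

lemma displacement_measurable:
  "{\<omega> \<in> space M. P (X s \<omega>) (X t \<omega>)} \<in> sets M"
proof -
  have 1: "(\<lambda>\<omega>. (X s \<omega>, X t \<omega>)) \<in> measurable M (count_space UNIV)"
    using measurable_Pair[OF X_measurable[of s] X_measurable[of t]] by (simp add: pair_measure_countable)
  have "{\<omega> \<in> space M. P (X s \<omega>) (X t \<omega>)} = (\<lambda>\<omega>. (X s \<omega>, X t \<omega>)) -` {(x, y). P x y} \<inter> space M" by auto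
  then show ?thesis using measurable_sets[OF 1, of "{(x, y). P x y}"] by simp
qed

lemma displacement_bound:
  "\<exists>c\<ge>0. \<forall>r>0. \<forall>T>0. \<exists>\<epsilon>. \<epsilon> \<longlonglongrightarrow> 0 \<and> (\<forall>n\<ge>2. \<forall>l\<le>T * n. \<forall>s.
    measure M {\<omega> \<in> space M. \<exists>k\<le>l. r * sqrt (real n) < norm (rvec (X (s + k) \<omega> - X s \<omega>))}
      \<le> c / r ^ 4 * (real l / real n)\<^sup>2 + \<epsilon> n)"
proof -
  obtain c where c: "0 \<le> c" and ex: "\<forall>r>0. \<forall>T>0. \<exists>\<epsilon>. \<epsilon> \<longlonglongrightarrow> 0 \<and> (\<forall>n\<ge>2. \<forall>m\<le>T * n. \<forall>x.
    exit_prob K (r * sqrt (real n)) x m x \<le> c / r ^ 4 * (real m / real n)\<^sup>2 + \<epsilon> n)"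
    using exit_prob_tail by (elim exE conjE) (rule that)
  show ?thesis
  proof (intro exI[of _ c] conjI c allI impI)
    fix r :: real and T :: nat assume r: "0 < r" and T: "0 < T"
    obtain \<epsilon> where e: "\<epsilon> \<longlonglongrightarrow> 0" "\<forall>n\<ge>2. \<forall>m\<le>T * n. \<forall>x.
      exit_prob K (r * sqrt (real n)) x m x \<le> c / r ^ 4 * (real m / real n)\<^sup>2 + \<epsilon> n"
      using ex[rule_format, OF r T] by (elim exE conjE) (rule that)
    show "\<exists>\<epsilon>. \<epsilon> \<longlonglongrightarrow> 0 \<and> (\<forall>n\<ge>2. \<forall>l\<le>T * n. \<forall>s.
      measure M {\<omega> \<in> space M. \<exists>k\<le>l. r * sqrt (real n) < norm (rvec (X (s + k) \<omega> - X s \<omega>))}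
        \<le> c / r ^ 4 * (real l / real n)\<^sup>2 + \<epsilon> n)"
      by (intro exI[of _ \<epsilon>] conjI e(1) allI impI chain_exit_le[OF chain_axioms] e(2)[rule_format])
  qed
qed

text \<open>All sampled times lie below T, so each position is the initial state plus a displacement
  within T n steps. The former is negligible at scale sqrt n, being a single random variable; the
  latter is controlled by the maximal estimate with r large. The threshold 2 r allots r to
  each.\<close>

lemma tight_finite_dimensional:
  assumes D: "0 < D" and e: "0 < e"
  shows "\<exists>R>0. \<forall>\<^sub>F n in sequentially.
    measure M {\<omega> \<in> space M. \<exists>j\<le>J. R < norm ((1 / sqrt (real n)) *\<^sub>R rvec (X (nat \<lfloor>real n * (real j / D)\<rfloor>) \<omega>))} \<le> e"
proof -
  obtain c where c: "0 \<le> c" and db: "\<forall>r>0. \<forall>T>0. \<exists>\<epsilon>. \<epsilon> \<longlonglongrightarrow> 0 \<and> (\<forall>n\<ge>2. \<forall>l\<le>T * n. \<forall>s.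
    measure M {\<omega> \<in> space M. \<exists>k\<le>l. r * sqrt (real n) < norm (rvec (X (s + k) \<omega> - X s \<omega>))}
      \<le> c / r ^ 4 * (real l / real n)\<^sup>2 + \<epsilon> n)"
    using displacement_bound by (elim exE conjE) (rule that)
  define T where "T = nat \<lceil>real J / D\<rceil> + 1"
  have T: "0 < T" by (simp add: T_def)
  have "((\<lambda>r::real. c / r ^ 4 * (real T)\<^sup>2) \<longlongrightarrow> 0) at_top"
    by real_asymp
  then have ev: "\<forall>\<^sub>F r in at_top. c / r ^ 4 * (real T)\<^sup>2 < e / 3 \<and> 0 < (r::real)"
    using e by (intro eventually_conj eventually_gt_at_top order_tendstoD) auto
  obtain r where r: "c / r ^ 4 * (real T)\<^sup>2 < e / 3" "0 < r"
    using eventually_happens[OF ev] by auto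
  obtain \<epsilon> where \<epsilon>: "\<epsilon> \<longlonglongrightarrow> 0" and dbn: "\<forall>n\<ge>2. \<forall>l\<le>T * n. \<forall>s.
    measure M {\<omega> \<in> space M. \<exists>k\<le>l. r * sqrt (real n) < norm (rvec (X (s + k) \<omega> - X s \<omega>))}
      \<le> c / r ^ 4 * (real l / real n)\<^sup>2 + \<epsilon> n"
    using db[rule_format, OF r(2) T] by (elim exE conjE) (rule that)
  have "(\<lambda>\<omega>. norm (rvec (X 0 \<omega>))) \<in> borel_measurable M"
    using measurable_compose[OF X_measurable[of 0], of "\<lambda>x. norm (rvec x)" borel] by simp
  from tight_single[OF prob_space_axioms this, of "e / 3"] e
  obtain R0 where R0: "0 < R0" "measure M {\<omega> \<in> space M. R0 < norm (rvec (X 0 \<omega>))} \<le> e / 3"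
    by auto
  have "\<forall>\<^sub>F n in sequentially. \<epsilon> n < e / 3" using \<epsilon> e by (intro order_tendstoD) auto
  moreover have "\<forall>\<^sub>F n::nat in sequentially. R0 < r * sqrt (real n)"
  proof -
    have "filterlim (\<lambda>n::nat. r * sqrt (real n)) at_top sequentially" using r(2) by real_asymp
    then show ?thesis by (simp add: filterlim_at_top_dense)
  qed
  ultimately have "\<forall>\<^sub>F n in sequentially.
    measure M {\<omega> \<in> space M. \<exists>j\<le>J. 2 * r < norm ((1 / sqrt (real n)) *\<^sub>R rvec (X (nat \<lfloor>real n * (real j / D)\<rfloor>) \<omega>))} \<le> e"
    using eventually_ge_at_top[of 2]
  proof eventually_elim
    case (elim n)
    let ?B0 = "{\<omega> \<in> space M. R0 < norm (rvec (X 0 \<omega>))}"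
    let ?B1 = "{\<omega> \<in> space M. \<exists>k\<le>T * n. r * sqrt (real n) < norm (rvec (X (0 + k) \<omega> - X 0 \<omega>))}"
    have B0: "?B0 \<in> sets M" by (rule displacement_measurable[of "\<lambda>x _. R0 < norm (rvec x)" 0 0])
    have B1: "?B1 \<in> sets M"
    proof -
      have "?B1 = (\<Union>k\<le>T * n. {\<omega> \<in> space M. r * sqrt (real n) < norm (rvec (X k \<omega> - X 0 \<omega>))})" by auto
      also have "\<dots> \<in> sets M"
        by (intro sets.finite_UN) (auto intro: displacement_measurable[of "\<lambda>x y. r * sqrt (real n) < norm (rvec (y - x))" 0])
      finally show ?thesis .
    qed
    have "{\<omega> \<in> space M. \<exists>j\<le>J. 2 * r < norm ((1 / sqrt (real n)) *\<^sub>R rvec (X (nat \<lfloor>real n * (real j / D)\<rfloor>) \<omega>))} \<subseteq> ?B0 \<union> ?B1"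
    proof
      fix \<omega> assume "\<omega> \<in> {\<omega> \<in> space M. \<exists>j\<le>J. 2 * r < norm ((1 / sqrt (real n)) *\<^sub>R rvec (X (nat \<lfloor>real n * (real j / D)\<rfloor>) \<omega>))}"
      then obtain j where j: "\<omega> \<in> space M" "j \<le> J" "2 * r < norm ((1 / sqrt (real n)) *\<^sub>R rvec (X (nat \<lfloor>real n * (real j / D)\<rfloor>) \<omega>))"
        by blast
      let ?k = "nat \<lfloor>real n * (real j / D)\<rfloor>"
      have kT: "?k \<le> T * n"
      proof -
        have "real ?k \<le> real n * (real j / D)" using D by simp
        also have "\<dots> \<le> real n * (real J / D)" using j(2) D by (intro mult_left_mono divide_right_mono) auto
        also have "\<dots> \<le> real n * real T" unfolding T_def by (intro mult_left_mono) linarith+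
        finally show ?thesis by (simp only: of_nat_mult[symmetric] of_nat_le_iff mult.commute)
      qed
      have "2 * (r * sqrt (real n)) < norm (rvec (X ?k \<omega>))"
        using j(3) elim(3) by (simp add: pos_less_divide_eq)
      moreover have "norm (rvec (X ?k \<omega>)) \<le> norm (rvec (X ?k \<omega> - X 0 \<omega>)) + norm (rvec (X 0 \<omega>))"
        using norm_triangle_ineq[of "rvec (X ?k \<omega> - X 0 \<omega>)" "rvec (X 0 \<omega>)"] by (simp add: rvec_diff)
      ultimately have "r * sqrt (real n) < norm (rvec (X 0 \<omega>)) \<or> r * sqrt (real n) < norm (rvec (X ?k \<omega> - X 0 \<omega>))"
        by linarith
      then show "\<omega> \<in> ?B0 \<union> ?B1" using j(1) kT elim(2) by auto
    qed
    then have "measure M {\<omega> \<in> space M. \<exists>j\<le>J. 2 * r < norm ((1 / sqrt (real n)) *\<^sub>R rvec (X (nat \<lfloor>real n * (real j / D)\<rfloor>) \<omega>))} \<le> measure M (?B0 \<union> ?B1)"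
      using B0 B1 by (intro finite_measure_mono) auto
    also have "\<dots> \<le> measure M ?B0 + measure M ?B1" by (rule measure_Un_le[OF B0 B1])
    also have "measure M ?B1 \<le> c / r ^ 4 * (real (T * n) / real n)\<^sup>2 + \<epsilon> n"
      using dbn[rule_format, OF elim(3) order_refl, of 0] .
    also have "real (T * n) / real n = real T" using elim(3) by simp
    finally show ?case using R0(2) r(1) elim(1) by linarith
  qed
  then show ?thesis using r(2) by (intro exI[of _ "2 * r"]) auto
qed

text \<open>The mesh parameter m is fixed before n tends to infinity. It makes the discretization of
  the Wiener path accurate by continuity and that of the rescaled chain accurate, for all large n,
  outside a rare event where some cell has a large displacement; the two discretized paths are
  compared through finite-dimensional distributions.\<close>

lemma functional_limit:
  fixes B :: "'d measure" and W :: "real \<Rightarrow> 'd \<Rightarrow> R2"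
  assumes W: "wiener_process B W \<Gamma>" and \<Gamma>: "\<And>z. (\<Gamma> *v z) \<bullet> z = qform \<mu> z"
  shows "converges_weakly j1_topology M (rescaled_path X) B (sample_path W)"
proof -
  interpret B: prob_space B using W by (simp add: wiener_process_def)
  have W1: "\<forall>\<omega>\<in>space B. continuous_on {0..} (\<lambda>t. W t \<omega>)"
    using W unfolding wiener_process_def by (elim conjE)
  have W2: "\<forall>t\<ge>0. W t \<in> borel_measurable B"
    using W unfolding wiener_process_def by (elim conjE)
  have Wcont: "continuous_on {0..} (sample_path W \<omega>)" if "\<omega> \<in> space B" for \<omega>
    using W1 that by (intro sample_path_continuous) blast
  have Wcad: "sample_path W \<omega> \<in> cadlag_space" if "\<omega> \<in> space B" for \<omega>
    using Wcont[OF that] by (intro continuous_imp_cadlag) (auto simp: sample_path_def)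
  have Wm: "(\<lambda>\<omega>. sample_path W \<omega> t) \<in> borel_measurable B" if "0 \<le> t" for t
    using W2 that by (simp add: sample_path_def)
  have XM: "(\<lambda>\<omega>. g (rescaled_path X n \<omega>)) \<in> borel_measurable M" if g: "path_lipschitz g" for g n
  proof -
    obtain \<sigma> where \<sigma>: "\<And>\<omega>. (\<lambda>l. path_dist (disc (\<sigma> l) (rescaled_path X n \<omega>)) (rescaled_path X n \<omega>)) \<longlonglongrightarrow> 0"
      using rescaled_path_disc by blast
    show ?thesis
      by (rule measurable_path_functional[OF g rescaled_measurable rescaled_path_cadlag \<sigma>])
  qed
  have WM: "(\<lambda>\<omega>. g (sample_path W \<omega>)) \<in> borel_measurable B" if g: "path_lipschitz g" for g
    by (rule measurable_path_functional[OF g Wm Wcad, where \<sigma> = "\<lambda>l. l"]) (auto intro: disc_tendsto_continuous Wcont)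
  obtain c where c: "0 \<le> c" and db: "\<forall>r>0. \<forall>T>0. \<exists>\<epsilon>. \<epsilon> \<longlonglongrightarrow> 0 \<and> (\<forall>n\<ge>2. \<forall>l\<le>T * n. \<forall>s.
    measure M {\<omega> \<in> space M. \<exists>k\<le>l. r * sqrt (real n) < norm (rvec (X (s + k) \<omega> - X s \<omega>))}
      \<le> c / r ^ 4 * (real l / real n)\<^sup>2 + \<epsilon> n)"
    using displacement_bound by (elim exE conjE) (rule that)
  show ?thesis
  proof (rule converges_weakly_from_lipschitz[where Y = "rescaled_path X" and Z = "sample_path W", OF prob_space_axioms B.prob_space_axioms rescaled_path_cadlag Wcad XM WM])
    fix g :: "(real \<Rightarrow> R2) \<Rightarrow> real" assume g: "path_lipschitz g"
    obtain L where L: "0 \<le> L" "\<And>x y. x \<in> cadlag_space \<Longrightarrow> y \<in> cadlag_space \<Longrightarrow> \<bar>g x - g y\<bar> \<le> L * path_dist x y"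
      using g unfolding path_lipschitz_def by blast
    obtain Q where Q: "\<And>x. x \<in> cadlag_space \<Longrightarrow> \<bar>g x\<bar> \<le> Q"
      using g unfolding path_lipschitz_def by blast
    have Q0: "0 \<le> Q" using Q[OF const_cadlag[of 0]] by linarith
    have gXi: "integrable M (\<lambda>\<omega>. g (rescaled_path X n \<omega>))" for n
      by (rule integrable_const_bound[where B = Q]) (auto intro: Q rescaled_path_cadlag XM[OF g])
    have dXm: "(\<lambda>\<omega>. g (disc m (rescaled_path X n \<omega>))) \<in> borel_measurable M" for m n
      by (rule measurable_disc_functional[OF g rescaled_measurable])
    have dXi: "integrable M (\<lambda>\<omega>. g (disc m (rescaled_path X n \<omega>)))" for m n
      by (rule integrable_const_bound[where B = Q]) (auto intro: Q disc_cadlag dXm)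
    have dWm: "(\<lambda>\<omega>. g (disc m (sample_path W \<omega>))) \<in> borel_measurable B" for m
      by (rule measurable_disc_functional[OF g Wm])
    have W_lim: "(\<lambda>m. \<integral>\<omega>. g (disc m (sample_path W \<omega>)) \<partial>B) \<longlonglongrightarrow> (\<integral>\<omega>. g (sample_path W \<omega>) \<partial>B)"
    proof (rule integral_dominated_convergence[where w = "\<lambda>_. Q"])
      show "AE \<omega> in B. (\<lambda>m. g (disc m (sample_path W \<omega>))) \<longlonglongrightarrow> g (sample_path W \<omega>)"
      proof (rule AE_I2)
        fix \<omega> assume \<omega>: "\<omega> \<in> space B"
        have "(\<lambda>m. g (disc m (sample_path W \<omega>)) - g (sample_path W \<omega>)) \<longlonglongrightarrow> 0"
        proof (rule Lim_null_comparison)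
          show "(\<lambda>m. L * path_dist (disc m (sample_path W \<omega>)) (sample_path W \<omega>)) \<longlonglongrightarrow> 0"
            by (rule tendsto_mult_right_zero[OF disc_tendsto_continuous[OF Wcont[OF \<omega>]]])
          show "\<forall>\<^sub>F m in sequentially. norm (g (disc m (sample_path W \<omega>)) - g (sample_path W \<omega>)) \<le> L * path_dist (disc m (sample_path W \<omega>)) (sample_path W \<omega>)"
            using L(2)[OF disc_cadlag Wcad[OF \<omega>]] by (intro always_eventually) simp
        qed
        then show "(\<lambda>m. g (disc m (sample_path W \<omega>))) \<longlonglongrightarrow> g (sample_path W \<omega>)" by (simp add: LIM_zero_iff)
      qed
    qed (auto intro!: AE_I2 Q disc_cadlag dWm WM[OF g])
    have fdd: "(\<lambda>n. \<integral>\<omega>. g (disc m (rescaled_path X n \<omega>)) \<partial>M) \<longlonglongrightarrow> (\<integral>\<omega>. g (disc m (sample_path W \<omega>)) \<partial>B)"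
      if m: "0 < m" for m
    proof -
      define D where "D = (real m)\<^sup>2"
      have D: "0 < D" using m by (simp add: D_def)
      define Y where "Y n \<omega> j = (1 / sqrt (real n)) *\<^sub>R rvec (X (nat \<lfloor>real n * (real j / D)\<rfloor>) \<omega>)" for n \<omega> j
      define Z where "Z \<omega> j = W (real j / D) \<omega>" for \<omega> j
      define h where "h v = g (step_path D (m ^ 3) v)" for v
      have Yr: "Y n \<omega> j = rescaled_path X n \<omega> (real j / D)" for n \<omega> j
        using D by (simp add: Y_def rescaled_path_def)
      have Zr: "Z \<omega> j = sample_path W \<omega> (real j / D)" for \<omega> j
        using D by (simp add: Z_def sample_path_def)
      have "(\<lambda>n. \<integral>\<omega>. h (Y n \<omega>) \<partial>M) \<longlonglongrightarrow> (\<integral>\<omega>. h (Z \<omega>) \<partial>B)"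
      proof (rule weak_convergence_from_char[OF prob_space_axioms B.prob_space_axioms, where J = "m ^ 3" and C = Q])
        show "(\<lambda>\<omega>. Y n \<omega> j) \<in> borel_measurable M" for n j unfolding Yr by (rule rescaled_measurable)
        show "(\<lambda>\<omega>. Z \<omega> j) \<in> borel_measurable B" for j unfolding Zr using D by (intro Wm) simp
        show "(\<lambda>n. \<integral>\<omega>. iexp (\<Sum>j\<le>m ^ 3. z j \<bullet> Y n \<omega> j) \<partial>M) \<longlonglongrightarrow> (\<integral>\<omega>. iexp (\<Sum>j\<le>m ^ 3. z j \<bullet> Z \<omega> j) \<partial>B)" for z
          unfolding Y_def Z_def wiener_char_finite_dimensional[OF W D] \<Gamma> by (rule char_finite_dimensional[OF D])
        show "continuous_on UNIV h" unfolding h_def[abs_def] using D by (intro continuous_step_functional[OF g]) simp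
        show "\<bar>h v\<bar> \<le> Q" for v unfolding h_def using D by (intro Q step_path_cadlag) simp
        show "h v = h (\<lambda>j. if j \<le> m ^ 3 then v j else 0)" for v
          unfolding h_def by (rule arg_cong[where f = g], rule step_path_cong) simp
        show "\<exists>R>0. \<forall>\<^sub>F n in sequentially. measure M {\<omega> \<in> space M. \<exists>j\<le>m ^ 3. R < norm (Y n \<omega> j)} \<le> e" if "0 < e" for e
          unfolding Y_def by (rule tight_finite_dimensional[OF D that])
      qed
      then show ?thesis by (simp add: h_def disc_def Yr[abs_def] Zr[abs_def] D_def)
    qed
    show "(\<lambda>n. \<integral>\<omega>. g (rescaled_path X n \<omega>) \<partial>M) \<longlonglongrightarrow> (\<integral>\<omega>. g (sample_path W \<omega>) \<partial>B)"
    proof (rule LIMSEQ_I)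
      fix r :: real assume r: "0 < r"
      \<comment> \<open>Five errors below or at r' arise: discretizing the chain on good outcomes,
        the two parts of the bound on bad outcomes, the finite-dimensional comparison, and
        discretizing the Wiener path.\<close>
      define r' where "r' = r / 6"
      have r': "0 < r'" using r by (simp add: r'_def)
      \<comment> \<open>The denominator is L + 1 because the Lipschitz constant may be 0.\<close>
      define e where "e = r' / (L + 1)"
      have e: "0 < e" using r' L(1) by (simp add: e_def)
      have Le: "L * e \<le> r'"
      proof -
        have "L * e \<le> (L + 1) * e" using e by simp
        also have "\<dots> = r'" using L(1) by (simp add: e_def)
        finally show ?thesis .
      qed
      have "(\<lambda>m. L * (1 / (1 + real m))) \<longlonglongrightarrow> 0" by real_asymp
      then have ev1: "\<forall>\<^sub>F m in sequentially. L * (1 / (1 + real m)) < r'" using r' by (intro order_tendstoD) auto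
      have "(\<lambda>m. 2 * Q * (4 * c / e ^ 4) * (1 / real m)) \<longlonglongrightarrow> 0" by (rule tendsto_mult_right_zero) real_asymp
      then have ev2: "\<forall>\<^sub>F m in sequentially. 2 * Q * (4 * c / e ^ 4) * (1 / real m) < r'" using r' by (intro order_tendstoD) auto
      have ev3: "\<forall>\<^sub>F m in sequentially. \<bar>(\<integral>\<omega>. g (disc m (sample_path W \<omega>)) \<partial>B) - (\<integral>\<omega>. g (sample_path W \<omega>) \<partial>B)\<bar> < r'"
        using tendstoD[OF W_lim r'] by (simp add: dist_real_def)
      have "\<forall>\<^sub>F m in sequentially. 0 < m \<and> L * (1 / (1 + real m)) < r' \<and> 2 * Q * (4 * c / e ^ 4) * (1 / real m) < r'
         \<and> \<bar>(\<integral>\<omega>. g (disc m (sample_path W \<omega>)) \<partial>B) - (\<integral>\<omega>. g (sample_path W \<omega>) \<partial>B)\<bar> < r'"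
        by (intro eventually_conj eventually_gt_at_top ev1 ev2 ev3)
      then obtain m where m: "0 < m" "L * (1 / (1 + real m)) < r'" "2 * Q * (4 * c / e ^ 4) * (1 / real m) < r'"
         "\<bar>(\<integral>\<omega>. g (disc m (sample_path W \<omega>)) \<partial>B) - (\<integral>\<omega>. g (sample_path W \<omega>) \<partial>B)\<bar> < r'"
        by (metis (mono_tags, lifting) eventually_happens' sequentially_bot)
      obtain \<epsilon> where \<epsilon>: "\<epsilon> \<longlonglongrightarrow> 0" and dbn: "\<forall>n\<ge>2. \<forall>l\<le>2 * n. \<forall>s.
        measure M {\<omega> \<in> space M. \<exists>k\<le>l. e * sqrt (real n) < norm (rvec (X (s + k) \<omega> - X s \<omega>))}
          \<le> c / e ^ 4 * (real l / real n)\<^sup>2 + \<epsilon> n"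
        using db[rule_format, OF e pos2] by (elim exE conjE) (rule that)
      have "(\<lambda>n. 2 * Q * real (m ^ 3) * \<epsilon> n) \<longlonglongrightarrow> 0" by (rule tendsto_mult_right_zero[OF \<epsilon>])
      then have ev4: "\<forall>\<^sub>F n in sequentially. 2 * Q * real (m ^ 3) * \<epsilon> n < r'" using r' by (intro order_tendstoD) auto
      have ev5: "\<forall>\<^sub>F n in sequentially. \<bar>(\<integral>\<omega>. g (disc m (rescaled_path X n \<omega>)) \<partial>M) - (\<integral>\<omega>. g (disc m (sample_path W \<omega>)) \<partial>B)\<bar> < r'"
        using tendstoD[OF fdd[OF m(1)] r'] by (simp add: dist_real_def)
      have "\<forall>\<^sub>F n in sequentially. norm ((\<integral>\<omega>. g (rescaled_path X n \<omega>) \<partial>M) - (\<integral>\<omega>. g (sample_path W \<omega>) \<partial>B)) < r"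
        using ev4 ev5 eventually_ge_at_top[of "2 * m\<^sup>2 + 2"]
      proof eventually_elim
        case (elim n)
        have n2: "2 \<le> n" and n0: "0 < n" and nm: "2 * m\<^sup>2 \<le> n" using elim(3) by auto
        define l where "l = n div m\<^sup>2 + 2"
        define s where "s j = nat \<lfloor>real n * (real j / (real m)\<^sup>2)\<rfloor>" for j
        define E where "E j = {\<omega> \<in> space M. \<exists>k\<le>l. e * sqrt (real n) < norm (rvec (X (s j + k) \<omega> - X (s j) \<omega>))}" for j
        define bad where "bad = (\<Union>j<m ^ 3. E j)"
        have E_sets: "E j \<in> sets M" for j
        proof -
          have "E j = (\<Union>k\<le>l. {\<omega> \<in> space M. e * sqrt (real n) < norm (rvec (X (s j + k) \<omega> - X (s j) \<omega>))})"
            unfolding E_def by auto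
          also have "\<dots> \<in> sets M"
            by (intro sets.finite_UN) (auto intro: displacement_measurable[of "\<lambda>x y. e * sqrt (real n) < norm (rvec (y - x))"])
          finally show ?thesis .
        qed
        then have bad_sets: "bad \<in> sets M" unfolding bad_def by auto
        \<comment> \<open>As n \<ge> 2 m^2, the two rounding steps in l amount to at most n / m^2,
          the number of steps in a cell.\<close>
        have l_le: "real l / real n \<le> 2 / (real m)\<^sup>2"
        proof -
          have "real_of_int \<lfloor>real n / real (m\<^sup>2)\<rfloor> = real (n div m\<^sup>2)"
            by (simp only: floor_divide_of_nat_eq of_int_of_nat_eq)
          then have "real (n div m\<^sup>2) \<le> real n / real (m\<^sup>2)"
            using of_int_floor_le[of "real n / real (m\<^sup>2)"] by linarith
          then have "real l \<le> real n / (real m)\<^sup>2 + 2" unfolding l_def by simp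
          also have "2 \<le> real n / (real m)\<^sup>2"
          proof -
            have "real (2 * m\<^sup>2) \<le> real n" using nm by (simp only: of_nat_le_iff)
            then show ?thesis using m(1) by (simp add: pos_le_divide_eq)
          qed
          finally have "real l \<le> real n / (real m)\<^sup>2 + real n / (real m)\<^sup>2" by simp
          also have "\<dots> = 2 / (real m)\<^sup>2 * real n" by simp
          finally show ?thesis using n0 by (simp only: pos_divide_le_eq of_nat_0_less_iff)
        qed
        have l2: "l \<le> 2 * n"
        proof -
          have "n div m\<^sup>2 \<le> n" by (rule div_le_dividend)
          then show ?thesis unfolding l_def using n2 by linarith
        qed
        have "measure M bad \<le> (\<Sum>j<m ^ 3. measure M (E j))"
          unfolding bad_def using E_sets by (intro finite_measure_subadditive_finite) auto
        also have "\<dots> \<le> (\<Sum>j<m ^ 3. c / e ^ 4 * (2 / (real m)\<^sup>2)\<^sup>2 + \<epsilon> n)"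
        proof (rule sum_mono)
          fix j
          have "measure M (E j) \<le> c / e ^ 4 * (real l / real n)\<^sup>2 + \<epsilon> n"
            unfolding E_def by (rule dbn[rule_format, OF n2 l2])
          also have "c / e ^ 4 * (real l / real n)\<^sup>2 \<le> c / e ^ 4 * (2 / (real m)\<^sup>2)\<^sup>2"
            using l_le c e by (intro mult_left_mono power_mono) auto
          finally show "measure M (E j) \<le> c / e ^ 4 * (2 / (real m)\<^sup>2)\<^sup>2 + \<epsilon> n" by simp
        qed
        also have "\<dots> = 4 * c / e ^ 4 * (1 / real m) + real (m ^ 3) * \<epsilon> n"
          using m(1) by (simp add: field_simps power2_eq_square power3_eq_cube)
        finally have "2 * Q * measure M bad \<le> 2 * Q * (4 * c / e ^ 4 * (1 / real m) + real (m ^ 3) * \<epsilon> n)"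
          using Q0 by (intro mult_left_mono) auto
        also have "\<dots> = 2 * Q * (4 * c / e ^ 4) * (1 / real m) + 2 * Q * real (m ^ 3) * \<epsilon> n"
          by (simp only: distrib_left mult.assoc)
        finally have P_bad: "2 * Q * measure M bad \<le> 2 * Q * (4 * c / e ^ 4) * (1 / real m) + 2 * Q * real (m ^ 3) * \<epsilon> n" .
        have pt: "\<bar>g (rescaled_path X n \<omega>) - g (disc m (rescaled_path X n \<omega>))\<bar> \<le> r' + 2 * Q * indicator bad \<omega>"
          if \<omega>: "\<omega> \<in> space M" for \<omega>
        proof (cases "\<omega> \<in> bad")
          case True
          then show ?thesis using Q[OF rescaled_path_cadlag[of X n \<omega>]] Q[OF disc_cadlag[of m "rescaled_path X n \<omega>"]] r' by simp
        next
          case False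
          have "path_dist (disc m (rescaled_path X n \<omega>)) (rescaled_path X n \<omega>) \<le> max e (1 / (1 + real m))"
          proof (rule path_dist_disc_rescaled[OF n0 m(1)])
            fix j k assume "j < m ^ 3" "k \<le> n div m\<^sup>2 + 2"
            then show "norm (rvec (X (nat \<lfloor>real n * (real j / (real m)\<^sup>2)\<rfloor> + k) \<omega> - X (nat \<lfloor>real n * (real j / (real m)\<^sup>2)\<rfloor>) \<omega>)) \<le> e * sqrt (real n)"
              using False \<omega> unfolding bad_def E_def s_def l_def by (auto simp: not_less)
          qed
          then have "L * path_dist (disc m (rescaled_path X n \<omega>)) (rescaled_path X n \<omega>) \<le> L * max e (1 / (1 + real m))"
            using L(1) by (rule mult_left_mono)
          also have "\<dots> \<le> r'" using Le m(2) by (auto simp: max_def)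
          finally have "L * path_dist (disc m (rescaled_path X n \<omega>)) (rescaled_path X n \<omega>) \<le> r'" .
          moreover have "\<bar>g (disc m (rescaled_path X n \<omega>)) - g (rescaled_path X n \<omega>)\<bar> \<le> L * path_dist (disc m (rescaled_path X n \<omega>)) (rescaled_path X n \<omega>)"
            by (rule L(2)[OF disc_cadlag rescaled_path_cadlag])
          ultimately show ?thesis using False by simp
        qed
        have ib: "integrable M (\<lambda>\<omega>. 2 * Q * indicator bad \<omega>)"
          by (rule integrable_mult_right, rule integrable_const_bound[where B = 1, OF _ borel_measurable_indicator[OF bad_sets]])
             (intro AE_I2, simp add: indicator_def)
        have "\<bar>(\<integral>\<omega>. g (rescaled_path X n \<omega>) \<partial>M) - (\<integral>\<omega>. g (disc m (rescaled_path X n \<omega>)) \<partial>M)\<bar>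
           = \<bar>\<integral>\<omega>. g (rescaled_path X n \<omega>) - g (disc m (rescaled_path X n \<omega>)) \<partial>M\<bar>"
          by (simp only: Bochner_Integration.integral_diff[OF gXi dXi])
        also have "\<dots> \<le> (\<integral>\<omega>. \<bar>g (rescaled_path X n \<omega>) - g (disc m (rescaled_path X n \<omega>))\<bar> \<partial>M)"
          by (rule integral_abs_bound)
        also have "\<dots> \<le> (\<integral>\<omega>. r' + 2 * Q * indicator bad \<omega> \<partial>M)"
          by (rule integral_mono[OF _ _ pt])
             (rule integrable_abs[OF Bochner_Integration.integrable_diff[OF gXi dXi]],
              rule Bochner_Integration.integrable_add[OF integrable_const ib])
        also have "\<dots> = r' + 2 * Q * measure M bad"
          by (subst Bochner_Integration.integral_add[OF integrable_const ib]) (simp add: prob_space bad_sets)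
        finally have "\<bar>(\<integral>\<omega>. g (rescaled_path X n \<omega>) \<partial>M) - (\<integral>\<omega>. g (disc m (rescaled_path X n \<omega>)) \<partial>M)\<bar> \<le> r' + 2 * Q * measure M bad" .
        then show ?case unfolding real_norm_def using P_bad m(3,4) elim(1,2) r'_def r by linarith
      qed
      then show "\<exists>N. \<forall>n\<ge>N. norm ((\<integral>\<omega>. g (rescaled_path X n \<omega>) \<partial>M) - (\<integral>\<omega>. g (sample_path W \<omega>) \<partial>B)) < r"
        by (simp add: eventually_sequentially)
    qed
  qed
qed

end

section \<open>Nondegeneracy and the hypotheses on the perturbed walk\<close>

text \<open>A nonzero infinite sum has a nonzero term, whether or not summability is known; that
  term provides the intermediate state.\<close>

lemma n_step_pos_imp_set_pmf:
  assumes "0 < n_step (\<lambda>x y. pmf (K x) y) n x y"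
  shows "y \<in> set_pmf (kpow K n x)"
  using assms
proof (induction n arbitrary: x)
  case 0
  then show ?case by (simp split: if_splits)
next
  case (Suc n)
  have nonneg: "0 \<le> n_step (\<lambda>x y. pmf (K x) y) k z y" for k z
    by (induction k arbitrary: z) (auto intro!: infsum_nonneg)
  have "\<exists>z. pmf (K x) z * n_step (\<lambda>x y. pmf (K x) y) n z y \<noteq> 0"
  proof (rule ccontr)
    assume "\<not> ?thesis"
    then have "n_step (\<lambda>x y. pmf (K x) y) (Suc n) x y = 0" by (auto intro!: infsum_0)
    with Suc.prems show False by simp
  qed
  then obtain z where "pmf (K x) z \<noteq> 0" "n_step (\<lambda>x y. pmf (K x) y) n z y \<noteq> 0" by auto
  then have "z \<in> set_pmf (K x)" "y \<in> set_pmf (kpow K n z)"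
    using Suc.IH[of z] nonneg[of n z] by (auto simp: set_pmf_iff)
  then show ?case by auto
qed

section \<open>Nondegeneracy of the step law\<close>

lemma m_inv_Z2_group: "inv\<^bsub>Z2_group\<^esub> x = - x"
  unfolding m_inv_def Z2_group_def
  by (rule the_equality) (auto dest: minus_unique)

lemma rvec_minus: "rvec (- x) = - rvec x"
  by (simp add: rvec_def vec_eq_iff)

lemma subgroup_orthogonal: "subgroup {x. z \<bullet> rvec x = 0} Z2_group"
proof (rule subgroup.intro)
  show "{x. z \<bullet> rvec x = 0} \<subseteq> carrier Z2_group"
    by (simp add: Z2_group_def)
  show "\<one>\<^bsub>Z2_group\<^esub> \<in> {x. z \<bullet> rvec x = 0}"
    by (simp add: Z2_group_def rvec_0)
  show "x \<otimes>\<^bsub>Z2_group\<^esub> y \<in> {x. z \<bullet> rvec x = 0}" if "x \<in> {x. z \<bullet> rvec x = 0}" "y \<in> {x. z \<bullet> rvec x = 0}" for x y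
    using that by (simp add: Z2_group_def rvec_add inner_add_right)
  show "inv\<^bsub>Z2_group\<^esub> x \<in> {x. z \<bullet> rvec x = 0}" if "x \<in> {x. z \<bullet> rvec x = 0}" for x
    using that by (simp add: m_inv_Z2_group rvec_minus)
qed

lemma inner_rvec: "z \<bullet> rvec x = z $ 1 * real_of_int (x $ 1) + z $ 2 * real_of_int (x $ 2)"
  by (simp add: rvec_def inner_vec_def sum_2)

text \<open>The lattice points orthogonal to z form a proper subgroup, which by aperiodicity cannot
  contain the support.\<close>

lemma aperiodic_support_nondegenerate:
  assumes ap: "aperiodic_walk N \<xi>" and supp: "set_pmf \<mu> = {x. \<P>(\<omega> in N. \<xi> \<omega> = x) > 0}"
    and z: "z \<noteq> 0"
  shows "\<exists>x\<in>set_pmf \<mu>. z \<bullet> rvec x \<noteq> 0"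
proof (rule ccontr)
  assume c: "\<not> ?thesis"
  have "{x. z \<bullet> rvec x = 0} \<noteq> UNIV"
  proof
    assume u: "{x. z \<bullet> rvec x = 0} = UNIV"
    have "z $ i = 0" for i
    proof -
      have "z \<bullet> rvec (axis i 1) = 0" using u by blast
      moreover have "rvec (axis i 1) = axis i 1" by (simp add: rvec_def axis_def vec_eq_iff)
      ultimately show ?thesis by (simp add: inner_axis)
    qed
    then show False using z by (simp add: vec_eq_iff)
  qed
  moreover have "{x. \<P>(\<omega> in N. \<xi> \<omega> = x) > 0} \<subseteq> {x. z \<bullet> rvec x = 0}"
    using c supp by auto
  ultimately show False using ap subgroup_orthogonal[of z] unfolding aperiodic_walk_def by blast
qed

text \<open>Nondegeneracy excludes lines through the origin only: (1, 0) and (0, 1) generate the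
  lattice but are collinear. Centring excludes the other lines, for if all atoms lie on one line,
  then z \<bullet> x is constant on the support for some z \<noteq> 0, and this constant is the mean
  0.\<close>

lemma noncollinear_atoms:
  assumes nd: "\<And>z. z \<noteq> 0 \<Longrightarrow> \<exists>x\<in>set_pmf \<mu>. z \<bullet> rvec x \<noteq> 0"
    and int: "integrable (measure_pmf \<mu>) rvec" and mean: "(\<integral>y. rvec y \<partial>measure_pmf \<mu>) = 0"
  shows "\<exists>x0 v1 v2. x0 \<in> set_pmf \<mu> \<and> x0 + v1 \<in> set_pmf \<mu> \<and> x0 + v2 \<in> set_pmf \<mu>
    \<and> v1 $ 1 * v2 $ 2 - v1 $ 2 * v2 $ 1 \<noteq> (0::int)"
proof (rule ccontr)
  assume "\<not> ?thesis"
  then have col: "v1 $ 1 * v2 $ 2 - v1 $ 2 * v2 $ 1 = 0"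
    if "x0 \<in> set_pmf \<mu>" "x0 + v1 \<in> set_pmf \<mu>" "x0 + v2 \<in> set_pmf \<mu>" for x0 v1 v2
    using that by blast
  obtain x0 where x0: "x0 \<in> set_pmf \<mu>" using set_pmf_not_empty[of \<mu>] by blast
  obtain z :: R2 where z: "z \<noteq> 0" "\<And>x. x \<in> set_pmf \<mu> \<Longrightarrow> z \<bullet> rvec x = z \<bullet> rvec x0"
  proof (cases "\<exists>x1\<in>set_pmf \<mu>. x1 \<noteq> x0")
    case True
    then obtain x1 where x1: "x1 \<in> set_pmf \<mu>" "x1 \<noteq> x0" by blast
    define d where "d = x1 - x0"
    \<comment> \<open>The direction d turned by a right angle; collinearity with d is orthogonality
      to z.\<close>
    define z :: R2 where "z = vector [- real_of_int (d $ 2), real_of_int (d $ 1)]"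
    have zc: "z $ 1 = - real_of_int (d $ 2)" "z $ 2 = real_of_int (d $ 1)"
      by (simp_all add: z_def vector_2)
    have "d \<noteq> 0" using x1 by (simp add: d_def)
    then have "d $ 1 \<noteq> 0 \<or> d $ 2 \<noteq> 0" by (auto simp: vec_eq_iff forall_2)
    then have "z \<noteq> 0" using zc by (auto simp: vec_eq_iff forall_2)
    moreover have "z \<bullet> rvec x = z \<bullet> rvec x0" if "x \<in> set_pmf \<mu>" for x
    proof -
      have "d $ 1 * (x - x0) $ 2 - d $ 2 * (x - x0) $ 1 = 0"
        using col[of x0 d "x - x0"] x0 x1 that by (simp add: d_def)
      then have "real_of_int (d $ 1 * (x - x0) $ 2 - d $ 2 * (x - x0) $ 1) = 0" by simp
      then show ?thesis by (simp add: inner_rvec zc algebra_simps)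
    qed
    ultimately show ?thesis by (rule that)
  next
    case False
    show ?thesis
    proof (rule that[of "axis 1 1"])
      show "axis 1 1 \<noteq> (0 :: R2)" by (simp add: axis_eq_0_iff)
      show "axis 1 1 \<bullet> rvec x = axis 1 1 \<bullet> rvec x0" if "x \<in> set_pmf \<mu>" for x
        using False that by metis
    qed
  qed
  have "(\<integral>x. z \<bullet> rvec x \<partial>measure_pmf \<mu>) = (\<integral>x. z \<bullet> rvec x0 \<partial>measure_pmf \<mu>)"
    by (rule integral_cong_AE) (auto simp: AE_measure_pmf_iff z)
  moreover have "(\<integral>x. z \<bullet> rvec x \<partial>measure_pmf \<mu>) = 0"
    using int mean by simp
  ultimately have "z \<bullet> rvec x0 = 0" by simp
  with z nd show False by force
qed

lemma qform_pos:
  assumes nd: "\<And>z. z \<noteq> 0 \<Longrightarrow> \<exists>x\<in>set_pmf \<mu>. z \<bullet> rvec x \<noteq> 0"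
    and int: "integrable (measure_pmf \<mu>) (\<lambda>y. (norm (rvec y))\<^sup>2)" and z: "z \<noteq> 0"
  shows "0 < qform \<mu> z"
proof -
  obtain x where x: "x \<in> set_pmf \<mu>" "z \<bullet> rvec x \<noteq> 0" using nd[OF z] by blast
  have "qform \<mu> z \<noteq> 0"
  proof
    assume "qform \<mu> z = 0"
    then have "AE y in measure_pmf \<mu>. (z \<bullet> rvec y)\<^sup>2 = 0"
      unfolding qform_def using integrable_rvec_inner(1)[OF int]
      by (subst (asm) integral_nonneg_eq_0_iff_AE) auto
    then show False using x by (auto simp: AE_measure_pmf_iff)
  qed
  then show ?thesis using qform_nonneg[of \<mu> z] by linarith
qed

section \<open>Covariance form and tail condition\<close>

lemma covariance_matrix_qform:
  assumes N: "prob_space N" and \<xi>: "\<xi> \<in> measurable N (count_space UNIV)"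
    and int: "integrable (measure_pmf (law N \<xi>)) (\<lambda>y. (norm (rvec y))\<^sup>2)"
    and mean: "(\<integral>y. rvec y \<partial>measure_pmf (law N \<xi>)) = 0"
  shows "(covariance_matrix N (\<lambda>\<omega>. rvec (\<xi> \<omega>)) *v z) \<bullet> z = qform (law N \<xi>) z"
proof -
  let ?\<mu> = "law N \<xi>"
  define c where "c i j = (\<integral>y. rvec y $ i * rvec y $ j \<partial>measure_pmf ?\<mu>)" for i j
  have m: "(\<integral>\<omega>. rvec (\<xi> \<omega>) $ i \<partial>N) = 0" for i
  proof -
    have "(\<integral>\<omega>. rvec (\<xi> \<omega>) $ i \<partial>N) = (\<integral>y. axis i 1 \<bullet> rvec y \<partial>measure_pmf ?\<mu>)"
      using integral_law[OF N \<xi>, of "\<lambda>y. axis i 1 \<bullet> rvec y"] by (simp add: inner_axis')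
    also have "\<dots> = 0" using integrable_rvec_inner(3)[OF int] mean by simp
    finally show ?thesis .
  qed
  have cov: "covariance_matrix N (\<lambda>\<omega>. rvec (\<xi> \<omega>)) $ i $ j = c i j" for i j
    using integral_law[OF N \<xi>, of "\<lambda>y. rvec y $ i * rvec y $ j"] by (simp add: covariance_matrix_def m c_def)
  have ic: "integrable (measure_pmf ?\<mu>) (\<lambda>y. rvec y $ i * rvec y $ j)" for i j
  proof (rule Bochner_Integration.integrable_bound[OF int])
    show "AE y in measure_pmf ?\<mu>. norm (rvec y $ i * rvec y $ j) \<le> norm ((norm (rvec y))\<^sup>2)"
    proof (rule AE_I2)
      fix y
      have "\<bar>rvec y $ i\<bar> * \<bar>rvec y $ j\<bar> \<le> norm (rvec y) * norm (rvec y)"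
        by (intro mult_mono component_le_norm_cart) auto
      then show "norm (rvec y $ i * rvec y $ j) \<le> norm ((norm (rvec y))\<^sup>2)"
        by (simp add: abs_mult power2_eq_square)
    qed
  qed simp
  have "qform ?\<mu> z = (\<integral>y. (z $ 1)\<^sup>2 * (rvec y $ 1 * rvec y $ 1) + 2 * (z $ 1 * z $ 2) * (rvec y $ 1 * rvec y $ 2)
      + (z $ 2)\<^sup>2 * (rvec y $ 2 * rvec y $ 2) \<partial>measure_pmf ?\<mu>)"
    unfolding qform_def
    by (rule Bochner_Integration.integral_cong) (simp_all add: inner_vec_def sum_2 power2_eq_square algebra_simps)
  also have "\<dots> = (z $ 1)\<^sup>2 * c 1 1 + 2 * (z $ 1 * z $ 2) * c 1 2 + (z $ 2)\<^sup>2 * c 2 2"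
    by (simp add: c_def ic)
  finally have q: "qform ?\<mu> z = (z $ 1)\<^sup>2 * c 1 1 + 2 * (z $ 1 * z $ 2) * c 1 2 + (z $ 2)\<^sup>2 * c 2 2" .
  have "c 2 1 = c 1 2" unfolding c_def by (simp add: mult.commute)
  then show ?thesis
    unfolding q by (simp add: matrix_vector_mult_def inner_vec_def sum_2 cov power2_eq_square algebra_simps)
qed

lemma tail_log_tendsto:
  fixes p :: "'a \<Rightarrow> real \<Rightarrow> real"
  assumes A: "finite A" "a \<in> A" and nonneg: "\<And>t. 0 \<le> p a t"
    and o: "(\<lambda>t. Max (insert 0 ((\<lambda>x. p x t) ` A))) \<in> o[at_top](\<lambda>t. 1 / ln t)"
  shows "((\<lambda>t. p a t * ln t) \<longlongrightarrow> 0) at_top"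
proof -
  let ?m = "\<lambda>t. Max (insert 0 ((\<lambda>x. p x t) ` A))"
  have ln: "\<forall>\<^sub>F t in at_top. 0 < ln (t::real)"
    using eventually_gt_at_top[of 1] by eventually_elim simp
  have "((\<lambda>t. ?m t / (1 / ln t)) \<longlongrightarrow> 0) at_top"
    by (rule smalloD_tendsto[OF o])
  moreover have "\<forall>\<^sub>F t in at_top. norm (p a t * ln t) \<le> ?m t / (1 / ln t)"
    using ln
  proof eventually_elim
    case (elim t)
    have "p a t \<le> ?m t" using A by (intro Max_ge) auto
    then show ?case using elim nonneg[of t] by (simp add: abs_mult mult_right_mono)
  qed
  ultimately show ?thesis by (rule Lim_null_comparison[rotated])
qed

theorem theorem2p1:
  fixes N :: "'a measure" and \<xi> :: "'a \<Rightarrow> Z2"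
    and A :: "Z2 set"
    and N' :: "Z2 \<Rightarrow> 'b measure" and \<eta> :: "Z2 \<Rightarrow> 'b \<Rightarrow> Z2"
    and M :: "'c measure" and X :: "nat \<Rightarrow> 'c \<Rightarrow> Z2"
    and B :: "'d measure" and W :: "real \<Rightarrow> 'd \<Rightarrow> R2"
    and \<Gamma> :: "real ^ 2 ^ 2"
  assumes "prob_space N" and "\<xi> \<in> measurable N (count_space UNIV)"
    and "finite A"
    and "\<And>x. x \<in> A \<Longrightarrow> prob_space (N' x)"
    and "\<And>x. x \<in> A \<Longrightarrow> \<eta> x \<in> measurable (N' x) (count_space UNIV)"
    and "prob_space M" and "markov_chain M X (perturbed_kernel N \<xi> N' \<eta> A)"
    and "(\<integral>\<omega>. rvec (\<xi> \<omega>) \<partial>N) = 0"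
    and "integrable N (\<lambda>\<omega>. (norm (rvec (\<xi> \<omega>)))\<^sup>2)"
    and "condition_B N \<xi> N' \<eta> A"
    \<comment> \<open>inserting 0 only matters for empty \<open>A\<close>, where the maximum is read as 0\<close>
    and "(\<lambda>t::real. Max (insert 0 ((\<lambda>x. \<P>(\<omega> in N' x. norm (rvec (\<eta> x \<omega>)) > t)) ` A)))
           \<in> o[at_top](\<lambda>t. 1 / ln t)"
    and "\<Gamma> = covariance_matrix N (\<lambda>\<omega>. rvec (\<xi> \<omega>))"
    and "wiener_process B W \<Gamma>"
  shows "invertible \<Gamma> \<and>
    converges_weakly j1_topology M (rescaled_path X) B (sample_path W)"
proof -
  note N = assms(1) and \<xi> = assms(2) and A = assms(3) and N' = assms(4) and \<eta> = assms(5)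
  define \<mu> where "\<mu> = law N \<xi>"
  \<comment> \<open>The transition probabilities as a kernel of discrete laws: from x in A the jump
    is that of \<eta> x, elsewhere that of \<xi>.\<close>
  define K where "K x = (if x \<in> A then map_pmf ((+) x) (law (N' x) (\<eta> x)) else walk \<mu> x)" for x
  have shift: "pmf (map_pmf ((+) x) p) y = pmf p (y - x)" for x y and p :: "Z2 pmf"
    using pmf_map_inj'[of "(+) x" p "y - x"] by simp
  have kernel: "perturbed_kernel N \<xi> N' \<eta> A = (\<lambda>x y. pmf (K x) y)"
    by (intro ext) (simp add: perturbed_kernel_def K_def walk_def \<mu>_def shift pmf_law[OF N \<xi>] pmf_law[OF N' \<eta>])
  have int: "integrable (measure_pmf \<mu>) (\<lambda>y. (norm (rvec y))\<^sup>2)"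
    unfolding \<mu>_def using assms(9) by (simp add: integrable_law[OF N \<xi>])
  have mean: "(\<integral>y. rvec y \<partial>measure_pmf \<mu>) = 0"
    unfolding \<mu>_def using assms(8) by (simp add: integral_law[OF N \<xi>])
  have supp: "set_pmf \<mu> = {x. \<P>(\<omega> in N. \<xi> \<omega> = x) > 0}"
    unfolding set_pmf_eq' \<mu>_def pmf_law[OF N \<xi>] ..
  have nd: "\<exists>x\<in>set_pmf \<mu>. z \<bullet> rvec x \<noteq> 0" if "z \<noteq> 0" for z
    using aperiodic_support_nondegenerate[OF _ supp that] assms(10) by (simp add: condition_B_def)
  obtain x0 v1 v2 where atoms: "x0 \<in> set_pmf \<mu>" "x0 + v1 \<in> set_pmf \<mu>" "x0 + v2 \<in> set_pmf \<mu>"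
    and det: "v1 $ 1 * v2 $ 2 - v1 $ 2 * v2 $ 1 \<noteq> 0"
    using noncollinear_atoms[OF nd integrable_rvec_inner(3)[OF int] mean] by blast
  \<comment> \<open>The least mass of three noncollinear atoms; it fixes the concentration constant
    c = q / 2.\<close>
  define q where "q = Min {pmf \<mu> x0, pmf \<mu> (x0 + v1), pmf \<mu> (x0 + v2)}"
  have q: "0 < q" using atoms by (simp add: q_def pmf_positive_iff)
  have q_le: "q \<le> pmf \<mu> x0" "q \<le> pmf \<mu> (x0 + v1)" "q \<le> pmf \<mu> (x0 + v2)"
    by (simp_all add: q_def)
  have conc: "pmf (kpow (walk \<mu>) k x) z \<le> 1 / (1 + q / 2 * real k)" for k x z
    by (rule walk_concentration[OF det q_le q])
  have acc: "\<exists>j. y \<in> set_pmf (kpow K j a)" if "a \<in> A" "y \<notin> A" for a y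
  proof -
    have "accessible (\<lambda>x y. pmf (K x) y) a y"
      using assms(10) that unfolding condition_B_def kernel by blast
    then show ?thesis unfolding accessible_def using n_step_pos_imp_set_pmf[of K] by blast
  qed
  have "\<exists>C\<ge>0. \<forall>n\<ge>2. \<forall>x. visits K A n x \<le> C * ln (real n)"
    by (rule visits_log_bound[OF conc _ A _ acc]) (use q in \<open>auto simp: K_def\<close>)
  then obtain C where C: "0 \<le> C" "\<And>n x. 2 \<le> n \<Longrightarrow> visits K A n x \<le> C * ln (real n)"
    by blast
  have tails: "((\<lambda>t. measure (measure_pmf (K a)) {y. norm (rvec (y - a)) > t} * ln t) \<longlongrightarrow> 0) at_top" if a: "a \<in> A" for a
  proof -
    have "measure (measure_pmf (K a)) {y. norm (rvec (y - a)) > t} = \<P>(\<omega> in N' a. norm (rvec (\<eta> a \<omega>)) > t)" for t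
      using a by (simp add: K_def measure_map_pmf vimage_def measure_law[OF N'[OF a] \<eta>[OF a]])
    then show ?thesis
      using tail_log_tendsto[where p = "\<lambda>x t. \<P>(\<omega> in N' x. norm (rvec (\<eta> x \<omega>)) > t)", OF A a _ assms(11)] by simp
  qed
  interpret perturbed_chain \<mu> K A C M X
  proof (intro perturbed_chain.intro perturbed_walk.intro chain.intro chain_axioms.intro)
    show "markov_chain M X (\<lambda>x y. pmf (K x) y)" using assms(7) unfolding kernel .
  qed (use A mean int tails C assms(6) in \<open>auto simp: K_def\<close>)
  have \<Gamma>: "(\<Gamma> *v z) \<bullet> z = qform \<mu> z" for z
    unfolding assms(12) \<mu>_def
    by (rule covariance_matrix_qform[OF N \<xi>]) (use int mean in \<open>simp_all add: \<mu>_def\<close>)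
  \<comment> \<open>The quadratic form of \<open>\<Gamma>\<close> is positive off 0, so its kernel
    is trivial.\<close>
  have "invertible \<Gamma>"
    unfolding invertible_left_inverse matrix_left_invertible_ker
    using qform_pos[OF nd int] \<Gamma> by (metis inner_zero_left less_irrefl)
  then show ?thesis using functional_limit[OF assms(13) \<Gamma>] by blast
qed

end
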